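(* Let $\mathcal{R}$ be a local ring of characteristic zero with residue field $L$ of characteristic $p>0$, and let $\Gamma$ be an arithmetic subgroup of $G(K)$. Then the natural $\mathcal{R}$-linear map (reduction of values modulo the maximal ideal of $\mathcal{R}$) $$\underline{H}^2(\mathcal{R})^\Gamma\longrightarrow\underline{H}^2(L)^\Gamma$$ is surjective.
   Context: All rings are commutative with unit. $K$ is a global field of characteristic $p>0$ (a function field of one variable over a finite field; the same $p$ as the characteristic of $L$) with a marked place $\infty$; $K_\infty$ is its completion at $\infty$; $A$ is the subring of $K$ of elements regular away from $\infty$. $G=GL_2$. A subgroup $\Gamma$ of $G(K)$ is arithmetic if $\Gamma\cap G(A)$ is commensurable with both $\Gamma$ and $G(A)$ (i.e. of finite index in both). $\tau$ is the Bruhat–Tits tree of $G(K_\infty)$, with its left $G(K_\infty)$-action; edges are oriented; for an edge $e$, $e(0)$ is its origin and $-e$ is the reversed edge. For a ring $R$, $\underline{H}^2(R)$ is the $R$-module of $R$-harmonic cocycles of weight $2$: functions $f$ from the edges of $\tau$ to $R$ such that $f(-e)=-f(e)$ for all edges $e$ and $\sum_{e(0)=v}f(e)=0$ for all vertices $v$. $G(K_\infty)$ acts by $g(f)(e)=f(g^{-1}e)$, and $\underline{H}^2(R)^\Gamma$ is the submodule of $\Gamma$-invariants. *)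

theory Defs
  imports
    "HOL-Analysis.Analysis"
    "HOL-Algebra.Coset"
    "HOL-Computational_Algebra.Computational_Algebra"
begin

section \<open>Rings and fields\<close>

definition is_ring_hom :: "('a::comm_ring_1 \<Rightarrow> 'b::comm_ring_1) \<Rightarrow> bool" where
  "is_ring_hom f \<longleftrightarrow> f 1 = 1 \<and> (\<forall>x y. f (x + y) = f x + f y) \<and> (\<forall>x y. f (x * y) = f x * f y)"

definition is_ideal :: "'a::comm_ring_1 set \<Rightarrow> bool" where
  "is_ideal I \<longleftrightarrow> 0 \<in> I \<and> (\<forall>x\<in>I. \<forall>y\<in>I. x + y \<in> I) \<and> (\<forall>r. \<forall>x\<in>I. r * x \<in> I)"

definition is_maximal_ideal :: "'a::comm_ring_1 set \<Rightarrow> bool" where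
  "is_maximal_ideal I \<longleftrightarrow>
     is_ideal I \<and> I \<noteq> UNIV \<and> (\<forall>J. is_ideal J \<and> I \<subseteq> J \<longrightarrow> J = I \<or> J = UNIV)"

definition local_ring :: "'a::comm_ring_1 itself \<Rightarrow> bool" where
  "local_ring _ \<longleftrightarrow> (\<exists>!m :: 'a set. is_maximal_ideal m)"

text \<open>A residue field of a local ring is given by its projection: a surjective ring
  homomorphism to a field whose kernel is the maximal ideal.\<close>

definition residue_map :: "('r::comm_ring_1 \<Rightarrow> 'l::field) \<Rightarrow> bool" where
  "residue_map \<rho> \<longleftrightarrow> is_ring_hom \<rho> \<and> surj \<rho> \<and> is_maximal_ideal {x. \<rho> x = 0}"

definition is_subfield :: "'a::field set \<Rightarrow> bool" where
  "is_subfield F \<longleftrightarrow> 1 \<in> F \<and> (\<forall>x\<in>F. \<forall>y\<in>F. x - y \<in> F \<and> x * y \<in> F) \<and> (\<forall>x\<in>F. inverse x \<in> F)"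

definition field_adjoin :: "'a::field set \<Rightarrow> 'a \<Rightarrow> 'a set" where
  "field_adjoin F t = \<Inter>{E. is_subfield E \<and> F \<subseteq> E \<and> t \<in> E}"

definition transcendental_over :: "'a::field set \<Rightarrow> 'a \<Rightarrow> bool" where
  "transcendental_over F t \<longleftrightarrow> (\<forall>P. (\<forall>i. coeff P i \<in> F) \<and> P \<noteq> 0 \<longrightarrow> poly P t \<noteq> 0)"

text \<open>A function field of one variable over a finite field, i.e. a finite extension of
  some \<open>F(t)\<close> with \<open>F\<close> finite and \<open>t\<close> transcendental over \<open>F\<close>.\<close>

definition global_function_field :: "'a::field itself \<Rightarrow> bool" where
  "global_function_field _ \<longleftrightarrow>
     (\<exists>(F :: 'a set) t B. is_subfield F \<and> finite F \<and> transcendental_over F t \<and> finite B \<and>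
        (\<forall>x. \<exists>c. (\<forall>b\<in>B. c b \<in> field_adjoin F t) \<and> x = (\<Sum>b\<in>B. c b * b)))"

section \<open>Places and completions\<close>

text \<open>Places are represented by normalised discrete valuations. The value at \<open>0\<close>, which
  should be infinite, is fixed to the junk value \<open>0\<close>, so that distinct valuations
  are distinct places.  On a global function field every valuation is trivial on the finite field
  of constants.\<close>

definition discrete_valuation :: "('a::field \<Rightarrow> int) \<Rightarrow> bool" where
  "discrete_valuation v \<longleftrightarrow>
     v 0 = 0 \<and>
     (\<forall>x y. x \<noteq> 0 \<and> y \<noteq> 0 \<longrightarrow> v (x * y) = v x + v y) \<and>
     (\<forall>x y. x \<noteq> 0 \<and> y \<noteq> 0 \<and> x + y \<noteq> 0 \<longrightarrow> min (v x) (v y) \<le> v (x + y)) \<and>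
     v ` (UNIV - {0}) = UNIV"

definition valuation_ring :: "('a::field \<Rightarrow> int) \<Rightarrow> 'a set" where
  "valuation_ring v = {x. x = 0 \<or> 0 \<le> v x}"

definition regular_away :: "('a::field \<Rightarrow> int) \<Rightarrow> 'a set" where
  "regular_away v = (\<Inter>w \<in> {w. discrete_valuation w \<and> w \<noteq> v}. valuation_ring w)"

definition val_dist :: "('a::field \<Rightarrow> int) \<Rightarrow> 'a \<Rightarrow> 'a \<Rightarrow> real" where
  "val_dist v x y = (if x = y then 0 else 2 powr (- real_of_int (v (x - y))))"

definition is_completion ::
    "('k::field \<Rightarrow> int) \<Rightarrow> ('c::field \<Rightarrow> int) \<Rightarrow> ('k \<Rightarrow> 'c) \<Rightarrow> bool" where
  "is_completion v w \<iota> \<longleftrightarrow>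
     is_ring_hom \<iota> \<and> discrete_valuation w \<and> (\<forall>x. w (\<iota> x) = v x) \<and>
     Metric_space.mtopology UNIV (val_dist w) closure_of (range \<iota>) = UNIV \<and>
     Metric_space.mcomplete UNIV (val_dist w)"

section \<open>Arithmetic subgroups of \<open>GL\<^sub>2\<close>\<close>

definition GL2 :: "('a::field^2^2) monoid" where
  "GL2 = \<lparr>carrier = {g. invertible g}, monoid.mult = (**), one = mat 1\<rparr>"

definition GL2_over :: "'a::field set \<Rightarrow> ('a^2^2) set" where
  "GL2_over A = {g. invertible g \<and> (\<forall>i j. g $ i $ j \<in> A) \<and> (\<forall>i j. matrix_inv g $ i $ j \<in> A)}"

definition finite_index :: "('a, 'b) monoid_scheme \<Rightarrow> 'a set \<Rightarrow> 'a set \<Rightarrow> bool" where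
  "finite_index G H U \<longleftrightarrow> U \<subseteq> H \<and> finite (rcosets\<^bsub>G\<lparr>carrier := H\<rparr>\<^esub> U)"

definition arithmetic_subgroup :: "('k::field \<Rightarrow> int) \<Rightarrow> ('k^2^2) set \<Rightarrow> bool" where
  "arithmetic_subgroup v \<Gamma> \<longleftrightarrow>
     subgroup \<Gamma> GL2 \<and>
     finite_index GL2 \<Gamma> (\<Gamma> \<inter> GL2_over (regular_away v)) \<and>
     finite_index GL2 (GL2_over (regular_away v)) (\<Gamma> \<inter> GL2_over (regular_away v))"

section \<open>The Bruhat--Tits tree\<close>

text \<open>Throughout, \<open>w\<close> is the valuation of the local field.  A lattice is the span over the
  valuation ring of a basis of the plane, here the columns of \<open>g\<close>.  Vertices are homothety
  classes of lattices; as a tree has no multiple edges, an oriented edge is the ordered pair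
  (origin, terminus) of two adjacent vertices.\<close>

type_synonym 'c vertex = "('c^2) set set"
type_synonym 'c edge = "'c vertex \<times> 'c vertex"

definition is_lattice :: "('c::field \<Rightarrow> int) \<Rightarrow> ('c^2) set \<Rightarrow> bool" where
  "is_lattice w \<Lambda> \<longleftrightarrow>
     (\<exists>g :: 'c^2^2. invertible g \<and> \<Lambda> = (\<lambda>u. g *v u) ` {u. \<forall>i. u $ i \<in> valuation_ring w})"

definition scale_lattice :: "'c::field \<Rightarrow> ('c^2) set \<Rightarrow> ('c^2) set" where
  "scale_lattice c \<Lambda> = (\<lambda>u. c *s u) ` \<Lambda>"

definition homothety_class :: "('c::field^2) set \<Rightarrow> 'c vertex" where
  "homothety_class \<Lambda> = {scale_lattice c \<Lambda> | c. c \<noteq> 0}"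

definition vertices :: "('c::field \<Rightarrow> int) \<Rightarrow> 'c vertex set" where
  "vertices w = {homothety_class \<Lambda> | \<Lambda>. is_lattice w \<Lambda>}"

definition adjacent :: "('c::field \<Rightarrow> int) \<Rightarrow> 'c vertex \<Rightarrow> 'c vertex \<Rightarrow> bool" where
  "adjacent w V V' \<longleftrightarrow>
     (\<exists>\<Lambda>\<in>V. \<exists>\<Lambda>'\<in>V'. \<exists>\<pi>. w \<pi> = 1 \<and> scale_lattice \<pi> \<Lambda> \<subset> \<Lambda>' \<and> \<Lambda>' \<subset> \<Lambda>)"

definition edges :: "('c::field \<Rightarrow> int) \<Rightarrow> 'c edge set" where
  "edges w = {(V, V'). V \<in> vertices w \<and> V' \<in> vertices w \<and> adjacent w V V'}"

abbreviation origin :: "'c edge \<Rightarrow> 'c vertex" where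
  "origin \<equiv> fst"

abbreviation reversed :: "'c edge \<Rightarrow> 'c edge" where
  "reversed \<equiv> prod.swap"

definition vertex_action :: "'c::field^2^2 \<Rightarrow> 'c vertex \<Rightarrow> 'c vertex" where
  "vertex_action g V = (\<lambda>\<Lambda>. (\<lambda>u. g *v u) ` \<Lambda>) ` V"

definition edge_action :: "'c::field^2^2 \<Rightarrow> 'c edge \<Rightarrow> 'c edge" where
  "edge_action g e = map_prod (vertex_action g) (vertex_action g) e"

section \<open>Harmonic cocycles of weight 2\<close>

text \<open>A function on the edges is represented by its extension by zero to all pairs, so
  the module operations are the pointwise ones and the zero off the edges is preserved by
  the action and by reduction of values.  Over a local field with finite residue field the
  sums below are finite.\<close>

definition harmonic_cocycles :: "('c::field \<Rightarrow> int) \<Rightarrow> ('c edge \<Rightarrow> 'r::comm_ring_1) set" where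
  "harmonic_cocycles w =
     {f. (\<forall>e. e \<notin> edges w \<longrightarrow> f e = 0) \<and>
         (\<forall>e\<in>edges w. f (reversed e) = - f e) \<and>
         (\<forall>V\<in>vertices w. (\<Sum>e | e \<in> edges w \<and> origin e = V. f e) = 0)}"

definition cochain_action ::
    "'c::field^2^2 \<Rightarrow> ('c edge \<Rightarrow> 'r::comm_ring_1) \<Rightarrow> 'c edge \<Rightarrow> 'r" where
  "cochain_action g f = (\<lambda>e. f (edge_action (matrix_inv g) e))"

definition invariant_cocycles ::
    "('c::field \<Rightarrow> int) \<Rightarrow> ('c^2^2) set \<Rightarrow> ('c edge \<Rightarrow> 'r::comm_ring_1) set" where
  "invariant_cocycles w \<Gamma> = {f \<in> harmonic_cocycles w. \<forall>g\<in>\<Gamma>. cochain_action g f = f}"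

end

theory Submission
  imports Defs
begin

text \<open>
  A \<open>\<Gamma>\<close>-invariant cocycle over the residue field lifts to an alternating \<open>\<Gamma>\<close>-invariant function,
  because \<open>\<Gamma>\<close> preserves the parity of vertices and so orients all edges.  Its divergence takes values
  in the maximal ideal, and has to be cancelled by an invariant flow with values in that ideal.

  Let \<open>N\<close> be a discrete \<open>\<Gamma>\<close>-stable subgroup of \<open>K\<^sup>2\<close> commensurable with \<open>A\<^sup>2\<close>.  In the homothety class of
  a vertex there is a smallest lattice \<open>\<Lambda>\<close> meeting \<open>N\<close>; the number of nonzero vectors in
  \<open>N \<inter> \<Lambda>\<close> is \<open>-1\<close> modulo \<open>p\<close>, hence a unit in the local ring.  Each such vector \<open>x\<close> selects the neighbour
  \<open>\<pi>\<Lambda> + Ox\<close>, whose smallest lattice has strictly smaller covolume, while by an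
  analogue of Minkowski's theorem the covolumes are bounded.  Spreading the flow at each vertex
  evenly over its vectors is therefore a well-founded recursion, equivariant without any choice.
  The arithmetic input is that \<open>A\<close> is discrete in the completion with bounded fundamental
  domain.
\<close>


text \<open>The obstacle is \<open>p\<close>-torsion: stabilisers in \<Gamma> of vertices and edges
  may have order divisible by \<open>p\<close>, so a solution can neither be averaged over them nor
  chosen freely on orbit representatives. The flow is therefore built only from data that \<Gamma>
  permutes. It need not stay in a finite part of the quotient: it runs off to infinity in the
  direction of growing \<open>ldet\<close>, that is, of shrinking lattices, and the lower bound for
  \<open>ldet\<close> leaves only finitely many steps behind each vertex. The arithmetic of function
  fields is derived without divisors or Riemann-Roch. Its source is one count,
  \<open>poly_dependence\<close>: for each \<open>s\<close> some \<open>k\<close> makes any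
  \<open>k\<close> elements dependent over \<open>F[s]\<close>. This bounds residue fields, the
  number of poles of an element and the ramification over \<open>s\<close>; the last turns a maximal
  subring omitting \<open>1/s\<close> into a discrete valuation. Hence every transcendental element
  has a zero, which makes \<open>A\<close> discrete, while division with remainder in
  \<open>F[s]\<close> gives the bounded fundamental domain.\<close>

section \<open>Values and balls of a discrete valuation\<close>

text \<open>Zero is adjoined by hand because its junk value \<open>v 0 = 0\<close> would exclude it
  from the balls with \<open>n > 0\<close>. These sets are the powers, positive and negative, of the
  maximal ideal of the valuation ring.\<close>

definition vball :: "('a::field \<Rightarrow> int) \<Rightarrow> int \<Rightarrow> 'a set" where
  "vball v n = {x. x = 0 \<or> n \<le> v x}"

lemma valuation_ring_eq_vball: "valuation_ring v = vball v 0"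
  by (simp add: valuation_ring_def vball_def)

locale valued_field =
  fixes v :: "'a::field \<Rightarrow> int"
  assumes dv: "discrete_valuation v"
begin

lemma val_0 [simp]: "v 0 = 0"
  using dv by (simp add: discrete_valuation_def)

lemma val_mult: "x \<noteq> 0 \<Longrightarrow> y \<noteq> 0 \<Longrightarrow> v (x * y) = v x + v y"
  using dv by (simp add: discrete_valuation_def)

lemma val_add: "x \<noteq> 0 \<Longrightarrow> y \<noteq> 0 \<Longrightarrow> x + y \<noteq> 0 \<Longrightarrow> min (v x) (v y) \<le> v (x + y)"
  using dv by (simp add: discrete_valuation_def)

lemma val_surj: obtains x where "x \<noteq> 0" "v x = n"
proof -
  have "n \<in> v ` (UNIV - {0})" using dv by (simp add: discrete_valuation_def)
  then show ?thesis using that by auto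
qed

lemma val_1 [simp]: "v 1 = 0"
  using val_mult[of 1 1] by simp

lemma val_minus [simp]: "v (- x) = v x"
proof (cases "x = 0")
  case False
  have "v (-1) + v (-1) = 0" using val_mult[of "-1" "-1"] by simp
  then have "v (-1) = 0" by simp
  with False val_mult[of "-1" x] show ?thesis by simp
qed simp

lemma val_inverse [simp]: "v (inverse x) = - v x"
proof (cases "x = 0")
  case False
  then have "v (x * inverse x) = v x + v (inverse x)" by (intro val_mult) auto
  with False show ?thesis by simp
qed simp

lemma val_divide: "x \<noteq> 0 \<Longrightarrow> y \<noteq> 0 \<Longrightarrow> v (x / y) = v x - v y"
  using val_mult[of x "inverse y"] by (simp add: divide_inverse)

lemma val_power: "x \<noteq> 0 \<Longrightarrow> v (x ^ n) = int n * v x"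
  by (induction n) (auto simp: val_mult algebra_simps)

lemma val_pow_power_int: "x \<noteq> 0 \<Longrightarrow> v (x powi k) = k * v x"
  by (auto simp: power_int_def val_power)

lemma uniformizer: obtains \<pi> where "\<pi> \<noteq> 0" "v \<pi> = 1"
  using val_surj[of 1] by metis

lemma vball_0 [simp]: "0 \<in> vball v n"
  by (simp add: vball_def)

lemma vball_1 [simp]: "1 \<in> vball v 0"
  by (simp add: vball_def)

lemma vball_add: "x \<in> vball v n \<Longrightarrow> y \<in> vball v n \<Longrightarrow> x + y \<in> vball v n"
  using val_add[of x y] by (force simp: vball_def)

lemma vball_minus: "x \<in> vball v n \<Longrightarrow> - x \<in> vball v n"
  by (simp add: vball_def)

lemma vball_minus_iff [simp]: "- x \<in> vball v n \<longleftrightarrow> x \<in> vball v n"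
  by (simp add: vball_def)

lemma vball_diff: "x \<in> vball v n \<Longrightarrow> y \<in> vball v n \<Longrightarrow> x - y \<in> vball v n"
  using vball_add[of x n "- y"] by simp

lemma vball_commute: "x - y \<in> vball v n \<longleftrightarrow> y - x \<in> vball v n"
  using vball_minus_iff[of "x - y" n] by simp

lemma vball_mono: "x \<in> vball v n \<Longrightarrow> m \<le> n \<Longrightarrow> x \<in> vball v m"
  by (auto simp: vball_def)

lemma vball_mult: "x \<in> vball v n \<Longrightarrow> y \<in> vball v m \<Longrightarrow> x * y \<in> vball v (n + m)"
  by (cases "x = 0 \<or> y = 0") (auto simp: vball_def val_mult)

lemma vball_mult0: "x \<in> vball v 0 \<Longrightarrow> y \<in> vball v m \<Longrightarrow> x * y \<in> vball v m"
  using vball_mult[of x 0 y m] by simp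

lemma vball_mult_iff: "x \<noteq> 0 \<Longrightarrow> x * y \<in> vball v n \<longleftrightarrow> y \<in> vball v (n - v x)"
  by (cases "y = 0") (auto simp: vball_def val_mult)

lemma vball_sum: "(\<And>i. i \<in> I \<Longrightarrow> f i \<in> vball v n) \<Longrightarrow> sum f I \<in> vball v n"
  by (induction I rule: infinite_finite_induct) (auto intro: vball_add)

text \<open>Strict ultrametric inequality: a summand of larger value changes neither the value nor
  the non-vanishing. Were \<open>v (x + y)\<close> larger, subtracting \<open>y\<close> again would
  make \<open>v x\<close> larger too.\<close>

lemma val_add_eq:
  assumes "x \<noteq> 0" "y \<in> vball v (v x + 1)"
  shows "x + y \<noteq> 0" "v (x + y) = v x"
proof -
  show nz: "x + y \<noteq> 0"
  proof
    assume "x + y = 0"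
    then have "y = - x" by (simp add: eq_neg_iff_add_eq_0 add.commute)
    then show False using assms by (auto simp: vball_def)
  qed
  show "v (x + y) = v x"
  proof (cases "y = 0")
    case False
    then have y: "v x < v y" using assms by (auto simp: vball_def)
    have "v x \<le> v (x + y)" using val_add[of x y] assms False nz y by auto
    moreover have "min (v (x + y)) (v (- y)) \<le> v (x + y + - y)"
      using assms False nz by (intro val_add) auto
    ultimately show ?thesis using y by auto
  qed simp
qed

lemma val_one_add:
  assumes "x \<in> vball v 1"
  shows "1 + x \<noteq> 0" "v (1 + x) = 0"
  using val_add_eq[of 1 x] assms by auto

lemma val_eq_if_diff:
  assumes "x \<noteq> 0" "y - x \<in> vball v (v x + 1)"
  shows "y \<noteq> 0" "v y = v x"
  using val_add_eq[OF assms] by auto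

end

section \<open>Weak approximation\<close>

text \<open>A discrete valuation ring is a maximal proper subring of its field. Concretely, units of
  \<open>v\<close> become units of \<open>w\<close>, so \<open>w\<close> is a nonnegative multiple
  of \<open>v\<close>, and surjectivity onto the integers forces the factor 1.\<close>

lemma discrete_valuation_eqI:
  assumes "discrete_valuation v" "discrete_valuation w" "vball v 0 \<subseteq> vball w 0"
  shows "v = w"
proof -
  interpret v: valued_field v by unfold_locales fact
  interpret w: valued_field w by unfold_locales fact
  obtain \<pi> where pi: "\<pi> \<noteq> 0" "v \<pi> = 1" using v.uniformizer .
  have unit: "w x = 0" if "x \<noteq> 0" "v x = 0" for x
  proof -
    have "x \<in> vball v 0" "inverse x \<in> vball v 0" using that by (auto simp: vball_def)
    then have "x \<in> vball w 0" "inverse x \<in> vball w 0" using assms(3) by blast+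
    then show ?thesis using that by (auto simp: vball_def)
  qed
  have scal: "w x = w \<pi> * v x" if "x \<noteq> 0" for x
  proof -
    let ?u = "x * \<pi> powi (- v x)"
    have "v ?u = 0" using that pi by (simp add: v.val_mult v.val_pow_power_int)
    then have "w ?u = 0" using unit that pi by simp
    then have "w x + w (\<pi> powi (- v x)) = 0" using that pi by (subst (asm) w.val_mult) auto
    then show ?thesis using pi by (simp add: w.val_pow_power_int)
  qed
  obtain y where "y \<noteq> 0" "w y = 1" using w.uniformizer .
  then have "w \<pi> * v y = 1" using scal by simp
  moreover have "\<pi> \<in> vball v 0" using pi by (simp add: vball_def)
  then have "w \<pi> \<ge> 0" using assms(3) by (auto simp: vball_def)
  ultimately have "w \<pi> = 1" using pos_zmult_eq_1_iff[of "w \<pi>" "v y"]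
    by (cases "w \<pi> = 0") auto
  show ?thesis
  proof
    fix x show "v x = w x" using scal[of x] \<open>w \<pi> = 1\<close> by (cases "x = 0") auto
  qed
qed

lemma separating_element_pair:
  assumes "discrete_valuation v" "discrete_valuation w" "v \<noteq> w"
  obtains x where "x \<noteq> 0" "v x < 0" "w x > 0"
proof -
  interpret v: valued_field v by unfold_locales fact
  interpret w: valued_field w by unfold_locales fact
  obtain x where x: "x \<noteq> 0" "v x \<ge> 0" "w x < 0"
    using discrete_valuation_eqI[OF assms(1,2)] assms(3) unfolding vball_def by fastforce
  obtain y where y: "y \<noteq> 0" "w y \<ge> 0" "v y < 0"
    using discrete_valuation_eqI[OF assms(2,1)] assms(3) unfolding vball_def by fastforce
  show ?thesis
    using that[of "y / x"] x y by (simp add: v.val_divide w.val_divide)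
qed

text \<open>Induction on \<open>S\<close>. Given \<open>z\<close> for \<open>S\<close> and
  \<open>u\<close> separating \<open>v\<close> from the new \<open>w'\<close>, the element
  \<open>u\<close> is multiplied by \<open>z ^ N\<close> if \<open>w' z\<close> is nonnegative.
  Otherwise the factor is \<open>z ^ N / (1 + z ^ N)\<close>, which has value 0 at the poles of
  \<open>z\<close> and a high zero at the places of \<open>S\<close>.\<close>

lemma separating_element:
  assumes "discrete_valuation v" "finite S" "\<And>w. w \<in> S \<Longrightarrow> discrete_valuation w \<and> w \<noteq> v"
  shows "\<exists>z. z \<noteq> 0 \<and> v z < 0 \<and> (\<forall>w\<in>S. w z > 0)"
  using assms(2,3)
proof (induction S rule: finite_induct)
  case empty
  interpret v: valued_field v by unfold_locales fact
  obtain z where "z \<noteq> 0" "v z = -1" using v.val_surj .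
  then show ?case by (intro exI[of _ z]) auto
next
  case (insert w' S)
  interpret v: valued_field v by unfold_locales fact
  interpret w': valued_field w' using insert.prems by unfold_locales auto
  obtain z where z: "z \<noteq> 0" "v z < 0" "\<forall>w\<in>S. w z > 0" using insert by auto
  obtain u where u: "u \<noteq> 0" "v u < 0" "w' u > 0"
    using separating_element_pair[of v w'] assms(1) insert.prems by auto
  have "finite ((\<lambda>w. \<bar>w u\<bar>) ` S)" using insert.hyps by simp
  then obtain M where M: "\<And>w. w \<in> S \<Longrightarrow> \<bar>w u\<bar> \<le> M"
    using Max_ge by blast
  \<comment> \<open>Since \<open>w z\<close> is at least 1 on \<open>S\<close>, this exponent lets
    the zeros of \<open>z ^ N\<close> outweigh the possible poles of \<open>u\<close> there.\<close>
  define N where "N = nat M + 1"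
  have N: "\<bar>w u\<bar> < int N * w z" if "w \<in> S" for w
  proof -
    have "\<bar>w u\<bar> < int N" using M[OF that] abs_ge_zero[of "w u"] unfolding N_def by linarith
    moreover have "int N * 1 \<le> int N * w z" using z that by (intro mult_left_mono) auto
    ultimately show ?thesis by simp
  qed
  have N0: "N > 0" by (simp add: N_def)
  show ?case
  proof (cases "w' z \<ge> 0")
    case True
    let ?x = "u * z ^ N"
    have "v ?x < 0" using u z N0 by (simp add: v.val_mult v.val_power add_neg_neg mult_pos_neg)
    moreover have "w' ?x > 0" using u z True by (simp add: w'.val_mult w'.val_power add_pos_nonneg)
    moreover have "w ?x > 0" if "w \<in> S" for w
    proof -
      interpret w: valued_field w using insert.prems that by unfold_locales auto
      show ?thesis using N[OF that] u z by (simp add: w.val_mult w.val_power)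
    qed
    ultimately show ?thesis using u z by (intro exI[of _ ?x]) auto
  next
    case False
    have one: "1 + z ^ N \<noteq> 0 \<and> w (1 + z ^ N) = int N * w z" if "discrete_valuation w" "w z < 0" for w
    proof -
      interpret w: valued_field w by unfold_locales fact
      have "w (z ^ N) = int N * w z" using z by (simp add: w.val_power)
      moreover have "int N * w z < 0" using that N0 by (simp add: mult_pos_neg)
      ultimately show ?thesis using w.val_add_eq[of "z ^ N" 1] z by (auto simp: vball_def add.commute)
    qed
    let ?x = "u * (z ^ N / (1 + z ^ N))"
    have nz: "1 + z ^ N \<noteq> 0" using one[OF assms(1)] z by auto
    have "v ?x = v u" using u z nz one[OF assms(1)]
      by (simp add: v.val_mult v.val_divide v.val_power del: times_divide_eq_right)
    moreover have "w' ?x = w' u" using u z nz one[OF w'.dv] False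
      by (simp add: w'.val_mult w'.val_divide w'.val_power del: times_divide_eq_right)
    moreover have "w ?x > 0" if "w \<in> S" for w
    proof -
      interpret w: valued_field w using insert.prems that by unfold_locales auto
      have "w (z ^ N) > 0" using z that N0 by (simp add: w.val_power)
      then have "w (1 + z ^ N) = 0" using w.val_one_add[of "z ^ N"] by (simp add: vball_def)
      then show ?thesis using N[OF that] u z nz
        by (simp add: w.val_mult w.val_divide w.val_power del: times_divide_eq_right)
    qed
    ultimately show ?thesis using u z nz by (intro exI[of _ ?x]) auto
  qed
qed

text \<open>The quotient \<open>z ^ N / (1 + z ^ N)\<close> is close to 1 where \<open>z\<close> has
  a pole and close to 0 where it has a zero.\<close>

lemma weak_approximation:
  assumes "discrete_valuation v" "finite S" "\<And>w. w \<in> S \<Longrightarrow> discrete_valuation w \<and> w \<noteq> v"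
  shows "\<exists>\<theta>. \<theta> - 1 \<in> vball v (int n) \<and> (\<forall>w\<in>S. \<theta> \<in> vball w (int n))"
proof -
  interpret v: valued_field v by unfold_locales fact
  obtain z where z: "z \<noteq> 0" "v z < 0" "\<forall>w\<in>S. w z > 0"
    using separating_element[OF assms] by auto
  define N where "N = Suc n"
  have "v (z ^ N) = int N * v z" using z by (simp add: v.val_power)
  moreover have le: "int N * v z \<le> - int N" using z(2) mult_left_mono[of "v z" "-1" "int N"] by simp
  ultimately have v1: "1 + z ^ N \<noteq> 0" "v (1 + z ^ N) = int N * v z"
    using v.val_add_eq[of "z ^ N" 1] z by (auto simp: vball_def add.commute N_def)
  let ?x = "z ^ N / (1 + z ^ N)"
  have "?x - 1 = - (1 / (1 + z ^ N))" using v1 by (simp add: field_simps)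
  then have "v (?x - 1) = - (int N * v z)" using v1 by (simp add: v.val_divide)
  then have "?x - 1 \<in> vball v (int n)" using le by (simp add: vball_def N_def)
  moreover have "?x \<in> vball w (int n)" if "w \<in> S" for w
  proof -
    interpret w: valued_field w using assms that by unfold_locales auto
    have "0 < w z" using z that by blast
    then have wz: "w (z ^ N) \<ge> int N" using z mult_left_mono[of 1 "w z" "int N"] by (simp add: w.val_power)
    then have "w (1 + z ^ N) = 0" using w.val_one_add[of "z ^ N"] by (simp add: vball_def N_def)
    then have "w ?x = w (z ^ N)" using v1 z by (simp add: w.val_divide)
    then show ?thesis using wz by (simp add: vball_def N_def)
  qed
  ultimately show ?thesis by blast
qed

section \<open>Finite residue fields\<close>

text \<open>Exactly one element per residue class, so \<open>card D\<close> is the order of the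
  residue field, which is never formed as a quotient.\<close>

definition residue_reps :: "('a::field \<Rightarrow> int) \<Rightarrow> 'a set \<Rightarrow> bool" where
  "residue_reps v D \<longleftrightarrow> finite D \<and> D \<subseteq> vball v 0 \<and>
     (\<forall>x\<in>vball v 0. \<exists>d\<in>D. x - d \<in> vball v 1) \<and>
     (\<forall>d\<in>D. \<forall>d'\<in>D. d - d' \<in> vball v 1 \<longrightarrow> d = d')"

context valued_field
begin

text \<open>A finite cover may contain centres outside the valuation ring and several centres per
  class. One centre per class is selected by \<open>r\<close>, and \<open>q\<close> replaces it by
  an element of the ring.\<close>

lemma residue_repsI:
  assumes "finite D" "\<And>x. x \<in> vball v 0 \<Longrightarrow> \<exists>d\<in>D. x - d \<in> vball v 1"
  obtains D' where "residue_reps v D'"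
proof -
  define r where "r x = (SOME d. d \<in> D \<and> x - d \<in> vball v 1)" for x
  have r: "r x \<in> D \<and> x - r x \<in> vball v 1" if "x \<in> vball v 0" for x
    unfolding r_def by (rule someI_ex) (use assms(2)[OF that] in blast)
  define q where "q d = (SOME x. x \<in> vball v 0 \<and> r x = d)" for d
  have q: "q d \<in> vball v 0 \<and> r (q d) = d" if "d \<in> r ` vball v 0" for d
    unfolding q_def by (rule someI_ex) (use that in blast)
  \<comment> \<open>Congruent elements satisfy the same predicate under \<open>SOME\<close>, hence
    receive the same centre.\<close>
  have eq: "r x = r y" if "x \<in> vball v 0" "x - y \<in> vball v 1" "y \<in> vball v 0" for x y
  proof -
    have "x - d \<in> vball v 1 \<longleftrightarrow> y - d \<in> vball v 1" for d
    proof
      assume "x - d \<in> vball v 1"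
      from vball_diff[OF this that(2)] show "y - d \<in> vball v 1" by simp
    next
      assume "y - d \<in> vball v 1"
      from vball_add[OF this that(2)] show "x - d \<in> vball v 1" by simp
    qed
    then show ?thesis by (simp add: r_def)
  qed
  define R where "R = r ` vball v 0"
  define Q where "Q = q ` R"
  have "R \<subseteq> D" using r by (auto simp: R_def)
  then have "finite R" using assms(1) finite_subset by blast
  then have 1: "finite Q" by (simp add: Q_def)
  have 2: "Q \<subseteq> vball v 0" using q by (auto simp: Q_def R_def)
  have 3: "\<exists>d\<in>Q. x - d \<in> vball v 1" if x: "x \<in> vball v 0" for x
  proof -
    have qx: "q (r x) \<in> vball v 0" "r (q (r x)) = r x" using q x by blast+
    have "x - r x \<in> vball v 1" "q (r x) - r x \<in> vball v 1"
      using r[OF x] r[OF qx(1)] qx(2) by simp_all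
    then have "(x - r x) - (q (r x) - r x) \<in> vball v 1" by (rule vball_diff)
    then have "x - q (r x) \<in> vball v 1" by simp
    then show ?thesis using x unfolding Q_def R_def by blast
  qed
  have 4: "d = d'" if d: "d \<in> Q" "d' \<in> Q" "d - d' \<in> vball v 1" for d d'
  proof -
    obtain e e' where e: "d = q e" "d' = q e'" "e \<in> R" "e' \<in> R" using d unfolding Q_def by blast
    then have "r d = e" "r d' = e'" "d \<in> vball v 0" "d' \<in> vball v 0" using q unfolding R_def by blast+
    then show ?thesis using eq[of d d'] d e by simp
  qed
  have "residue_reps v Q" unfolding residue_reps_def using 1 2 3 4 by blast
  then show ?thesis using that by blast
qed

text \<open>Expansions with \<open>k\<close> digits from \<open>D\<close>; the next digit is scaled
  by an element of value \<open>n + k\<close>.\<close>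

lemma vball_finite_cover:
  assumes "residue_reps v D"
  shows "\<exists>T. finite T \<and> card T \<le> card D ^ k \<and> (\<forall>x\<in>vball v n. \<exists>t\<in>T. x - t \<in> vball v (n + int k))"
proof (induction k)
  case 0
  show ?case by (intro exI[of _ "{0}"]) auto
next
  case (Suc k)
  then obtain T where T: "finite T" "card T \<le> card D ^ k"
    "\<forall>x\<in>vball v n. \<exists>t\<in>T. x - t \<in> vball v (n + int k)" by blast
  have D: "finite D" "\<And>x. x \<in> vball v 0 \<Longrightarrow> \<exists>d\<in>D. x - d \<in> vball v 1"
    using assms by (auto simp: residue_reps_def)
  obtain p where p: "p \<noteq> 0" "v p = n + int k" using val_surj .
  let ?T = "(\<lambda>(t, d). t + p * d) ` (T \<times> D)"
  have "finite ?T" using T D by auto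
  moreover have "card ?T \<le> card D ^ Suc k"
  proof -
    have "card ?T \<le> card (T \<times> D)" using T D by (intro card_image_le) auto
    also have "\<dots> \<le> card D ^ k * card D" using T by (simp add: card_cartesian_product)
    finally show ?thesis by (simp add: mult.commute)
  qed
  moreover have "\<exists>t\<in>?T. x - t \<in> vball v (n + int (Suc k))" if x: "x \<in> vball v n" for x
  proof -
    obtain t where t: "t \<in> T" "x - t \<in> vball v (n + int k)" using T(3) x by blast
    have e: "p * ((x - t) / p) = x - t" using p by simp
    then have "p * ((x - t) / p) \<in> vball v (n + int k)" using t by simp
    then have "(x - t) / p \<in> vball v 0" unfolding vball_mult_iff[OF p(1)] p(2) by simp
    then obtain d where d: "d \<in> D" "(x - t) / p - d \<in> vball v 1" using D by blast
    have "n + int (Suc k) - (n + int k) = 1" by simp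
    then have "p * ((x - t) / p - d) \<in> vball v (n + int (Suc k))"
      unfolding vball_mult_iff[OF p(1)] p(2) using d(2) by simp
    moreover have "p * ((x - t) / p - d) = x - (t + p * d)" by (simp only: right_diff_distrib e diff_diff_eq)
    ultimately have "x - (t + p * d) \<in> vball v (n + int (Suc k))" by simp
    moreover have "t + p * d \<in> ?T" using t(1) d(1) by force
    ultimately show ?thesis by blast
  qed
  ultimately show ?case by blast
qed

text \<open>Used in two opposite ways: to bound the number of points of \<open>A\<close> in a ball,
  and to produce short vectors in the analogue of Minkowski's theorem.\<close>

lemma vball_pigeonhole:
  assumes "residue_reps v D" "finite X" "X \<subseteq> vball v n" "card D ^ k < card X"
  obtains x y where "x \<in> X" "y \<in> X" "x \<noteq> y" "x - y \<in> vball v (n + int k)"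
proof -
  obtain T where T: "finite T" "card T \<le> card D ^ k"
    "\<forall>x\<in>vball v n. \<exists>t\<in>T. x - t \<in> vball v (n + int k)" using vball_finite_cover[OF assms(1)] by blast
  then obtain f where f: "\<And>x. x \<in> vball v n \<Longrightarrow> f x \<in> T \<and> x - f x \<in> vball v (n + int k)" by metis
  have "card (f ` X) \<le> card T" using f assms(3) T by (intro card_mono) auto
  then have "\<not> inj_on f X" using pigeonhole[of f X] T assms(4) by linarith
  then obtain x y where xy: "x \<in> X" "y \<in> X" "x \<noteq> y" "f x = f y" by (auto simp: inj_on_def)
  have "x - f x \<in> vball v (n + int k)" "y - f y \<in> vball v (n + int k)"
    using f[of x] f[of y] xy assms(3) by blast+
  then have "(x - f x) - (y - f y) \<in> vball v (n + int k)" by (rule vball_diff)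
  then show ?thesis using that[of x y] xy by simp
qed

end


section \<open>Polynomials over subrings\<close>

definition is_subring :: "'a::comm_ring_1 set \<Rightarrow> bool" where
  "is_subring R \<longleftrightarrow> 1 \<in> R \<and> (\<forall>x\<in>R. \<forall>y\<in>R. x - y \<in> R \<and> x * y \<in> R)"

definition polys_over :: "'a::comm_ring_1 set \<Rightarrow> 'a poly set" where
  "polys_over R = {P. \<forall>i. coeff P i \<in> R}"

locale sub_ring =
  fixes R :: "'a::comm_ring_1 set"
  assumes subring: "is_subring R"
begin

lemma one_closed [simp]: "1 \<in> R"
  using subring by (simp add: is_subring_def)

lemma diff_closed: "x \<in> R \<Longrightarrow> y \<in> R \<Longrightarrow> x - y \<in> R"
  using subring by (simp add: is_subring_def)

lemma mult_closed: "x \<in> R \<Longrightarrow> y \<in> R \<Longrightarrow> x * y \<in> R"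
  using subring by (simp add: is_subring_def)

lemma zero_closed [simp]: "0 \<in> R"
  using diff_closed[of 1 1] by simp

lemma uminus_closed: "x \<in> R \<Longrightarrow> - x \<in> R"
  using diff_closed[of 0 x] by simp

lemma add_closed: "x \<in> R \<Longrightarrow> y \<in> R \<Longrightarrow> x + y \<in> R"
  using diff_closed[of x "- y"] uminus_closed by simp

lemma sum_closed: "(\<And>i. i \<in> I \<Longrightarrow> f i \<in> R) \<Longrightarrow> sum f I \<in> R"
  by (induction I rule: infinite_finite_induct) (auto intro: add_closed)

lemma power_closed: "x \<in> R \<Longrightarrow> x ^ n \<in> R"
  by (induction n) (auto intro: mult_closed)

lemma polys_coeff: "P \<in> polys_over R \<Longrightarrow> coeff P i \<in> R"
  by (simp add: polys_over_def)

lemma polys_0 [simp]: "0 \<in> polys_over R"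
  by (simp add: polys_over_def)

lemma polys_pCons_iff [simp]: "pCons a P \<in> polys_over R \<longleftrightarrow> a \<in> R \<and> P \<in> polys_over R"
  unfolding polys_over_def by (force simp: coeff_pCons split: nat.splits)

lemma polys_1 [simp]: "1 \<in> polys_over R"
  by (simp add: one_pCons)

lemma polys_diff: "P \<in> polys_over R \<Longrightarrow> Q \<in> polys_over R \<Longrightarrow> P - Q \<in> polys_over R"
  by (simp add: polys_over_def diff_closed)

lemma polys_add: "P \<in> polys_over R \<Longrightarrow> Q \<in> polys_over R \<Longrightarrow> P + Q \<in> polys_over R"
  by (simp add: polys_over_def add_closed)

lemma polys_mult: "P \<in> polys_over R \<Longrightarrow> Q \<in> polys_over R \<Longrightarrow> P * Q \<in> polys_over R"
  by (simp add: polys_over_def coeff_mult sum_closed mult_closed)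

lemma polys_smult: "a \<in> R \<Longrightarrow> P \<in> polys_over R \<Longrightarrow> smult a P \<in> polys_over R"
  by (simp add: polys_over_def mult_closed)

lemma polys_monom: "a \<in> R \<Longrightarrow> monom a n \<in> polys_over R"
  by (simp add: polys_over_def)

lemma polys_sum: "(\<And>i. i \<in> I \<Longrightarrow> f i \<in> polys_over R) \<Longrightarrow> sum f I \<in> polys_over R"
  by (induction I rule: infinite_finite_induct) (auto intro: polys_add)

lemma polys_prod: "(\<And>i. i \<in> I \<Longrightarrow> f i \<in> polys_over R) \<Longrightarrow> prod f I \<in> polys_over R"
  by (induction I rule: infinite_finite_induct) (auto intro: polys_mult)

lemma polys_power: "P \<in> polys_over R \<Longrightarrow> P ^ n \<in> polys_over R"
  by (induction n) (auto intro: polys_mult)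

lemma poly_in_subring: "P \<in> polys_over R \<Longrightarrow> x \<in> R \<Longrightarrow> poly P x \<in> R"
  by (induction P) (auto intro: add_closed mult_closed)

lemma adjoin_subring: "is_subring ((\<lambda>P. poly P x) ` polys_over R)"
  unfolding is_subring_def
proof (intro conjI ballI)
  have "poly 1 x \<in> (\<lambda>P. poly P x) ` polys_over R" by (rule imageI) simp
  then show "1 \<in> (\<lambda>P. poly P x) ` polys_over R" by simp
  fix a b assume "a \<in> (\<lambda>P. poly P x) ` polys_over R" "b \<in> (\<lambda>P. poly P x) ` polys_over R"
  then obtain P Q where PQ: "P \<in> polys_over R" "Q \<in> polys_over R" "a = poly P x" "b = poly Q x" by auto
  have "poly (P - Q) x \<in> (\<lambda>P. poly P x) ` polys_over R" by (intro imageI polys_diff PQ)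
  then show "a - b \<in> (\<lambda>P. poly P x) ` polys_over R" using PQ by simp
  have "poly (P * Q) x \<in> (\<lambda>P. poly P x) ` polys_over R" by (intro imageI polys_mult PQ)
  then show "a * b \<in> (\<lambda>P. poly P x) ` polys_over R" using PQ by simp
qed

lemma adjoin_contains: "R \<subseteq> (\<lambda>P. poly P x) ` polys_over R"
proof
  fix a assume "a \<in> R"
  then have "poly [:a:] x \<in> (\<lambda>P. poly P x) ` polys_over R" by (intro imageI) simp
  then show "a \<in> (\<lambda>P. poly P x) ` polys_over R" by simp
qed

lemma adjoin_contains_gen: "x \<in> (\<lambda>P. poly P x) ` polys_over R"
proof -
  have "poly [:0, 1:] x \<in> (\<lambda>P. poly P x) ` polys_over R" by (intro imageI) simp
  then show ?thesis by simp
qed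

end

text \<open>A Steinitz argument with prescribed coefficients \<open>C\<close> and relations modulo
  \<open>Z\<close>. It is applied over \<open>F\<close> modulo the maximal ideal, to bound a residue
  field, and over \<open>F[s]\<close> with \<open>Z = {0}\<close>, to span the field over
  \<open>F(s)\<close>.\<close>

lemma maximal_independent:
  fixes X Z C :: "'a::comm_ring_1 set"
  assumes "\<And>x::nat \<Rightarrow> 'a. (\<And>l. l < k \<Longrightarrow> x l \<in> X) \<Longrightarrow>
    \<exists>c. (\<forall>l<k. c l \<in> C) \<and> (\<exists>l<k. c l \<noteq> 0) \<and> (\<Sum>l<k. c l * x l) \<in> Z"
  shows "\<exists>n (x :: nat \<Rightarrow> 'a). (\<forall>l<n. x l \<in> X) \<and>
    (\<forall>y\<in>X. \<exists>c. (\<forall>l\<le>n. c l \<in> C) \<and> c n \<noteq> 0 \<and> (\<Sum>l<n. c l * x l) + c n * y \<in> Z)"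
proof -
  define rel where "rel n x c \<longleftrightarrow> (\<forall>l<n. c l \<in> C) \<and> (\<exists>l<n. c l \<noteq> 0) \<and> (\<Sum>l<n. c l * x l) \<in> Z"
    for n :: nat and x c :: "nat \<Rightarrow> 'a"
  define ind where "ind n \<longleftrightarrow> (\<exists>x. (\<forall>l<n. x l \<in> X) \<and> (\<forall>c. \<not> rel n x c))" for n :: nat
  have "\<not> ind k"
  proof
    assume "ind k"
    then obtain x where x: "\<forall>l<k. x l \<in> X" "\<forall>c. \<not> rel k x c" unfolding ind_def by (elim exE conjE)
    have "\<exists>c. rel k x c" unfolding rel_def by (rule assms) (use x(1) in simp)
    then show False using x(2) by simp
  qed
  \<comment> \<open>The least length at which independence fails; length 0 is independent because no
    coefficient can be nonzero. A family of length \<open>m - 1\<close> is then maximal, and adding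
    any \<open>y\<close> creates a relation that must involve \<open>y\<close>.\<close>
  define m where "m = (LEAST n. \<not> ind n)"
  have m: "\<not> ind m" unfolding m_def by (rule LeastI) fact
  have "ind 0" by (simp add: ind_def rel_def)
  then obtain n where n: "m = Suc n" using m by (cases m) auto
  then have "ind n" using not_less_Least[of n "\<lambda>n. \<not> ind n"] by (auto simp: m_def)
  then obtain x where x0: "\<forall>l<n. x l \<in> X" "\<forall>c. \<not> rel n x c" unfolding ind_def by (elim exE conjE)
  have x: "\<And>l. l < n \<Longrightarrow> x l \<in> X" "\<And>c. \<not> rel n x c" using x0 by simp_all
  show ?thesis
  proof (rule exI[of _ n], rule exI[of _ x], intro conjI allI impI ballI)
    show "\<And>l. l < n \<Longrightarrow> x l \<in> X" by (rule x)
    fix y assume y: "y \<in> X"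
    have "\<forall>l<Suc n. (x(n := y)) l \<in> X" using x y by (auto simp: less_Suc_eq)
    then obtain c where "rel (Suc n) (x(n := y)) c" using m unfolding n ind_def by blast
    then have c: "\<forall>l<Suc n. c l \<in> C" "(\<Sum>l<Suc n. c l * (x(n := y)) l) \<in> Z" "\<exists>l<Suc n. c l \<noteq> 0"
      unfolding rel_def by blast+
    have s: "(\<Sum>l<n. c l * (x(n := y)) l) = (\<Sum>l<n. c l * x l)" by (rule sum.cong) auto
    have "c n \<noteq> 0"
    proof
      assume "c n = 0"
      then have "(\<Sum>l<n. c l * x l) \<in> Z" using c(2) s by simp
      moreover have "\<forall>l<n. c l \<in> C" using c(1) by simp
      moreover have "\<exists>l<n. c l \<noteq> 0" using c(3) \<open>c n = 0\<close> by (auto simp: less_Suc_eq)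
      ultimately show False using x(2)[of c] unfolding rel_def by blast
    qed
    then show "\<exists>c. (\<forall>l\<le>n. c l \<in> C) \<and> c n \<noteq> 0 \<and> (\<Sum>l<n. c l * x l) + c n * y \<in> Z"
      using c s by (intro exI[of _ c]) (auto simp: less_Suc_eq_le)
  qed
qed

section \<open>Linear dependence in function fields\<close>

locale function_field =
  fixes F :: "'a::field set" and t :: 'a and B :: "'a set"
  assumes subfield: "is_subfield F" and finite_F: "finite F" and finite_B: "finite B"
    and span: "\<And>x. \<exists>c. (\<forall>b\<in>B. c b \<in> field_adjoin F t) \<and> x = (\<Sum>b\<in>B. c b * b)"
begin

sublocale sub_ring F
  using subfield by unfold_locales (auto simp: is_subfield_def is_subring_def)

abbreviation PF where "PF \<equiv> polys_over F"

lemma inverse_closed: "x \<in> F \<Longrightarrow> inverse x \<in> F"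
  using subfield by (simp add: is_subfield_def)

lemma divide_closed: "x \<in> F \<Longrightarrow> y \<in> F \<Longrightarrow> x / y \<in> F"
  by (simp add: divide_inverse mult_closed inverse_closed)

definition fractions :: "'a set" where
  "fractions = {x. \<exists>P\<in>PF. \<exists>Q\<in>PF. poly Q t \<noteq> 0 \<and> poly Q t * x = poly P t}"

lemma fractionsI: "P \<in> PF \<Longrightarrow> Q \<in> PF \<Longrightarrow> poly Q t \<noteq> 0 \<Longrightarrow> poly Q t * x = poly P t \<Longrightarrow> x \<in> fractions"
  unfolding fractions_def by blast

lemma field_adjoin_fractions: "field_adjoin F t \<subseteq> fractions"
proof -
  have "is_subfield fractions"
    unfolding is_subfield_def
  proof (intro conjI ballI)
    show "1 \<in> fractions" by (rule fractionsI[of 1 1]) auto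
    fix x assume "x \<in> fractions"
    then obtain P Q where PQ: "P \<in> PF" "Q \<in> PF" "poly Q t \<noteq> 0" "poly Q t * x = poly P t"
      unfolding fractions_def by blast
    show "inverse x \<in> fractions"
    proof (cases "x = 0")
      case True
      then show ?thesis by (intro fractionsI[of 0 1]) auto
    next
      case False
      then have "poly P t \<noteq> 0" "poly P t * inverse x = poly Q t" using PQ by (auto simp flip: PQ(4))
      then show ?thesis unfolding fractions_def using PQ by blast
    qed
    fix y assume "y \<in> fractions"
    then obtain P' Q' where PQ': "P' \<in> PF" "Q' \<in> PF" "poly Q' t \<noteq> 0" "poly Q' t * y = poly P' t"
      unfolding fractions_def by blast
    have "poly (Q * Q') t * (x - y) = poly (P * Q' - P' * Q) t"
      by (simp add: algebra_simps flip: PQ(4) PQ'(4))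
    moreover have "P * Q' - P' * Q \<in> PF" "Q * Q' \<in> PF" "poly (Q * Q') t \<noteq> 0"
      using PQ PQ' by (auto intro: polys_diff polys_mult)
    ultimately show "x - y \<in> fractions" unfolding fractions_def by blast
    have "poly (Q * Q') t * (x * y) = poly (P * P') t"
      by (simp add: algebra_simps flip: PQ(4) PQ'(4))
    moreover have "P * P' \<in> PF" using PQ PQ' by (auto intro: polys_mult)
    ultimately show "x * y \<in> fractions"
      unfolding fractions_def using \<open>Q * Q' \<in> PF\<close> \<open>poly (Q * Q') t \<noteq> 0\<close> by blast
  qed
  moreover have "F \<subseteq> fractions"
  proof
    fix a assume "a \<in> F"
    then have "[:a:] \<in> PF" "poly 1 t * a = poly [:a:] t" by auto
    then show "a \<in> fractions" by (intro fractionsI[of "[:a:]" 1]) auto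
  qed
  moreover have "t \<in> fractions"
  proof -
    show ?thesis by (rule fractionsI[of "[:0, 1:]" 1]) auto
  qed
  ultimately show ?thesis unfolding field_adjoin_def by blast
qed

text \<open>These finite sets take the place of Riemann-Roch spaces: their size is at most
  exponential in \<open>n\<close>, and multiplication by a fixed element raises \<open>n\<close> by
  a constant once a fixed denominator is cleared. The elements of \<open>B\<close> may be dependent,
  so the size is only bounded from above.\<close>

definition bounded_span :: "nat \<Rightarrow> 'a set" where
  "bounded_span n = {\<Sum>b\<in>B. poly (P b) t * b | P. \<forall>b\<in>B. P b \<in> PF \<and> degree (P b) \<le> n}"

lemma bounded_span_0 [simp]: "0 \<in> bounded_span n"
  unfolding bounded_span_def by (auto intro!: exI[of _ "\<lambda>_. 0"])

lemma bounded_span_mono: "x \<in> bounded_span n \<Longrightarrow> n \<le> m \<Longrightarrow> x \<in> bounded_span m"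
  unfolding bounded_span_def by (force intro: order_trans)

lemma bounded_span_add:
  assumes "x \<in> bounded_span n" "y \<in> bounded_span n"
  shows "x + y \<in> bounded_span n"
proof -
  obtain P Q where "x = (\<Sum>b\<in>B. poly (P b) t * b)" "\<forall>b\<in>B. P b \<in> PF \<and> degree (P b) \<le> n"
    "y = (\<Sum>b\<in>B. poly (Q b) t * b)" "\<forall>b\<in>B. Q b \<in> PF \<and> degree (Q b) \<le> n"
    using assms unfolding bounded_span_def by blast
  then show ?thesis unfolding bounded_span_def
    by (auto intro!: exI[of _ "\<lambda>b. P b + Q b"] polys_add degree_add_le
        simp: algebra_simps sum.distrib)
qed

lemma bounded_span_sum: "(\<And>i. i \<in> I \<Longrightarrow> f i \<in> bounded_span n) \<Longrightarrow> sum f I \<in> bounded_span n"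
  by (induction I rule: infinite_finite_induct) (auto intro: bounded_span_add)

lemma bounded_span_mult:
  assumes "x \<in> bounded_span n" "c \<in> PF" "degree c \<le> d"
  shows "poly c t * x \<in> bounded_span (n + d)"
proof -
  obtain P where "x = (\<Sum>b\<in>B. poly (P b) t * b)" "\<forall>b\<in>B. P b \<in> PF \<and> degree (P b) \<le> n"
    using assms unfolding bounded_span_def by blast
  moreover have "degree (c * P b) \<le> n + d" if "degree (P b) \<le> n" for b
    using degree_mult_le[of c "P b"] that assms(3) by linarith
  ultimately show ?thesis unfolding bounded_span_def
    using assms by (auto intro!: exI[of _ "\<lambda>b. c * P b"] polys_mult simp: sum_distrib_left mult.assoc)
qed

lemma bounded_span_smult: "x \<in> bounded_span n \<Longrightarrow> a \<in> F \<Longrightarrow> a * x \<in> bounded_span n"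
  using bounded_span_mult[of x n "[:a:]" 0] by simp

lemma card_bounded_span:
  "finite (bounded_span n) \<and> card (bounded_span n) \<le> card F ^ (card B * Suc n)"
proof -
  let ?f = "\<lambda>a. \<Sum>b\<in>B. (\<Sum>i\<le>n. a (b, i) * t ^ i) * b"
  let ?A = "PiE (B \<times> {..n}) (\<lambda>_. F)"
  have sub: "bounded_span n \<subseteq> ?f ` ?A"
  proof
    fix x assume "x \<in> bounded_span n"
    then obtain P where P: "x = (\<Sum>b\<in>B. poly (P b) t * b)" "\<forall>b\<in>B. P b \<in> PF \<and> degree (P b) \<le> n"
      unfolding bounded_span_def by blast
    let ?a = "restrict (\<lambda>(b, i). coeff (P b) i) (B \<times> {..n})"
    have "x = ?f ?a"
      unfolding P(1)
    proof (intro sum.cong refl arg_cong2[of _ _ _ _ "(*)"])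
      fix b assume b: "b \<in> B"
      have "poly (P b) t = (\<Sum>i\<le>degree (P b). coeff (P b) i * t ^ i)" by (rule poly_altdef)
      also have "\<dots> = (\<Sum>i\<le>n. coeff (P b) i * t ^ i)"
        using P(2) b by (intro sum.mono_neutral_left) (auto simp: coeff_eq_0)
      also have "\<dots> = (\<Sum>i\<le>n. ?a (b, i) * t ^ i)" using b by (intro sum.cong) auto
      finally show "poly (P b) t = (\<Sum>i\<le>n. ?a (b, i) * t ^ i)" .
    qed
    moreover have "?a \<in> ?A" using P(2) by (auto simp: polys_coeff)
    ultimately show "x \<in> ?f ` ?A" by blast
  qed
  have fin: "finite ?A" using finite_B finite_F by (intro finite_PiE) auto
  have "card (bounded_span n) \<le> card ?A"
    using sub fin by (meson card_image_le card_mono finite_imageI le_trans)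
  also have "\<dots> = card F ^ (card B * Suc n)"
    using finite_B by (subst card_PiE) (auto simp: card_cartesian_product)
  finally show ?thesis using sub fin finite_surj by blast
qed

lemma ex_denominator: "\<exists>Q\<in>PF. poly Q t \<noteq> 0 \<and> (\<exists>n. poly Q t * x \<in> bounded_span n)"
proof -
  obtain c where c: "\<forall>b\<in>B. c b \<in> field_adjoin F t" "x = (\<Sum>b\<in>B. c b * b)" using span by blast
  have common: "\<exists>Q\<in>PF. poly Q t \<noteq> 0 \<and> (\<forall>b\<in>B'. \<exists>P\<in>PF. poly Q t * c b = poly P t)" if "B' \<subseteq> B" for B'
    using finite_subset[OF that finite_B] that
  proof (induction B' rule: finite_induct)
    case empty
    show ?case by (rule bexI[of _ 1]) auto
  next
    case (insert b B')
    then obtain Q where Q: "Q \<in> PF" "poly Q t \<noteq> 0" "\<forall>b\<in>B'. \<exists>P\<in>PF. poly Q t * c b = poly P t" by auto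
    have "c b \<in> fractions" using c(1) insert.prems field_adjoin_fractions by auto
    then obtain P' Q' where Q': "P' \<in> PF" "Q' \<in> PF" "poly Q' t \<noteq> 0" "poly Q' t * c b = poly P' t"
      unfolding fractions_def by blast
    have "\<exists>P\<in>PF. poly (Q * Q') t * c b' = poly P t" if b': "b' \<in> insert b B'" for b'
    proof (cases "b' = b")
      case True
      have "poly (Q * Q') t * c b = poly (Q * P') t" using Q' by simp
      then show ?thesis using True Q Q' polys_mult by blast
    next
      case False
      then obtain P where P: "P \<in> PF" "poly Q t * c b' = poly P t" using Q b' by blast
      then have "poly (Q * Q') t * c b' = poly (Q' * P) t" by (simp add: ac_simps flip: P(2))
      then show ?thesis using P Q' polys_mult by blast
    qed
    then show ?case using Q Q' by (intro bexI[of _ "Q * Q'"]) (auto intro: polys_mult)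
  qed
  from common[OF subset_refl] obtain Q P where Q: "Q \<in> PF" "poly Q t \<noteq> 0"
    "\<forall>b\<in>B. P b \<in> PF \<and> poly Q t * c b = poly (P b) t" by metis
  have "poly Q t * x = (\<Sum>b\<in>B. poly (P b) t * b)"
    unfolding c(2) sum_distrib_left using Q by (intro sum.cong) (auto simp flip: mult.assoc)
  moreover have "finite ((\<lambda>b. degree (P b)) ` B)" using finite_B by simp
  then obtain n where "\<And>b. b \<in> B \<Longrightarrow> degree (P b) \<le> n" using Max_ge by blast
  ultimately have "poly Q t * x \<in> bounded_span n" using Q unfolding bounded_span_def by blast
  then show ?thesis using Q by blast
qed

lemma ex_common_denominator:
  assumes "finite X"
  shows "\<exists>Q\<in>PF. poly Q t \<noteq> 0 \<and> (\<exists>n. \<forall>x\<in>X. poly Q t * x \<in> bounded_span n)"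
  using assms
proof (induction X rule: finite_induct)
  case empty
  show ?case by (rule bexI[of _ 1]) auto
next
  case (insert x X)
  then obtain Q n where Q: "Q \<in> PF" "poly Q t \<noteq> 0" "\<forall>x\<in>X. poly Q t * x \<in> bounded_span n" by blast
  obtain Q' n' where Q': "Q' \<in> PF" "poly Q' t \<noteq> 0" "poly Q' t * x \<in> bounded_span n'"
    using ex_denominator by blast
  define m where "m = n + n' + degree Q + degree Q'"
  have "poly (Q * Q') t * y \<in> bounded_span m" if y: "y \<in> insert x X" for y
  proof (cases "y = x")
    case True
    have "poly Q t * (poly Q' t * x) \<in> bounded_span (n' + degree Q)"
      using Q Q' by (intro bounded_span_mult) auto
    then have "poly Q t * (poly Q' t * x) \<in> bounded_span m"
      by (rule bounded_span_mono) (simp add: m_def)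
    then show ?thesis using True by (simp add: mult.assoc)
  next
    case False
    have "poly Q' t * (poly Q t * y) \<in> bounded_span (n + degree Q')"
      using Q Q' y False by (intro bounded_span_mult) auto
    then have "poly Q' t * (poly Q t * y) \<in> bounded_span m"
      by (rule bounded_span_mono) (simp add: m_def)
    then show ?thesis by (simp add: ac_simps)
  qed
  then show ?case using Q Q' by (intro bexI[of _ "Q * Q'"]) (auto intro: polys_mult)
qed

text \<open>\<Delta> is a common denominator of the finitely many products \<open>s * b\<close> with
  \<open>b\<close> in \<open>B\<close>, and \<open>e\<close> bounds the degrees of their
  numerators.\<close>

lemma multiplication_degree:
  "\<exists>\<Delta>\<in>PF. poly \<Delta> t \<noteq> 0 \<and> (\<exists>e. \<forall>n. \<forall>x\<in>bounded_span n. poly \<Delta> t * (s * x) \<in> bounded_span (n + e))"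
proof -
  obtain \<Delta> e where D: "\<Delta> \<in> PF" "poly \<Delta> t \<noteq> 0" "\<forall>x\<in>(*) s ` B. poly \<Delta> t * x \<in> bounded_span e"
    using ex_common_denominator[of "(*) s ` B"] finite_B by blast
  have "poly \<Delta> t * (s * x) \<in> bounded_span (n + e)" if x: "x \<in> bounded_span n" for n x
  proof -
    obtain P where P: "x = (\<Sum>b\<in>B. poly (P b) t * b)" "\<forall>b\<in>B. P b \<in> PF \<and> degree (P b) \<le> n"
      using x unfolding bounded_span_def by blast
    have "poly \<Delta> t * (s * x) = (\<Sum>b\<in>B. poly (P b) t * (poly \<Delta> t * (s * b)))"
      unfolding P(1) by (simp add: sum_distrib_left ac_simps)
    also have "\<dots> \<in> bounded_span (e + n)"
      using D P(2) by (intro bounded_span_sum bounded_span_mult) auto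
    finally show ?thesis by (simp add: add.commute)
  qed
  then show ?thesis using D by blast
qed

lemma card_F: "2 \<le> card F"
proof -
  have "card {0, 1 :: 'a} \<le> card F" using finite_F by (intro card_mono) auto
  then show ?thesis by simp
qed

text \<open>Pigeonhole for the coefficients of \<open>P\<close>. With \<open>J\<close> coefficients
  for each of \<open>k\<close> polynomials there are \<open>card F\<close> to the power
  \<open>k J\<close> choices, whereas after clearing denominators the values lie in a
  \<open>bounded_span\<close> whose size has exponent at most \<open>card B\<close> times
  \<open>1 + E + J d\<close>. If \<open>k\<close> exceeds \<open>card B\<close> times
  \<open>d\<close>, the choices win for large \<open>J\<close>. Only \<open>J\<close> and
  \<open>E\<close> depend on \<open>x\<close>, which makes \<open>k\<close> uniform.\<close>

proposition poly_dependence: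
  "\<exists>k. \<forall>x :: nat \<Rightarrow> 'a. \<exists>P. (\<forall>l<k. P l \<in> PF) \<and> (\<exists>l<k. P l \<noteq> 0) \<and> (\<Sum>l<k. poly (P l) s * x l) = 0"
proof -
  obtain \<Delta> e where \<Delta>: "\<Delta> \<in> PF" "poly \<Delta> t \<noteq> 0"
    and e: "\<And>n x. x \<in> bounded_span n \<Longrightarrow> poly \<Delta> t * (s * x) \<in> bounded_span (n + e)"
    using multiplication_degree[of s] by blast
  \<comment> \<open>The degree cost per power of \<open>s\<close>: \<open>e\<close> for a
    multiplication by \<open>s\<close>, and \<open>degree \<Delta>\<close> for bringing all terms to
    the common denominator \<open>\<Delta> ^ J\<close>.\<close>
  define d where "d = e + degree \<Delta>"
  define k where "k = Suc (card B * d)"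
  have "\<exists>P. (\<forall>l<k. P l \<in> PF) \<and> (\<exists>l<k. P l \<noteq> 0) \<and> (\<Sum>l<k. poly (P l) s * x l) = 0" for x :: "nat \<Rightarrow> 'a"
  proof -
    obtain Q E where Q: "Q \<in> PF" "poly Q t \<noteq> 0" "\<And>l. l < k \<Longrightarrow> poly Q t * x l \<in> bounded_span E"
      using ex_common_denominator[of "x ` {..<k}"] by auto
    define J where "J = Suc (card B * Suc E)"
    have pow: "poly \<Delta> t ^ i * (s ^ i * y) \<in> bounded_span (n + i * e)" if y: "y \<in> bounded_span n" for i n y
    proof (induction i)
      case (Suc i)
      from e[OF Suc] show ?case by (simp add: algebra_simps)
    qed (use y in simp)
    let ?f = "\<lambda>c. poly Q t * poly \<Delta> t ^ J * (\<Sum>l<k. (\<Sum>i<J. c (l, i) * s ^ i) * x l)"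
    let ?A = "PiE ({..<k} \<times> {..<J}) (\<lambda>_. F)"
    have mem: "poly \<Delta> t ^ J * (s ^ i * (poly Q t * x l)) \<in> bounded_span (E + J * d)" if li: "l < k" "i < J" for l i
    proof -
      have "poly (\<Delta> ^ (J - i)) t * (poly \<Delta> t ^ i * (s ^ i * (poly Q t * x l)))
          \<in> bounded_span (E + i * e + (J - i) * degree \<Delta>)"
      proof (intro bounded_span_mult polys_power)
        show "poly \<Delta> t ^ i * (s ^ i * (poly Q t * x l)) \<in> bounded_span (E + i * e)"
          by (rule pow[OF Q(3)[OF li(1)]])
        show "degree (\<Delta> ^ (J - i)) \<le> (J - i) * degree \<Delta>"
          using degree_power_le[of \<Delta> "J - i"] by (simp only: mult.commute)
      qed (rule \<Delta>)
      moreover have "poly (\<Delta> ^ (J - i)) t * poly \<Delta> t ^ i = poly \<Delta> t ^ J"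
        using li by (simp flip: power_add)
      moreover have "E + i * e + (J - i) * degree \<Delta> \<le> E + J * d"
        unfolding d_def add_mult_distrib2 using mult_le_mono1[of i J e] mult_le_mono1[of "J - i" J "degree \<Delta>"] li
        by linarith
      ultimately show ?thesis using bounded_span_mono by (simp flip: mult.assoc)
    qed
    have "?f ` ?A \<subseteq> bounded_span (E + J * d)"
    proof
      fix z assume "z \<in> ?f ` ?A"
      then obtain c where c: "c \<in> ?A" "z = ?f c" by blast
      have "z = (\<Sum>l<k. \<Sum>i<J. c (l, i) * (poly \<Delta> t ^ J * (s ^ i * (poly Q t * x l))))"
        unfolding c(2) by (simp add: sum_distrib_left sum_distrib_right ac_simps)
      also have "\<dots> \<in> bounded_span (E + J * d)"
      proof (rule bounded_span_sum, rule bounded_span_sum)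
        fix l i assume li: "l \<in> {..<k}" "i \<in> {..<J}"
        have "c (l, i) \<in> F" using li c(1) by auto
        then show "c (l, i) * (poly \<Delta> t ^ J * (s ^ i * (poly Q t * x l))) \<in> bounded_span (E + J * d)"
          using li by (intro bounded_span_smult mem) auto
      qed
      finally show "z \<in> bounded_span (E + J * d)" .
    qed
    then have "card (?f ` ?A) \<le> card F ^ (card B * Suc (E + J * d))"
      using card_bounded_span by (meson card_mono le_trans)
    also have "\<dots> < card F ^ (k * J)"
    proof (rule power_strict_increasing)
      have "card B * Suc (E + J * d) = card B * Suc E + card B * d * J" by (simp add: algebra_simps)
      also have "\<dots> < J + card B * d * J" by (simp add: J_def)
      finally show "card B * Suc (E + J * d) < k * J" by (simp add: k_def)
    qed (use card_F in simp)
    also have "\<dots> = card ?A" by (subst card_PiE) (auto simp: card_cartesian_product)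
    finally have "\<not> inj_on ?f ?A" by (rule pigeonhole)
    then obtain c c' where cc: "c \<in> ?A" "c' \<in> ?A" "c \<noteq> c'" "?f c = ?f c'" unfolding inj_on_def by blast
    \<comment> \<open>The difference of two colliding coefficient arrays is a nonzero
      relation.\<close>
    define P where "P l = (\<Sum>i<J. monom (c (l, i) - c' (l, i)) i)" for l
    have coeff: "coeff (P l) i = (if i < J then c (l, i) - c' (l, i) else 0)" for l i
      unfolding P_def by (auto simp: coeff_sum)
    have "(\<Sum>l<k. (\<Sum>i<J. c (l, i) * s ^ i) * x l) = (\<Sum>l<k. (\<Sum>i<J. c' (l, i) * s ^ i) * x l)"
      using cc(4) Q(2) \<Delta>(2) by simp
    then have "(\<Sum>l<k. poly (P l) s * x l) = 0"
      by (simp add: P_def poly_sum poly_monom left_diff_distrib sum_subtractf)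
    moreover have "P l \<in> PF" if "l < k" for l
      unfolding polys_over_def using coeff that cc by (auto intro!: diff_closed dest!: PiE_mem)
    moreover have "\<exists>l<k. P l \<noteq> 0"
    proof -
      obtain z where z: "z \<in> {..<k} \<times> {..<J}" "c z \<noteq> c' z" using cc PiE_ext by blast
      then have "coeff (P (fst z)) (snd z) \<noteq> 0" using coeff by auto
      then show ?thesis using z(1) by (intro exI[of _ "fst z"]) auto
    qed
    ultimately show ?thesis by blast
  qed
  then show ?thesis by blast
qed

text \<open>Dividing by the highest power of \<open>s\<close> common to all \<open>P l\<close>
  leaves some constant term nonzero. The constant terms are what survives reduction at a place where
  \<open>s\<close> vanishes.\<close>

lemma poly_dependence_normalised:
  assumes "s \<noteq> 0"
  shows "\<exists>k. \<forall>x :: nat \<Rightarrow> 'a. \<exists>P. (\<forall>l<k. P l \<in> PF) \<and> (\<exists>l<k. coeff (P l) 0 \<noteq> 0) \<and>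
    (\<Sum>l<k. poly (P l) s * x l) = 0"
proof -
  obtain k where k: "\<And>x :: nat \<Rightarrow> 'a. \<exists>P. (\<forall>l<k. P l \<in> PF) \<and> (\<exists>l<k. P l \<noteq> 0) \<and>
    (\<Sum>l<k. poly (P l) s * x l) = 0" using poly_dependence[of s] by blast
  have "\<exists>P. (\<forall>l<k. P l \<in> PF) \<and> (\<exists>l<k. coeff (P l) 0 \<noteq> 0) \<and> (\<Sum>l<k. poly (P l) s * x l) = 0"
    for x :: "nat \<Rightarrow> 'a"
  proof -
    obtain P l0 where P: "\<forall>l<k. P l \<in> PF" "l0 < k" "P l0 \<noteq> 0" "(\<Sum>l<k. poly (P l) s * x l) = 0"
      using k[of x] by blast
    define j where "j = (LEAST j. \<exists>l<k. coeff (P l) j \<noteq> 0)"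
    have "coeff (P l0) (degree (P l0)) \<noteq> 0" using P by simp
    then have "\<exists>j. \<exists>l<k. coeff (P l) j \<noteq> 0" using P(2) by blast
    then have j: "\<exists>l<k. coeff (P l) j \<noteq> 0" unfolding j_def by (rule LeastI_ex)
    have low: "coeff (P l) i = 0" if "l < k" "i < j" for l i
      using not_less_Least[of i "\<lambda>j. \<exists>l<k. coeff (P l) j \<noteq> 0"] that by (auto simp: j_def)
    have eq: "P l = monom 1 j * poly_shift j (P l)" if "l < k" for l
      using low[OF that] by (intro poly_eqI) (auto simp: coeff_monom_mult coeff_poly_shift)
    have "s ^ j * (\<Sum>l<k. poly (poly_shift j (P l)) s * x l) = (\<Sum>l<k. poly (P l) s * x l)"
      unfolding sum_distrib_left
    proof (rule sum.cong)
      fix l assume "l \<in> {..<k}"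
      then have "poly (P l) s = s ^ j * poly (poly_shift j (P l)) s"
        by (subst eq) (auto simp: poly_monom)
      then show "s ^ j * (poly (poly_shift j (P l)) s * x l) = poly (P l) s * x l" by simp
    qed simp
    then have "(\<Sum>l<k. poly (poly_shift j (P l)) s * x l) = 0" using P(4) assms by simp
    moreover have "\<forall>l<k. poly_shift j (P l) \<in> PF" using P(1) by (auto simp: polys_over_def coeff_poly_shift)
    moreover have "\<exists>l<k. coeff (poly_shift j (P l)) 0 \<noteq> 0" using j by (simp add: coeff_poly_shift)
    ultimately show ?thesis by (intro exI[of _ "\<lambda>l. poly_shift j (P l)"]) simp
  qed
  then show ?thesis by blast
qed

end


section \<open>Existence of valuations\<close>

lemma poly_eq_monom_mult:
  fixes P :: "'a::comm_ring_1 poly"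
  assumes "P \<noteq> 0"
  shows "\<exists>j. P = monom 1 j * poly_shift j P \<and> coeff (poly_shift j P) 0 \<noteq> 0"
proof -
  define j where "j = (LEAST j. coeff P j \<noteq> 0)"
  have "coeff P (degree P) \<noteq> 0" using assms by simp
  then have j: "coeff P j \<noteq> 0" unfolding j_def by (rule LeastI)
  have low: "coeff P i = 0" if "i < j" for i
    using not_less_Least[of i "\<lambda>j. coeff P j \<noteq> 0"] that by (simp add: j_def)
  have "P = monom 1 j * poly_shift j P"
    by (rule poly_eqI) (simp add: coeff_monom_mult coeff_poly_shift low)
  then show ?thesis using j by (intro exI[of _ j]) (simp add: coeff_poly_shift)
qed

lemma is_subring_Union_chain:
  assumes "C \<noteq> {}" "\<And>R. R \<in> C \<Longrightarrow> is_subring R" "\<And>R S. R \<in> C \<Longrightarrow> S \<in> C \<Longrightarrow> R \<subseteq> S \<or> S \<subseteq> R"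
  shows "is_subring (\<Union>C)"
  unfolding is_subring_def
proof (intro conjI ballI)
  show "1 \<in> \<Union>C" using assms(1,2) by (auto simp: is_subring_def)
  fix x y assume "x \<in> \<Union>C" "y \<in> \<Union>C"
  then obtain R S where "R \<in> C" "S \<in> C" "x \<in> R" "y \<in> S" by blast
  then obtain T where "T \<in> C" "x \<in> T" "y \<in> T" using assms(3)[of R S] by blast
  then show "x - y \<in> \<Union>C" "x * y \<in> \<Union>C" using assms(2)[of T] by (auto simp: is_subring_def)
qed

text \<open>A subring maximal among those in which \<open>s\<close> is not invertible is a valuation ring.\<close>

locale maximal_subring = sub_ring R for R :: "'a::field set" +
  fixes s :: 'a
  assumes s_mem: "s \<in> R" and inv_s: "inverse s \<notin> R"
    and maximal: "\<And>S. is_subring S \<Longrightarrow> R \<subseteq> S \<Longrightarrow> inverse s \<notin> S \<Longrightarrow> S = R"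
begin

lemma s_nz: "s \<noteq> 0"
  using inv_s zero_closed by force

text \<open>By maximality, adjoining any new element makes \<open>s\<close> invertible.\<close>

lemma inverse_s_adjoin:
  assumes "x \<notin> R"
  shows "\<exists>P\<in>polys_over R. inverse s = poly P x"
  using maximal[OF adjoin_subring adjoin_contains, of x] adjoin_contains_gen[of x] assms by blast

text \<open>\<open>s\<close> lies in the Jacobson radical. If \<open>d = 1 - s * b\<close> had its
  inverse outside \<open>R\<close>, then \<open>1/s\<close> would be a polynomial in
  \<open>1/d\<close>; multiplying by a power of \<open>d\<close>, which is 1 modulo
  \<open>s\<close>, would put \<open>1/s\<close> into \<open>R\<close>.\<close>

lemma one_minus_unit:
  assumes b: "b \<in> R"
  shows "1 - s * b \<noteq> 0" "inverse (1 - s * b) \<in> R"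
proof -
  define d where "d = 1 - s * b"
  show nz: "1 - s * b \<noteq> 0"
  proof
    assume "1 - s * b = 0"
    then have "inverse s = b" using s_nz by (simp add: field_simps)
    then show False using inv_s b by simp
  qed
  have pow: "\<exists>c\<in>R. d ^ k = 1 - s * c" for k
  proof (induction k)
    case 0
    show ?case by (rule bexI[of _ 0]) auto
  next
    case (Suc k)
    then obtain c where c: "c \<in> R" "d ^ k = 1 - s * c" by blast
    have "d ^ Suc k = 1 - s * (b + c - s * (b * c))"
      unfolding power_Suc c(2) by (simp add: d_def algebra_simps)
    moreover have "b + c - s * (b * c) \<in> R"
      using b c s_mem by (intro diff_closed add_closed mult_closed)
    ultimately show ?case by blast
  qed
  show "inverse (1 - s * b) \<in> R"
  proof (rule ccontr)
    assume "inverse (1 - s * b) \<notin> R"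
    then obtain P where P: "P \<in> polys_over R" "inverse s = poly P (inverse d)"
      using inverse_s_adjoin unfolding d_def by blast
    define k where "k = degree P"
    have "d ^ k * inverse s = (\<Sum>i\<le>k. coeff P i * d ^ (k - i))"
      unfolding P(2) poly_altdef k_def[symmetric] sum_distrib_left
    proof (rule sum.cong)
      fix i assume "i \<in> {..k}"
      then have "d ^ k = d ^ (k - i) * d ^ i" by (simp flip: power_add)
      then show "d ^ k * (coeff P i * inverse d ^ i) = coeff P i * d ^ (k - i)"
        using nz by (simp add: d_def[symmetric] power_inverse)
    qed simp
    also have "\<dots> \<in> R"
      using P b s_mem unfolding d_def
      by (intro sum_closed mult_closed power_closed diff_closed polys_coeff) auto
    finally have mem: "d ^ k * inverse s \<in> R" .
    obtain c where c: "c \<in> R" "d ^ k = 1 - s * c" using pow by blast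
    have "d ^ k * inverse s + c = inverse s" using s_nz unfolding c(2) by (simp add: field_simps)
    then show False using add_closed[OF mem c(1)] inv_s by simp
  qed
qed

text \<open>The classical elimination for valuation rings. As \<open>1 - s * q\<close> is a unit,
  the relation for \<open>1/x\<close>, multiplied by \<open>x ^ n\<close>, writes
  \<open>x ^ n\<close> as an \<open>R\<close>-combination of lower powers, which removes the leading
  term of \<open>P\<close>.\<close>

lemma descent:
  assumes x: "x \<noteq> 0" and P: "P \<in> polys_over R" "s * poly P x = 1"
    and Q: "Q \<in> polys_over R" "s * poly Q (inverse x) = 1" and deg: "degree Q \<le> degree P"
  shows "\<exists>P'\<in>polys_over R. degree P' < degree P \<and> s * poly P' x = 1"
proof -
  define n where "n = degree P"
  have "n \<noteq> 0"
  proof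
    assume "n = 0"
    then obtain a where a: "P = [:a:]" unfolding n_def by (rule degree_eq_zeroE)
    then have "inverse s = a" using P(2) s_nz by (simp add: field_simps)
    then show False using inv_s P(1) a by simp
  qed
  obtain q Q' where Q': "Q = pCons q Q'" by (cases Q)
  have qR: "q \<in> R" "Q' \<in> polys_over R" using Q(1) Q' by auto
  have dQ': "degree Q' \<le> n - 1" using deg Q' by (auto simp: n_def split: if_splits)
  define u where "u = inverse (1 - s * q)"
  have u: "u \<in> R" "u * (1 - s * q) = 1" using one_minus_unit[OF qR(1)] by (auto simp: u_def)
  \<comment> \<open>The coefficients of \<open>Q'\<close> in reverse order, padded to degree
    \<open>n - 1\<close>, so that the value of \<open>T\<close> at \<open>x\<close> is
    \<open>x ^ (n - 1)\<close> times that of \<open>Q'\<close> at \<open>1/x\<close>.\<close>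
  define T where "T = (\<Sum>j\<le>n-1. monom (coeff Q' j) (n - 1 - j))"
  have T: "T \<in> polys_over R" unfolding T_def by (intro polys_sum polys_monom polys_coeff qR)
  have dT: "coeff T i = 0" if "i \<ge> n" for i
    using that \<open>n \<noteq> 0\<close> unfolding T_def by (auto simp: coeff_sum intro!: sum.neutral)
  have "poly Q' (inverse x) = (\<Sum>j\<le>n-1. coeff Q' j * inverse x ^ j)"
    unfolding poly_altdef using dQ' by (intro sum.mono_neutral_left) (auto simp: coeff_eq_0)
  then have "x ^ (n - 1) * poly Q' (inverse x) = (\<Sum>j\<le>n-1. x ^ (n - 1) * (coeff Q' j * inverse x ^ j))"
    by (simp add: sum_distrib_left)
  also have "\<dots> = poly T x"
    unfolding T_def poly_sum poly_monom
  proof (rule sum.cong)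
    fix j assume "j \<in> {..n - 1}"
    then have "n - 1 - j + j = n - 1" by simp
    then have "x ^ (n - 1) = x ^ (n - 1 - j) * x ^ j" by (metis power_add)
    then show "x ^ (n - 1) * (coeff Q' j * inverse x ^ j) = coeff Q' j * x ^ (n - 1 - j)"
      using x by (simp add: power_inverse)
  qed simp
  finally have Tx: "x ^ (n - 1) * poly Q' (inverse x) = poly T x" .
  have "s * q + s * (inverse x * poly Q' (inverse x)) = 1"
    using Q(2) by (simp add: Q' distrib_left)
  then have "1 - s * q = s * (inverse x * poly Q' (inverse x))"
    by (metis add_diff_cancel_left')
  then have "x ^ n * (1 - s * q) = s * (x ^ n * inverse x * poly Q' (inverse x))" by (simp add: ac_simps)
  also have "x ^ n * inverse x = x ^ (n - 1)"
    using x \<open>n \<noteq> 0\<close> by (cases n) auto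
  finally have "x ^ n * (1 - s * q) = s * poly T x" using Tx by simp
  then have "u * (x ^ n * (1 - s * q)) = u * s * poly T x" by simp
  moreover have "u * (x ^ n * (1 - s * q)) = x ^ n * (u * (1 - s * q))" by (simp only: ac_simps)
  ultimately have xn: "x ^ n = u * s * poly T x" using u(2) by simp
  define a where "a = coeff P n"
  define P' where "P' = P - monom a n + smult (a * u * s) T"
  have "poly P' x = poly P x - a * x ^ n + a * (u * s * poly T x)"
    by (simp add: P'_def poly_monom mult.assoc)
  then have "s * poly P' x = 1" using xn P(2) by simp
  moreover have "a \<in> R" unfolding a_def by (rule polys_coeff[OF P(1)])
  then have "P' \<in> polys_over R" unfolding P'_def
    using P T u s_mem by (intro polys_add polys_diff polys_smult polys_monom mult_closed)
  moreover have "degree P' < n"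
  proof (rule degree_lessI)
    show "\<forall>k\<ge>n. coeff P' k = 0"
      unfolding P'_def a_def by (auto simp: dT n_def coeff_eq_0)
  qed (use \<open>n \<noteq> 0\<close> in simp)
  ultimately show ?thesis unfolding n_def by blast
qed

text \<open>If \<open>x\<close> and \<open>1/x\<close> are both outside \<open>R\<close>, each has a
  relation of least degree; \<open>descent\<close> applied to the one of larger degree contradicts
  minimality.\<close>

lemma valuation_ring:
  assumes "x \<noteq> 0" "x \<notin> R"
  shows "inverse x \<in> R"
proof (rule ccontr)
  assume nx: "inverse x \<notin> R"
  define good where "good y P \<longleftrightarrow> P \<in> polys_over R \<and> s * poly P y = 1" for y P
  define m where "m y = (LEAST n. \<exists>P. good y P \<and> degree P = n)" for y
  have ex: "\<exists>P. good y P \<and> degree P = m y" if y: "y \<notin> R" for y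
  proof -
    obtain P where "P \<in> polys_over R" "inverse s = poly P y" using inverse_s_adjoin[OF y] by blast
    then have "good y P" using s_nz by (simp add: good_def flip: \<open>inverse s = _\<close>)
    then have "\<exists>n P. good y P \<and> degree P = n" by blast
    then show ?thesis unfolding m_def by (rule LeastI_ex)
  qed
  have least: "m y \<le> degree P" if "good y P" for y P
    unfolding m_def using that by (intro Least_le) blast
  have *: False if y: "y \<noteq> 0" "y \<notin> R" "inverse y \<notin> R" "m (inverse y) \<le> m y" for y
  proof -
    obtain P where P: "good y P" "degree P = m y" using ex[OF y(2)] by blast
    obtain Q where Q: "good (inverse y) Q" "degree Q = m (inverse y)" using ex[OF y(3)] by blast
    have "\<exists>P'\<in>polys_over R. degree P' < degree P \<and> s * poly P' y = 1"
      using descent[of y P Q] y P Q unfolding good_def by simp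
    then obtain P' where "P' \<in> polys_over R" "degree P' < degree P" "s * poly P' y = 1" by blast
    then show False using least[of y P'] P by (simp add: good_def)
  qed
  show False using *[of x] *[of "inverse x"] assms nx by (cases "m (inverse x) \<le> m x") auto
qed

definition U where "U = {x. x \<noteq> 0 \<and> x \<in> R \<and> inverse x \<in> R}"

lemma U_mult: "x \<in> U \<Longrightarrow> y \<in> U \<Longrightarrow> x * y \<in> U"
  by (auto simp: U_def intro: mult_closed)

lemma U_inverse: "x \<in> U \<Longrightarrow> inverse x \<in> U"
  by (auto simp: U_def)

lemma U_1: "1 \<in> U"
  by (simp add: U_def)

lemma U_power: "x \<in> U \<Longrightarrow> x ^ n \<in> U"
  by (induction n) (auto intro: U_mult U_1)

text \<open>The nonunits form the maximal ideal: after factoring out the summand that divides the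
  other, \<open>x + y = y * (x / y + 1)\<close>, a unit sum would make \<open>y\<close> a
  unit.\<close>

lemma nonunit_add:
  assumes "x \<in> R - U" "y \<in> R - U"
  shows "x + y \<in> R - U"
proof -
  have *: "x + y \<notin> U" if "y \<noteq> 0" "x \<in> R" "y \<in> R - U" "x / y \<in> R" for x y
  proof
    assume "x + y \<in> U"
    then have "inverse (x + y) * (x / y + 1) \<in> R" "x + y \<noteq> 0"
      using that by (auto simp: U_def intro!: mult_closed add_closed)
    moreover have "inverse (x + y) * (x / y + 1) = inverse y"
      using \<open>x + y \<noteq> 0\<close> that(1) by (simp add: field_simps)
    ultimately show False using that by (simp add: U_def)
  qed
  have "x + y \<notin> U"
  proof (cases "x = 0 \<or> y = 0")
    case False
    then have "x / y \<in> R \<or> y / x \<in> R"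
      using valuation_ring[of "x / y"] by auto
    then show ?thesis using *[of y x] *[of x y] False assms by (auto simp: add.commute)
  qed (use assms in auto)
  then show ?thesis using assms by (auto intro: add_closed)
qed

lemma nonunit_sum: "finite I \<Longrightarrow> (\<And>i. i \<in> I \<Longrightarrow> f i \<in> R - U) \<Longrightarrow> sum f I \<in> R - U"
proof (induction I rule: finite_induct)
  case empty
  then show ?case by (simp add: U_def)
next
  case (insert i I)
  then show ?case using nonunit_add[of "f i" "sum f I"] by simp
qed

text \<open>In a vanishing sum, the term of smallest value cannot be unique.\<close>

lemma two_dominant_terms:
  assumes I: "finite I" "I \<noteq> {}" "\<And>i. i \<in> I \<Longrightarrow> y i \<noteq> 0" and sum: "sum y I = 0"
  obtains i j where "i \<in> I" "j \<in> I" "i \<noteq> j" "y i / y j \<in> U"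
proof -
  have "\<exists>j\<in>I. \<forall>i\<in>I. y i / y j \<in> R"
    using I
  proof (induction I rule: finite_ne_induct)
    case (singleton i)
    then show ?case by simp
  next
    case (insert k I)
    then obtain j where j: "j \<in> I" "\<forall>i\<in>I. y i / y j \<in> R" by auto
    have nz: "y k \<noteq> 0" "y j \<noteq> 0" using insert j by auto
    show ?case
    proof (cases "y k / y j \<in> R")
      case True
      then show ?thesis using j by blast
    next
      case False
      then have r: "y j / y k \<in> R" using valuation_ring[of "y k / y j"] nz by simp
      have "y i / y k \<in> R" if "i \<in> I" for i
      proof -
        have "y i / y j * (y j / y k) \<in> R" using j r that by (intro mult_closed) auto
        then show ?thesis using nz by simp
      qed
      then show ?thesis using nz by (intro bexI[of _ k]) auto
    qed
  qed
  then obtain j where j: "j \<in> I" "\<forall>i\<in>I. y i / y j \<in> R" by blast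
  \<comment> \<open>Were all other quotients nonunits, so would be their sum, which equals
    -1.\<close>
  have "\<exists>i\<in>I - {j}. y i / y j \<in> U"
  proof (rule ccontr)
    assume "\<not> ?thesis"
    then have "(\<Sum>i\<in>I - {j}. y i / y j) \<in> R - U" using j I by (intro nonunit_sum) auto
    moreover have "(\<Sum>i\<in>I - {j}. y i / y j) = (sum y I - y j) / y j"
      using I j by (simp add: sum_diff1 flip: sum_divide_distrib)
    then have "(\<Sum>i\<in>I - {j}. y i / y j) = -1" using sum I j by simp
    ultimately show False by (auto simp: U_def uminus_closed)
  qed
  then show ?thesis using that j by blast
qed

lemma powi_s_unit:
  assumes "s powi j \<in> U"
  shows "j = 0"
proof -
  have False if "s powi j \<in> U" "j > 0" for j
  proof -
    have "s powi (j - 1) \<in> R" using that s_mem by (simp add: power_int_def power_closed)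
    then have "s powi (j - 1) * inverse (s powi j) \<in> R" using that by (intro mult_closed) (auto simp: U_def)
    then have "s powi (-1) \<in> R" using s_nz by (simp add: power_int_diff field_simps)
    then show False using inv_s by simp
  qed
  from this[of j] this[of "- j"] U_inverse[OF assms] assms show ?thesis
    by (cases "j = 0"; cases "j > 0") (auto simp: power_int_minus)
qed

end

text \<open>So far \<open>R\<close> has only an abstract ordered value group. The condition says
  that \<open>N\<close> times this group lies in the multiples of the value of \<open>s\<close>, so
  that it embeds into the integers.\<close>

locale finite_ramification = maximal_subring +
  fixes N :: nat
  assumes N_pos: "N > 0" and ramified: "\<And>x. x \<noteq> 0 \<Longrightarrow> \<exists>j. x ^ N / s powi j \<in> U"
begin

text \<open>\<open>N\<close> times the valuation normalised to be 1 at \<open>s\<close>, so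
  \<open>w0 s = N\<close>. Its values may form a proper subgroup of the integers.\<close>

definition w0 :: "'a \<Rightarrow> int" where
  "w0 x = (if x = 0 then 0 else THE j. x ^ N / s powi j \<in> U)"

lemma w0_unique:
  assumes "x \<noteq> 0" "x ^ N / s powi j \<in> U"
  shows "w0 x = j"
proof -
  have "j' = j" if "x ^ N / s powi j' \<in> U" for j'
  proof -
    have "x ^ N / s powi j' * inverse (x ^ N / s powi j) \<in> U" using that assms by (intro U_mult U_inverse)
    then have "s powi (j - j') \<in> U" using assms(1) s_nz by (simp add: power_int_diff field_simps)
    then have "j - j' = 0" by (rule powi_s_unit)
    then show ?thesis by simp
  qed
  with assms(2) have "(THE j. x ^ N / s powi j \<in> U) = j" by (rule the_equality)
  then show ?thesis using assms(1) by (simp add: w0_def)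
qed

lemma w0: "x \<noteq> 0 \<Longrightarrow> x ^ N / s powi (w0 x) \<in> U"
  using ramified w0_unique by blast

lemma w0_mult: "x \<noteq> 0 \<Longrightarrow> y \<noteq> 0 \<Longrightarrow> w0 (x * y) = w0 x + w0 y"
proof -
  assume xy: "x \<noteq> 0" "y \<noteq> 0"
  have "x ^ N / s powi (w0 x) * (y ^ N / s powi (w0 y)) \<in> U" using xy by (intro U_mult w0)
  moreover have "x ^ N / s powi (w0 x) * (y ^ N / s powi (w0 y)) = (x * y) ^ N / s powi (w0 x + w0 y)"
    using s_nz by (simp add: power_int_add power_mult_distrib)
  ultimately show ?thesis using xy by (intro w0_unique) simp_all
qed

lemma w0_s: "w0 s = int N"
proof (rule w0_unique[OF s_nz])
  have "s ^ N / s powi (int N) = 1" using s_nz by simp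
  then show "s ^ N / s powi (int N) \<in> U" using U_1 by simp
qed

lemma w0_1: "w0 1 = 0"
  using w0_unique[of 1 0] U_1 by simp

lemma w0_inverse: "x \<noteq> 0 \<Longrightarrow> w0 (inverse x) = - w0 x"
  using w0_mult[of x "inverse x"] w0_1 by simp

lemma w0_nonneg: "x \<noteq> 0 \<Longrightarrow> x \<in> R \<Longrightarrow> w0 x \<ge> 0"
proof (rule ccontr)
  assume x: "x \<noteq> 0" "x \<in> R" "\<not> w0 x \<ge> 0"
  obtain m where m: "w0 x = - int m" "m > 0" using x(3) by (metis neg_int_cases not_le)
  have "x ^ N * s ^ m \<in> U" using w0[OF x(1)] unfolding m(1)
    by (simp add: power_int_minus divide_inverse)
  moreover obtain j where "m = Suc j" using m(2) by (cases m) auto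
  ultimately have "x ^ N * s ^ Suc j \<in> U" by simp
  then have "inverse (x ^ N * s ^ Suc j) * (x ^ N * s ^ j) \<in> R"
    using x s_mem by (intro mult_closed power_closed) (auto simp: U_def)
  then show False using inv_s x(1) s_nz by (simp add: field_simps)
qed

lemma w0_add:
  assumes "x \<noteq> 0" "y \<noteq> 0" "x + y \<noteq> 0"
  shows "min (w0 x) (w0 y) \<le> w0 (x + y)"
proof -
  have *: "w0 y \<le> w0 (x + y)" if "x \<noteq> 0" "y \<noteq> 0" "x + y \<noteq> 0" "x / y \<in> R" for x y
  proof -
    have "x / y + 1 \<in> R" using that by (intro add_closed) auto
    moreover have e: "x + y = y * (x / y + 1)" using that by (simp add: field_simps)
    moreover have "x / y + 1 \<noteq> 0" using that e by auto
    ultimately show ?thesis using w0_nonneg[of "x / y + 1"] w0_mult[of y "x / y + 1"] that by simp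
  qed
  have "x / y \<in> R \<or> y / x \<in> R" using valuation_ring[of "x / y"] assms by auto
  then show ?thesis using *[of x y] *[of y x] assms by (auto simp: add.commute)
qed

lemma w0_powi: "x \<noteq> 0 \<Longrightarrow> w0 (x powi n) = n * w0 x"
proof -
  assume x: "x \<noteq> 0"
  have pow: "w0 (y ^ k) = int k * w0 y" if y: "y \<noteq> 0" for y k
  proof (induction k)
    case (Suc k)
    have "w0 (y ^ Suc k) = w0 y + w0 (y ^ k)" using y w0_mult[of y "y ^ k"] by simp
    then show ?case unfolding Suc.IH by (simp add: distrib_right)
  qed (simp add: w0_1)
  show ?thesis
  proof (cases "n \<ge> 0")
    case True
    then show ?thesis using pow[OF x, of "nat n"] by (simp add: power_int_def)
  next
    case False
    then show ?thesis using pow[of "inverse x" "nat (- n)"] x by (simp add: power_int_def w0_inverse)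
  qed
qed

text \<open>The values of \<open>w0\<close> form a nonzero subgroup of the integers; dividing by its
  least positive element \<open>e\<close> makes the valuation surjective.\<close>

lemma ex_discrete_valuation: "\<exists>w. discrete_valuation w \<and> w s > 0"
proof -
  define pos_value where "pos_value e \<longleftrightarrow> e > 0 \<and> (\<exists>x. x \<noteq> 0 \<and> w0 x = int e)" for e
  define e where "e = (LEAST e. pos_value e)"
  have "pos_value N" unfolding pos_value_def using N_pos w0_s s_nz by auto
  then have "pos_value e" unfolding e_def by (rule LeastI)
  then obtain x0 where e: "e > 0" "x0 \<noteq> 0" "w0 x0 = int e" unfolding pos_value_def by auto
  have dvd: "w0 x = (w0 x div int e) * int e" for x
  proof (cases "x = 0")
    case False
    define y where "y = x / x0 powi (w0 x div int e)"
    have y: "y \<noteq> 0" using False e by (simp add: y_def)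
    have "w0 y = w0 x - (w0 x div int e) * int e"
      using False e by (simp add: y_def divide_inverse w0_mult w0_inverse w0_powi)
    also have "\<dots> = w0 x mod int e" by (simp add: minus_div_mult_eq_mod)
    finally have wy: "w0 y = w0 x mod int e" .
    have "w0 x mod int e = 0"
    proof (rule ccontr)
      assume "w0 x mod int e \<noteq> 0"
      moreover have "w0 x mod int e \<ge> 0" "w0 x mod int e < int e" using e by auto
      ultimately have n: "nat (w0 x mod int e) > 0" "w0 y = int (nat (w0 x mod int e))"
        "nat (w0 x mod int e) < e"
        using wy by auto
      then have "pos_value (nat (w0 x mod int e))" using y unfolding pos_value_def by blast
      then show False using not_less_Least n(3) unfolding e_def by blast
    qed
    then show ?thesis using div_mult_mod_eq[of "w0 x" "int e"] by simp
  qed (simp add: w0_def)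
  define w where "w x = w0 x div int e" for x
  have ww: "w0 x = w x * int e" for x using dvd[of x] by (simp add: w_def)
  have "discrete_valuation w"
    unfolding discrete_valuation_def
  proof (intro conjI allI impI)
    show "w 0 = 0" by (simp add: w_def w0_def)
    fix x y :: 'a
    assume "x \<noteq> 0 \<and> y \<noteq> 0"
    then have "w (x * y) * int e = (w x + w y) * int e"
      using w0_mult[of x y] by (simp add: ww[symmetric] distrib_right)
    then show "w (x * y) = w x + w y" using e by simp
  next
    fix x y :: 'a
    assume "x \<noteq> 0 \<and> y \<noteq> 0 \<and> x + y \<noteq> 0"
    then have "min (w0 x) (w0 y) \<le> w0 (x + y)" by (intro w0_add) auto
    then show "min (w x) (w y) \<le> w (x + y)"
      using e unfolding ww by (auto simp: min_def split: if_splits)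
  next
    show "w ` (UNIV - {0}) = UNIV"
    proof (intro equalityI subsetI)
      fix n :: int
      have "w (x0 powi n) * int e = n * int e" using e by (simp add: ww[symmetric] w0_powi)
      then have "w (x0 powi n) = n" using e by simp
      then show "n \<in> w ` (UNIV - {0})" using e by (intro image_eqI[of _ _ "x0 powi n"]) auto
    qed simp
  qed
  moreover have "w s > 0"
  proof -
    have "w s * int e > 0" using w0_s N_pos by (simp add: ww[symmetric])
    then show ?thesis using e by (simp add: zero_less_mult_iff)
  qed
  ultimately show ?thesis by blast
qed

end

context function_field
begin

text \<open>A function transcendental over the constants has a zero. Zorn's lemma enlarges
  \<open>F[s]\<close> to a maximal subring without \<open>1/s\<close>. The powers of any
  \<open>x\<close> satisfy a relation of bounded length over \<open>F[s]\<close>, and two of its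
  terms with equal value compare a power of \<open>x\<close> with a power of
  \<open>s\<close>.\<close>

lemma ex_valuation_pos:
  assumes trans: "\<And>P. P \<in> PF \<Longrightarrow> P \<noteq> 0 \<Longrightarrow> poly P s \<noteq> 0"
  obtains w where "discrete_valuation w" "w s > 0"
proof -
  have "poly [:0, 1:] s \<noteq> 0" by (rule trans) auto
  then have s: "s \<noteq> 0" by simp
  let ?A = "{R. is_subring R \<and> F \<subseteq> R \<and> s \<in> R \<and> inverse s \<notin> R}"
  let ?R0 = "(\<lambda>P. poly P s) ` PF"
  have "inverse s \<notin> ?R0"
  proof
    assume "inverse s \<in> ?R0"
    then obtain P where P: "inverse s = poly P s" "P \<in> PF" by (rule imageE)
    have "poly (pCons (-1) P) s = s * poly P s - 1" by simp
    also have "\<dots> = 0" using s by (simp flip: P(1))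
    finally have "poly (pCons (-1) P) s = 0" .
    moreover have "pCons (-1) P \<in> PF" using P(2) uminus_closed[of 1] by simp
    ultimately show False using trans[of "pCons (-1) P"] by simp
  qed
  moreover have "is_subring ?R0" "F \<subseteq> ?R0" "s \<in> ?R0"
    by (rule adjoin_subring adjoin_contains adjoin_contains_gen)+
  ultimately have "?R0 \<in> ?A" by blast
  then have "\<exists>M\<in>?A. \<forall>X\<in>?A. M \<subseteq> X \<longrightarrow> X = M"
  proof (intro subset_Zorn_nonempty)
    fix C assume C: "C \<noteq> {}" "subset.chain ?A C"
    then have C': "C \<subseteq> ?A" "\<forall>R\<in>C. \<forall>S\<in>C. R \<subseteq> S \<or> S \<subseteq> R"
      unfolding subset_chain_def by blast+
    have "is_subring (\<Union>C)"
    proof (rule is_subring_Union_chain[OF C(1)])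
      show "is_subring R" if "R \<in> C" for R using that C'(1) by blast
      show "R \<subseteq> S \<or> S \<subseteq> R" if "R \<in> C" "S \<in> C" for R S using that C'(2) by blast
    qed
    moreover obtain R1 where "R1 \<in> C" using C(1) by blast
    then have "F \<subseteq> \<Union>C" "s \<in> \<Union>C" using C'(1) by blast+
    moreover have "inverse s \<notin> \<Union>C" using C'(1) by blast
    ultimately show "\<Union>C \<in> ?A" by blast
  qed (rule exI[of _ ?R0, THEN ex_in_conv[THEN iffD1]])
  then obtain R where RA: "R \<in> ?A" and Rmax: "\<forall>X\<in>?A. R \<subseteq> X \<longrightarrow> X = R" by (elim bexE)
  have R: "is_subring R" "F \<subseteq> R" "s \<in> R" "inverse s \<notin> R" using RA by simp_all
  interpret R: maximal_subring R s
  proof unfold_locales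
    fix S assume S: "is_subring S" "R \<subseteq> S" "inverse s \<notin> S"
    then have "S \<in> ?A" using R by blast
    then show "S = R" using Rmax S(2) by blast
  qed (use R in auto)
  \<comment> \<open>After removal of a power of \<open>s\<close>, a polynomial in \<open>s\<close>
    is a nonzero constant times \<open>1 - s * b\<close> with \<open>b\<close> in \<open>R\<close>,
    hence a unit.\<close>
  have unit: "\<exists>j. poly P s / s ^ j \<in> R.U" if P: "P \<in> PF" "P \<noteq> 0" for P
  proof -
    obtain j T where PT: "P = monom 1 j * T" "T = poly_shift j P" "coeff T 0 \<noteq> 0"
      using poly_eq_monom_mult[OF P(2)] by blast
    have TF: "T \<in> PF" using P unfolding PT(2) by (auto simp: polys_over_def coeff_poly_shift)
    obtain a T' where T': "T = pCons a T'" by (cases T)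
    have a: "a \<noteq> 0" "a \<in> F" "T' \<in> PF" using PT(3) TF unfolding T' by auto
    define b where "b = - (inverse a * poly T' s)"
    have "poly T' s \<in> R"
      by (rule R.poly_in_subring) (use a R in \<open>auto simp: polys_over_def\<close>)
    then have b: "b \<in> R" unfolding b_def
      using a R inverse_closed by (intro R.uminus_closed R.mult_closed) auto
    have "1 - s * b \<in> R.U"
      unfolding R.U_def using R.one_minus_unit[OF b] R.s_mem b by (auto intro: R.diff_closed R.mult_closed)
    moreover have "a \<in> R.U" using a R inverse_closed by (auto simp: R.U_def)
    ultimately have "a * (1 - s * b) \<in> R.U" by (intro R.U_mult)
    moreover have "poly T s = a * (1 - s * b)" using a by (simp add: T' b_def field_simps)
    moreover have "poly P s / s ^ j = poly T s" using s by (subst PT(1)) (simp add: poly_monom)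
    ultimately have "poly P s / s ^ j \<in> R.U" by simp
    then show ?thesis by blast
  qed
  then obtain ord where ord: "poly P s / s ^ ord P \<in> R.U" if "P \<in> PF" "P \<noteq> 0" for P by metis
  obtain k where k: "\<And>x :: nat \<Rightarrow> 'a. \<exists>P. (\<forall>l<k. P l \<in> PF) \<and> (\<exists>l<k. P l \<noteq> 0) \<and>
    (\<Sum>l<k. poly (P l) s * x l) = 0" using poly_dependence[of s] by blast
  have small: "\<exists>n j. 0 < n \<and> n \<le> k \<and> x ^ n / s powi j \<in> R.U" if x: "x \<noteq> 0" for x
  proof -
    obtain P where P: "\<forall>l<k. P l \<in> PF" "\<exists>l<k. P l \<noteq> 0" "(\<Sum>l<k. poly (P l) s * x ^ l) = 0"
      using k[of "\<lambda>l. x ^ l"] by blast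
    let ?I = "{l. l < k \<and> P l \<noteq> 0}"
    have "(\<Sum>l\<in>?I. poly (P l) s * x ^ l) = (\<Sum>l<k. poly (P l) s * x ^ l)"
      by (intro sum.mono_neutral_left) auto
    then have sum0: "(\<Sum>l\<in>?I. poly (P l) s * x ^ l) = 0" using P(3) by simp
    have nz: "poly (P l) s * x ^ l \<noteq> 0" if l: "l \<in> ?I" for l using l P(1) trans[of "P l"] x by simp
    have "finite ?I" "?I \<noteq> {}" using P(2) by auto
    from R.two_dominant_terms[OF this nz sum0] obtain i j where ij: "i \<in> ?I" "j \<in> ?I" "i \<noteq> j"
      "(poly (P i) s * x ^ i) / (poly (P j) s * x ^ j) \<in> R.U" by blast
    have *: "\<exists>n j. 0 < n \<and> n \<le> k \<and> x ^ n / s powi j \<in> R.U"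
      if ij: "i < k" "j < i" "P i \<noteq> 0" "P j \<noteq> 0" "(poly (P i) s * x ^ i) / (poly (P j) s * x ^ j) \<in> R.U" for i j
    proof -
      define a where "a = poly (P i) s / s ^ ord (P i)"
      define b where "b = poly (P j) s / s ^ ord (P j)"
      have ab: "a \<in> R.U" "b \<in> R.U" unfolding a_def b_def using ord P(1) ij by simp_all
      have "(poly (P i) s * x ^ i) / (poly (P j) s * x ^ j) * (b * inverse a) \<in> R.U"
        using ab ij by (intro R.U_mult R.U_inverse)
      moreover have "x ^ i = x ^ (i - j) * x ^ j" using ij by (simp flip: power_add)
      moreover have "poly (P i) s \<noteq> 0" "poly (P j) s \<noteq> 0" using trans P(1) ij by simp_all
      ultimately have "x ^ (i - j) / s powi (int (ord (P j)) - int (ord (P i))) \<in> R.U"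
        using x s by (simp add: a_def b_def power_int_diff field_simps)
      then show ?thesis using ij by (intro exI[of _ "i - j"]) auto
    qed
    show ?thesis
    proof (cases "j < i")
      case True
      then show ?thesis using *[of i j] ij by auto
    next
      case False
      have "(poly (P j) s * x ^ j) / (poly (P i) s * x ^ i) \<in> R.U"
        using R.U_inverse[OF ij(4)] by simp
      then show ?thesis using *[of j i] ij False by auto
    qed
  qed
  \<comment> \<open>The exponents \<open>n\<close> vary with \<open>x\<close> but are at most
    \<open>k\<close>, so \<open>fact k\<close> serves for all \<open>x\<close>.\<close>
  interpret R: finite_ramification R s "fact k"
  proof unfold_locales
    fix x :: 'a assume "x \<noteq> 0"
    then obtain n j where n: "0 < n" "n \<le> k" "x ^ n / s powi j \<in> R.U" using small by blast
    then obtain m where m: "fact k = n * m" using dvd_fact[of n k] by (auto elim: dvdE)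
    have "(x ^ n / s powi j) ^ m \<in> R.U" by (rule R.U_power) fact
    then have "x ^ fact k / s powi (j * int m) \<in> R.U"
      by (simp add: m power_divide power_mult power_int_mult)
    then show "\<exists>j. x ^ fact k / s powi j \<in> R.U" by blast
  qed simp
  show ?thesis using R.ex_discrete_valuation that by blast
qed

end


lemma valued_field_bounded:
  assumes "finite X"
  shows "\<exists>C. \<forall>x\<in>X. x \<in> vball v (- int C)"
proof -
  have "finite ((\<lambda>x. nat \<bar>v x\<bar>) ` X)" using assms by simp
  then obtain C where C: "\<And>x. x \<in> X \<Longrightarrow> nat \<bar>v x\<bar> \<le> C" using Max_ge by blast
  have "x \<in> vball v (- int C)" if "x \<in> X" for x
  proof -
    have "- int C \<le> v x" using C[OF that] by linarith
    then show ?thesis by (simp add: vball_def)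
  qed
  then show ?thesis by blast
qed

text \<open>Equal labels mean congruence to depth \<open>k\<close> at all places of \<open>S\<close>
  at once. The label is the tuple of chosen representatives, and there are finitely many of these
  because the residue fields are finite.\<close>

lemma finite_label:
  fixes S :: "('a::field \<Rightarrow> int) set"
  assumes "finite S" "\<forall>w\<in>S. discrete_valuation w \<and> (\<exists>D. residue_reps w D)"
  shows "\<exists>\<phi> :: 'a \<Rightarrow> ('a \<Rightarrow> int) \<Rightarrow> 'a. finite (\<phi> ` {x. \<forall>w\<in>S. x \<in> vball w m}) \<and>
    (\<forall>x y. (\<forall>w\<in>S. x \<in> vball w m) \<longrightarrow> (\<forall>w\<in>S. y \<in> vball w m) \<longrightarrow>
      \<phi> x = \<phi> y \<longrightarrow> (\<forall>w\<in>S. x - y \<in> vball w (m + int k)))"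
proof -
  have "\<exists>T. finite T \<and> (\<forall>x\<in>vball w m. \<exists>t\<in>T. x - t \<in> vball w (m + int k))" if w: "w \<in> S" for w
  proof -
    interpret valued_field w using bspec[OF assms(2) w] by unfold_locales simp
    obtain D where "residue_reps w D" using bspec[OF assms(2) w] by blast
    from vball_finite_cover[OF this, of k m] show ?thesis by auto
  qed
  then have "\<exists>T. \<forall>w\<in>S. finite (T w) \<and> (\<forall>x\<in>vball w m. \<exists>t\<in>T w. x - t \<in> vball w (m + int k))"
    by (rule bchoice[OF ballI])
  then obtain T where T: "\<forall>w\<in>S. finite (T w) \<and> (\<forall>x\<in>vball w m. \<exists>t\<in>T w. x - t \<in> vball w (m + int k))" ..
  define f where "f w x = (SOME t. t \<in> T w \<and> x - t \<in> vball w (m + int k))" for w x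
  have f: "f w x \<in> T w \<and> x - f w x \<in> vball w (m + int k)" if "w \<in> S" "x \<in> vball w m" for w x
    unfolding f_def by (rule someI_ex) (use T that in blast)
  define \<phi> where "\<phi> x = restrict (\<lambda>w. f w x) S" for x
  have "\<phi> ` {x. \<forall>w\<in>S. x \<in> vball w m} \<subseteq> PiE S T"
    using f by (auto simp: \<phi>_def)
  moreover have "finite (PiE S T)" using assms(1) T by (intro finite_PiE) auto
  ultimately have 1: "finite (\<phi> ` {x. \<forall>w\<in>S. x \<in> vball w m})" by (rule finite_subset)
  have 2: "x - y \<in> vball w (m + int k)"
    if xy: "\<And>w. w \<in> S \<Longrightarrow> x \<in> vball w m" "\<And>w. w \<in> S \<Longrightarrow> y \<in> vball w m" "\<phi> x = \<phi> y" "w \<in> S" for x y w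
  proof -
    interpret valued_field w using bspec[OF assms(2) xy(4)] by unfold_locales simp
    have "f w x = f w y" using xy(3,4) unfolding \<phi>_def by (metis restrict_apply')
    moreover have "(x - f w x) - (y - f w y) \<in> vball w (m + int k)"
      using vball_diff[OF conjunct2[OF f[OF xy(4) xy(1)[OF xy(4)]]] conjunct2[OF f[OF xy(4) xy(2)[OF xy(4)]]]] .
    ultimately show ?thesis by simp
  qed
  show ?thesis
  proof (rule exI[of _ \<phi>], intro conjI allI impI ballI)
    show "finite (\<phi> ` {x. \<forall>w\<in>S. x \<in> vball w m})" by (rule 1)
    fix x y w assume "\<forall>w\<in>S. x \<in> vball w m" "\<forall>w\<in>S. y \<in> vball w m" "\<phi> x = \<phi> y" "w \<in> S"
    then show "x - y \<in> vball w (m + int k)" by (intro 2) simp_all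
  qed
qed

context function_field
begin

section \<open>Valuations of a function field\<close>

text \<open>Nonzero constants are roots of unity, as their powers lie in a finite set.\<close>

lemma val_constant:
  assumes "discrete_valuation v" "x \<in> F" "x \<noteq> 0"
  shows "v x = 0"
proof -
  interpret valued_field v by unfold_locales fact
  have "range (\<lambda>n::nat. x ^ n) \<subseteq> F" by (rule image_subsetI) (rule power_closed[OF assms(2)])
  then have "finite (range (\<lambda>n::nat. x ^ n))" using finite_F finite_subset by blast
  then have "\<not> inj (\<lambda>n::nat. x ^ n)" using finite_imageD by blast
  then obtain i j where "x ^ i = x ^ j" "i \<noteq> j" unfolding inj_def by blast
  then have "int i * v x = int j * v x" using val_power[OF assms(3), of i] val_power[OF assms(3), of j] by simp
  then show ?thesis using \<open>i \<noteq> j\<close> by simp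
qed

lemma constant_vball: "discrete_valuation v \<Longrightarrow> x \<in> F \<Longrightarrow> x \<in> vball v 0"
  by (cases "x = 0") (simp_all add: vball_def val_constant)

text \<open>At a pole of \<open>s\<close> the leading term dominates, because the coefficients have
  value 0. In particular an element with a pole is transcendental over \<open>F\<close>.\<close>

lemma val_poly_neg:
  assumes "discrete_valuation v" "v s < 0" "P \<in> PF" "P \<noteq> 0"
  shows "poly P s \<noteq> 0 \<and> v (poly P s) = int (degree P) * v s"
  using assms(3,4)
proof (induction P)
  case (pCons a P)
  interpret valued_field v by unfold_locales fact
  have s: "s \<noteq> 0" using assms(2) by auto
  have a: "a \<in> F" "P \<in> PF" using pCons.prems by simp_all
  show ?case
  proof (cases "P = 0")
    case True
    then show ?thesis using pCons.prems val_constant[OF assms(1) a(1)] by simp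
  next
    case False
    then have IH: "poly P s \<noteq> 0" "v (poly P s) = int (degree P) * v s" using pCons.IH a by simp_all
    have v: "v (s * poly P s) = int (degree (pCons a P)) * v s"
      using IH s False by (simp add: val_mult algebra_simps)
    have "int (degree (pCons a P)) * v s < 0" using False assms(2) by (simp add: mult_pos_neg)
    then have "v (s * poly P s) + 1 \<le> 0" using v by simp
    then have "a \<in> vball v (v (s * poly P s) + 1)"
      using vball_mono constant_vball[OF assms(1) a(1)] by blast
    then show ?thesis using val_add_eq[of "s * poly P s" a] IH s v by (simp add: add.commute)
  qed
qed simp

lemma poly_vball:
  assumes "discrete_valuation v" "s \<in> vball v 0" "P \<in> PF"
  shows "poly P s \<in> vball v 0"
proof -
  interpret valued_field v by unfold_locales fact
  show ?thesis
    using assms(3)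
  proof (induction P)
    case (pCons a P)
    then have "a \<in> F" "P \<in> PF" by auto
    then have "s * poly P s \<in> vball v 0" "a \<in> vball v 0"
      using pCons.IH vball_mult0[OF assms(2)] constant_vball[OF assms(1)] by blast+
    then show ?case using vball_add by simp
  qed simp
qed

lemma poly_vball_1:
  assumes "discrete_valuation v" "s \<in> vball v 1" "P \<in> PF"
  shows "poly P s - coeff P 0 \<in> vball v 1"
proof -
  interpret valued_field v by unfold_locales fact
  obtain a Q where P: "P = pCons a Q" by (cases P)
  have "poly Q s \<in> vball v 0"
    using assms(3) P by (intro poly_vball assms(1) vball_mono[OF assms(2)]) simp_all
  from vball_mult0[OF this assms(2)] show ?thesis by (simp add: P mult.commute)
qed

text \<open>Take a uniformizer \<open>s\<close>. Modulo the maximal ideal a normalised relation over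
  \<open>F[s]\<close> keeps only the constant terms, so any \<open>k\<close> residues are linearly
  dependent over the finite field \<open>F\<close>.\<close>

proposition finite_residue_field:
  fixes v :: "'a \<Rightarrow> int"
  assumes "discrete_valuation v"
  shows "\<exists>D. residue_reps v D"
proof -
  interpret valued_field v by unfold_locales fact
  obtain s where s: "s \<noteq> 0" "v s = 1" using uniformizer .
  have s1: "s \<in> vball v 1" using s by (simp add: vball_def)
  obtain k where k: "\<And>x :: nat \<Rightarrow> 'a. \<exists>P. (\<forall>l<k. P l \<in> PF) \<and> (\<exists>l<k. coeff (P l) 0 \<noteq> 0) \<and>
    (\<Sum>l<k. poly (P l) s * x l) = 0" using poly_dependence_normalised[OF s(1)] by blast
  have dep: "\<exists>c. (\<forall>l<k. c l \<in> F) \<and> (\<exists>l<k. c l \<noteq> 0) \<and> (\<Sum>l<k. c l * x l) \<in> vball v 1"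
    if x: "\<And>l. l < k \<Longrightarrow> x l \<in> vball v 0" for x :: "nat \<Rightarrow> 'a"
  proof -
    obtain P where P: "\<forall>l<k. P l \<in> PF" "\<exists>l<k. coeff (P l) 0 \<noteq> 0" "(\<Sum>l<k. poly (P l) s * x l) = 0"
      using k[of x] by blast
    have "(\<Sum>l<k. coeff (P l) 0 * x l) = - (\<Sum>l<k. (poly (P l) s - coeff (P l) 0) * x l)"
      using P(3) by (simp add: left_diff_distrib sum_subtractf)
    also have "\<dots> \<in> vball v 1"
    proof (intro vball_minus vball_sum)
      fix l assume l: "l \<in> {..<k}"
      have "x l * (poly (P l) s - coeff (P l) 0) \<in> vball v 1"
        using l x P by (intro vball_mult0 poly_vball_1 assms s1) auto
      then show "(poly (P l) s - coeff (P l) 0) * x l \<in> vball v 1" by (simp add: mult.commute)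
    qed
    finally have "(\<Sum>l<k. coeff (P l) 0 * x l) \<in> vball v 1" .
    moreover have "\<forall>l<k. coeff (P l) 0 \<in> F" using P(1) polys_coeff by simp
    ultimately show ?thesis using P(2) by (intro exI[of _ "\<lambda>l. coeff (P l) 0"] conjI)
  qed
  have "\<exists>n (x :: nat \<Rightarrow> 'a). (\<forall>l<n. x l \<in> vball v 0) \<and>
      (\<forall>y\<in>vball v 0. \<exists>c. (\<forall>l\<le>n. c l \<in> F) \<and> c n \<noteq> 0 \<and> (\<Sum>l<n. c l * x l) + c n * y \<in> vball v 1)"
    by (rule maximal_independent[of k]) (rule dep)
  then obtain n and x :: "nat \<Rightarrow> 'a" where nx: "\<forall>l<n. x l \<in> vball v 0"
    "\<forall>y\<in>vball v 0. \<exists>c. (\<forall>l\<le>n. c l \<in> F) \<and> c n \<noteq> 0 \<and> (\<Sum>l<n. c l * x l) + c n * y \<in> vball v 1"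
    by (elim exE conjE)
  let ?D = "(\<lambda>a. \<Sum>l<n. a l * x l) ` PiE {..<n} (\<lambda>_. F)"
  have "finite ?D" using finite_F by (intro finite_imageI finite_PiE) auto
  moreover have "\<exists>d\<in>?D. y - d \<in> vball v 1" if y: "y \<in> vball v 0" for y
  proof -
    obtain c where c: "\<forall>l\<le>n. c l \<in> F" "c n \<noteq> 0" "(\<Sum>l<n. c l * x l) + c n * y \<in> vball v 1"
      using bspec[OF nx(2) y] by (elim exE conjE)
    let ?a = "restrict (\<lambda>l. - (c l / c n)) {..<n}"
    have "(\<Sum>l<n. ?a l * x l) = (\<Sum>l<n. - (inverse (c n) * (c l * x l)))"
      by (rule sum.cong) (simp_all add: divide_inverse)
    then have "inverse (c n) * ((\<Sum>l<n. c l * x l) + c n * y) = y - (\<Sum>l<n. ?a l * x l)"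
      using c(2) by (simp add: distrib_left sum_distrib_left sum_negf flip: mult.assoc)
    moreover have "inverse (c n) * ((\<Sum>l<n. c l * x l) + c n * y) \<in> vball v 1"
      using c by (intro vball_mult0 constant_vball assms inverse_closed) auto
    moreover have "?a \<in> PiE {..<n} (\<lambda>_. F)" using c by (auto intro!: uminus_closed divide_closed)
    then have "(\<Sum>l<n. ?a l * x l) \<in> ?D" by (rule imageI)
    ultimately show ?thesis by (intro bexI[of _ "\<Sum>l<n. ?a l * x l"]) simp_all
  qed
  ultimately obtain D where "residue_reps v D" by (rule residue_repsI)
  then show ?thesis ..
qed

text \<open>Among \<open>k\<close> poles, weak approximation supplies elements that are 1 at one
  pole and 0 at the others. A normalised relation between them over \<open>F[1/s]\<close>, reduced
  at the pole whose index carries a nonzero constant term, says that this constant is 0.\<close>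

proposition finite_poles:
  fixes s :: 'a
  shows "finite {w. discrete_valuation w \<and> w s < 0}" (is "finite ?W")
proof (rule ccontr)
  assume inf: "infinite ?W"
  then have "?W \<noteq> {}" by (metis finite.emptyI)
  then obtain w1 where "w1 \<in> ?W" by blast
  then interpret w1: valued_field w1 by unfold_locales simp
  have s: "s \<noteq> 0" using \<open>w1 \<in> ?W\<close> by auto
  define r where "r = inverse s"
  obtain k where k: "\<And>x :: nat \<Rightarrow> 'a. \<exists>P. (\<forall>l<k. P l \<in> PF) \<and> (\<exists>l<k. coeff (P l) 0 \<noteq> 0) \<and>
    (\<Sum>l<k. poly (P l) r * x l) = 0" using poly_dependence_normalised[of r] s by (auto simp: r_def)
  obtain T where T: "T \<subseteq> ?W" "finite T" "card T = k"
    using infinite_arbitrarily_large[OF inf] by blast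
  then obtain g where g: "bij_betw g {..<k} T"
    using ex_bij_betw_nat_finite[OF T(2)] by (auto simp: atLeast0LessThan)
  have gT: "g l \<in> T" if "l < k" for l using g that by (auto simp: bij_betw_def)
  have "\<forall>l\<in>{..<k}. \<exists>\<theta>. \<theta> - 1 \<in> vball (g l) (int 1) \<and> (\<forall>w\<in>T - {g l}. \<theta> \<in> vball w (int 1))"
  proof
    fix l assume "l \<in> {..<k}"
    then have "g l \<in> T" using gT by simp
    then show "\<exists>\<theta>. \<theta> - 1 \<in> vball (g l) (int 1) \<and> (\<forall>w\<in>T - {g l}. \<theta> \<in> vball w (int 1))"
      using T by (intro weak_approximation) auto
  qed
  from bchoice[OF this] obtain \<theta> where
    "\<forall>l\<in>{..<k}. \<theta> l - 1 \<in> vball (g l) (int 1) \<and> (\<forall>w\<in>T - {g l}. \<theta> l \<in> vball w (int 1))" ..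
  then have \<theta>: "\<And>l. l < k \<Longrightarrow> \<theta> l - 1 \<in> vball (g l) 1"
    "\<And>l w. l < k \<Longrightarrow> w \<in> T \<Longrightarrow> w \<noteq> g l \<Longrightarrow> \<theta> l \<in> vball w 1" by simp_all
  obtain P m where P: "\<forall>l<k. P l \<in> PF" "m < k" "coeff (P m) 0 \<noteq> 0" "(\<Sum>l<k. poly (P l) r * \<theta> l) = 0"
    using k[of \<theta>] by blast
  define w where "w = g m"
  have w: "discrete_valuation w" "w s < 0" using gT[OF P(2)] T by (auto simp: w_def)
  interpret valued_field w by unfold_locales fact
  have r: "r \<in> vball w 1" using w by (auto simp: r_def vball_def)
  have r0: "r \<in> vball w 0" using r vball_mono by auto
  have "(\<Sum>l\<in>{..<k} - {m}. poly (P l) r * \<theta> l) \<in> vball w 1"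
  proof (intro vball_sum vball_mult0)
    fix l assume l: "l \<in> {..<k} - {m}"
    show "poly (P l) r \<in> vball w 0" using l P by (intro poly_vball w r0) auto
    have "g l \<noteq> w" using l P(2) g unfolding w_def bij_betw_def inj_on_def by blast
    then show "\<theta> l \<in> vball w 1" using l gT[OF P(2)] by (intro \<theta>(2)) (auto simp: w_def)
  qed
  moreover have "(\<Sum>l\<in>{..<k} - {m}. poly (P l) r * \<theta> l) = - (poly (P m) r * \<theta> m)"
    using P by (simp add: sum_diff1)
  ultimately have 1: "poly (P m) r * \<theta> m \<in> vball w 1" by simp
  have 2: "poly (P m) r * (\<theta> m - 1) \<in> vball w 1"
    using \<theta>(1)[OF P(2)] P by (intro vball_mult0 poly_vball w r0) (auto simp: w_def)
  have 3: "poly (P m) r - coeff (P m) 0 \<in> vball w 1"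
    using P by (intro poly_vball_1 w r) auto
  have "poly (P m) r * \<theta> m - poly (P m) r * (\<theta> m - 1) - (poly (P m) r - coeff (P m) 0) \<in> vball w 1"
    by (rule vball_diff[OF vball_diff[OF 1 2] 3])
  then have "coeff (P m) 0 \<in> vball w 1" by (simp add: algebra_simps)
  moreover have "w (coeff (P m) 0) = 0" using P by (intro val_constant w polys_coeff) auto
  ultimately show False using P by (simp add: vball_def)
qed

lemma polys_division:
  assumes "Q \<in> PF" "Q \<noteq> 0" "P \<in> PF"
  shows "\<exists>D\<in>PF. \<exists>R\<in>PF. P = D * Q + R \<and> (R = 0 \<or> degree R < degree Q)"
  using assms(3)
proof (induction P)
  case 0
  show ?case by (intro bexI[of _ 0]) auto
next
  case (pCons a P)
  then obtain D R where DR: "D \<in> PF" "R \<in> PF" "P = D * Q + R" "R = 0 \<or> degree R < degree Q" by auto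
  have a: "a \<in> F" using pCons.prems by simp
  define c where "c = coeff (pCons a R) (degree Q) / lead_coeff Q"
  define R' where "R' = pCons a R - smult c Q"
  have aR: "pCons a R \<in> PF" using a DR by simp
  have c: "c \<in> F" unfolding c_def by (intro divide_closed polys_coeff aR assms)
  have "R' \<in> PF" unfolding R'_def by (intro polys_diff polys_smult aR c assms)
  moreover have "pCons c D \<in> PF" using c DR by simp
  moreover have "pCons a P = pCons c D * Q + R'"
    by (simp add: R'_def DR(3) mult_pCons_left)
  moreover have "R' = 0 \<or> degree R' < degree Q"
  proof -
    have "degree (pCons a R) \<le> degree Q" using DR(4) by auto
    then have "degree R' \<le> degree Q" unfolding R'_def
      by (intro degree_diff_le) (auto intro: order_trans[OF degree_smult_le])
    moreover have "coeff R' (degree Q) = 0" using assms(2) by (simp add: R'_def c_def)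
    ultimately show ?thesis by (metis leading_coeff_0_iff le_neq_implies_less)
  qed
  ultimately show ?case by blast
qed

context
  fixes s :: 'a
  assumes transcendental: "\<forall>P\<in>PF. P \<noteq> 0 \<longrightarrow> poly P s \<noteq> 0"
begin

lemma nonvanishing: "P \<in> PF \<Longrightarrow> P \<noteq> 0 \<Longrightarrow> poly P s \<noteq> 0"
  using transcendental by simp

text \<open>If \<open>P d\<close> is the leading coefficient of an algebraic relation for
  \<open>x\<close> over \<open>F[s]\<close>, its value at \<open>s\<close> times \<open>x\<close> is
  integral: a pole would make the top term outweigh the rest of the relation.\<close>

lemma integral_multiple:
  "\<exists>Q\<in>PF. poly Q s \<noteq> 0 \<and> (\<forall>w. discrete_valuation w \<longrightarrow> 0 \<le> w s \<longrightarrow> poly Q s * x \<in> vball w 0)"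
proof -
  obtain k where k: "\<And>x :: nat \<Rightarrow> 'a. \<exists>P. (\<forall>l<k. P l \<in> PF) \<and> (\<exists>l<k. P l \<noteq> 0) \<and>
    (\<Sum>l<k. poly (P l) s * x l) = 0" using poly_dependence[of s] by blast
  obtain P where P: "\<forall>l<k. P l \<in> PF" "\<exists>l<k. P l \<noteq> 0" "(\<Sum>l<k. poly (P l) s * x ^ l) = 0"
    using k[of "\<lambda>l. x ^ l"] by auto
  define L where "L = {l. l < k \<and> P l \<noteq> 0}"
  define d where "d = Max L"
  have L: "finite L" "L \<noteq> {}" using P(2) by (auto simp: L_def)
  have d: "d \<in> L" unfolding d_def by (rule Max_in[OF L])
  have ld: "l \<le> d" if "l \<in> L" for l unfolding d_def using L that by simp
  have dk: "d < k" "P d \<in> PF" "P d \<noteq> 0" using d P(1) by (auto simp: L_def)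
  have "(\<Sum>l\<in>L. poly (P l) s * x ^ l) = (\<Sum>l<k. poly (P l) s * x ^ l)"
    by (intro sum.mono_neutral_left) (auto simp: L_def)
  then have "(\<Sum>l\<in>L - {d}. poly (P l) s * x ^ l) = - (poly (P d) s * x ^ d)"
    using P(3) d L by (simp add: sum_diff1)
  then have eq: "poly (P d) s * x ^ d = - (\<Sum>l\<in>L - {d}. poly (P l) s * x ^ l)" by simp
  have "poly (P d) s * x \<in> vball w 0" if w: "discrete_valuation w" "0 \<le> w s" for w
  proof (rule ccontr)
    assume neg: "poly (P d) s * x \<notin> vball w 0"
    interpret valued_field w by unfold_locales fact
    have s0: "s \<in> vball w 0" using w by (simp add: vball_def)
    have x: "x \<noteq> 0" using neg by auto
    have pd: "poly (P d) s \<noteq> 0" using nonvanishing dk by simp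
    have "poly (P d) s \<in> vball w 0" by (intro poly_vball w s0 dk)
    then have wp: "w (poly (P d) s) \<ge> 0" using pd by (simp add: vball_def)
    have neg': "w (poly (P d) s) + w x < 0" using neg x pd by (simp add: vball_def val_mult)
    then have wx: "w x < 0" using wp by simp
    have "d \<noteq> 0"
    proof
      assume "d = 0"
      then have "L - {d} = {}" using ld by force
      then have "(\<Sum>l\<in>L - {d}. poly (P l) s * x ^ l) = 0" by (simp only: sum.empty)
      then show False using eq pd \<open>d = 0\<close> by simp
    qed
    have "- (\<Sum>l\<in>L - {d}. poly (P l) s * x ^ l) \<in> vball w ((int d - 1) * w x)"
    proof (intro vball_minus vball_sum vball_mult0)
      fix l assume l: "l \<in> L - {d}"
      then show "poly (P l) s \<in> vball w 0" using P(1) by (intro poly_vball w s0) (auto simp: L_def)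
      have "int l \<le> int d - 1" using ld[of l] l by force
      then have "(int d - 1) * w x \<le> int l * w x" using wx by (intro mult_right_mono_neg) auto
      then show "x ^ l \<in> vball w ((int d - 1) * w x)" using x by (simp add: vball_def val_power)
    qed
    then have "poly (P d) s * x ^ d \<in> vball w ((int d - 1) * w x)" using eq by simp
    then have "(int d - 1) * w x \<le> w (poly (P d) s) + int d * w x"
      using pd x by (simp add: vball_def val_mult val_power)
    then show False using neg' by (simp add: algebra_simps)
  qed
  then show ?thesis using nonvanishing[OF dk(2,3)] dk(2) by (intro bexI[of _ "P d"]) simp_all
qed

text \<open>A maximal independent family over \<open>F[s]\<close>, multiplied by one common
  denominator so that its members have poles only at poles of \<open>s\<close>. It spans over
  \<open>F(s)\<close> but need not be an integral basis.\<close>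

lemma integral_spanning_set:
  "\<exists>n (b :: nat \<Rightarrow> 'a). (\<forall>l<n. \<forall>w. discrete_valuation w \<longrightarrow> 0 \<le> w s \<longrightarrow> b l \<in> vball w 0) \<and>
    (\<forall>y. \<exists>Q\<in>PF. Q \<noteq> 0 \<and> (\<exists>P. (\<forall>l<n. P l \<in> PF) \<and> poly Q s * y = (\<Sum>l<n. poly (P l) s * b l)))"
proof -
  obtain k where k: "\<And>x :: nat \<Rightarrow> 'a. \<exists>P. (\<forall>l<k. P l \<in> PF) \<and> (\<exists>l<k. P l \<noteq> 0) \<and>
    (\<Sum>l<k. poly (P l) s * x l) = 0" using poly_dependence[of s] by blast
  let ?C = "(\<lambda>P. poly P s) ` PF"
  have dep: "\<exists>c. (\<forall>l<k. c l \<in> ?C) \<and> (\<exists>l<k. c l \<noteq> 0) \<and> (\<Sum>l<k. c l * x l) \<in> {0}" for x :: "nat \<Rightarrow> 'a"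
  proof -
    obtain P where P: "\<forall>l<k. P l \<in> PF" "\<exists>l<k. P l \<noteq> 0" "(\<Sum>l<k. poly (P l) s * x l) = 0"
      using k[of x] by blast
    then show ?thesis using nonvanishing by (intro exI[of _ "\<lambda>l. poly (P l) s"]) auto
  qed
  have "\<exists>n (x :: nat \<Rightarrow> 'a). (\<forall>l<n. x l \<in> UNIV) \<and>
      (\<forall>y\<in>UNIV. \<exists>c. (\<forall>l\<le>n. c l \<in> ?C) \<and> c n \<noteq> 0 \<and> (\<Sum>l<n. c l * x l) + c n * y \<in> {0})"
    by (rule maximal_independent[of k]) (rule dep)
  then obtain n and x :: "nat \<Rightarrow> 'a" where
    nx: "\<forall>y\<in>UNIV. \<exists>c. (\<forall>l\<le>n. c l \<in> ?C) \<and> c n \<noteq> 0 \<and> (\<Sum>l<n. c l * x l) + c n * y \<in> {0}"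
    by (elim exE conjE)
  have "\<exists>E. \<forall>l. E l \<in> PF \<and> poly (E l) s \<noteq> 0 \<and>
    (\<forall>w. discrete_valuation w \<longrightarrow> 0 \<le> w s \<longrightarrow> poly (E l) s * x l \<in> vball w 0)"
  proof (rule choice, rule allI)
    show "\<exists>Q. Q \<in> PF \<and> poly Q s \<noteq> 0 \<and>
      (\<forall>w. discrete_valuation w \<longrightarrow> 0 \<le> w s \<longrightarrow> poly Q s * x l \<in> vball w 0)" for l
      using integral_multiple[of "x l"] by (elim bexE) (rule exI, erule conjI)
  qed
  then obtain E where EE: "\<forall>l. E l \<in> PF \<and> poly (E l) s \<noteq> 0 \<and>
    (\<forall>w. discrete_valuation w \<longrightarrow> 0 \<le> w s \<longrightarrow> poly (E l) s * x l \<in> vball w 0)" ..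
  have E: "\<And>l. E l \<in> PF" "\<And>l. poly (E l) s \<noteq> 0"
    "\<And>l w. discrete_valuation w \<Longrightarrow> 0 \<le> w s \<Longrightarrow> poly (E l) s * x l \<in> vball w 0"
    using EE by simp_all
  define G where "G = (\<Prod>l<n. E l)"
  have G: "G \<in> PF" "poly G s \<noteq> 0" unfolding G_def using E by (auto intro: polys_prod simp: poly_prod)
  define b where "b l = poly G s * x l" for l
  show ?thesis
  proof (rule exI[of _ n], rule exI[of _ b], intro conjI allI impI)
    fix l w assume l: "l < n" and w: "discrete_valuation w" "0 \<le> w s"
    interpret valued_field w by unfold_locales fact
    have "G = (\<Prod>l\<in>{..<n} - {l}. E l) * E l"
      unfolding G_def using l by (subst prod.remove[of _ l]) (auto simp: mult.commute)
    then have "b l = poly (\<Prod>l\<in>{..<n} - {l}. E l) s * (poly (E l) s * x l)" by (simp add: b_def)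
    also have "\<dots> \<in> vball w 0"
    proof (rule vball_mult0)
      show "poly (\<Prod>l\<in>{..<n} - {l}. E l) s \<in> vball w 0"
        by (intro poly_vball w polys_prod E) (use w in \<open>simp add: vball_def\<close>)
      show "poly (E l) s * x l \<in> vball w 0" by (rule E(3)[OF w])
    qed
    finally show "b l \<in> vball w 0" .
  next
    fix y
    obtain c where c: "\<forall>l\<le>n. c l \<in> ?C" "c n \<noteq> 0" "(\<Sum>l<n. c l * x l) + c n * y \<in> {0}"
      using bspec[OF nx UNIV_I, of y] by (elim exE conjE)
    have "\<forall>l\<in>{..n}. \<exists>P. P \<in> PF \<and> c l = poly P s" using c(1) by blast
    then obtain P where P: "\<forall>l\<in>{..n}. P l \<in> PF \<and> c l = poly (P l) s" by (rule bchoice[THEN exE])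
    have "poly (G * P n) s * y = poly G s * (c n * y)" using P by simp
    also have "c n * y = - (\<Sum>l<n. c l * x l)" using c(3) by (simp add: eq_neg_iff_add_eq_0 add.commute)
    also have "poly G s * \<dots> = (\<Sum>l<n. poly (- P l) s * b l)"
      using P by (simp add: sum_distrib_left b_def ac_simps flip: sum_negf)
    finally have "poly (G * P n) s * y = (\<Sum>l<n. poly (- P l) s * b l)" .
    moreover have "\<forall>l<n. - P l \<in> PF"
    proof (intro allI impI)
      fix l assume "l < n"
      then have "0 - P l \<in> PF" using P by (intro polys_diff polys_0) simp
      then show "- P l \<in> PF" by simp
    qed
    moreover have "P n \<in> PF" "poly (P n) s \<noteq> 0" using P c(2) by auto
    then have "G * P n \<in> PF" "G * P n \<noteq> 0" using G polys_mult by auto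
    ultimately show "\<exists>Q\<in>PF. Q \<noteq> 0 \<and> (\<exists>P. (\<forall>l<n. P l \<in> PF) \<and> poly Q s * y = (\<Sum>l<n. poly (P l) s * b l))"
      by (intro bexI[of _ "G * P n"] conjI exI[of _ "\<lambda>l. - P l"])
  qed
qed

end

end


section \<open>Functions regular away from a place\<close>

lemma regular_away_iff:
  "x \<in> regular_away v \<longleftrightarrow> (\<forall>w. discrete_valuation w \<longrightarrow> w \<noteq> v \<longrightarrow> x \<in> vball w 0)"
  by (auto simp: regular_away_def valuation_ring_eq_vball)

lemma finite_family_bound:
  assumes "finite I" "\<And>i. i \<in> I \<Longrightarrow> \<exists>C::nat. P i C" "\<And>i C D. P i C \<Longrightarrow> C \<le> D \<Longrightarrow> P i D"
  shows "\<exists>C::nat. \<forall>i\<in>I. P i C"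
  using assms(1,2)
proof (induction I rule: finite_induct)
  case (insert i I)
  then obtain C where C: "\<forall>i\<in>I. P i C" by auto
  obtain D where D: "P i D" using insert.prems by auto
  have "P j (max C D)" if "j \<in> insert i I" for j
    using that C D assms(3)[of j _ "max C D"] by auto
  then show ?case by blast
qed simp

locale function_field_place = function_field F t B + valued_field v
  for F :: "'a::field set" and t B and v :: "'a \<Rightarrow> int"
begin

abbreviation A where "A \<equiv> regular_away v"

lemma A_I: "(\<And>w. discrete_valuation w \<Longrightarrow> w \<noteq> v \<Longrightarrow> x \<in> vball w 0) \<Longrightarrow> x \<in> A"
  by (simp add: regular_away_iff)

lemma A_D: "x \<in> A \<Longrightarrow> discrete_valuation w \<Longrightarrow> w \<noteq> v \<Longrightarrow> x \<in> vball w 0"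
  by (simp add: regular_away_iff)

lemma A_subring: "is_subring A"
  unfolding is_subring_def
proof (intro conjI ballI)
  show "1 \<in> A" by (rule A_I) (simp add: valued_field.vball_1 valued_field.intro)
  fix x y assume xy: "x \<in> A" "y \<in> A"
  show "x - y \<in> A"
    by (rule A_I) (intro valued_field.vball_diff valued_field.intro A_D xy)
  show "x * y \<in> A"
    by (rule A_I) (intro valued_field.vball_mult0 valued_field.intro A_D xy)
qed

sublocale A: sub_ring A
  by unfold_locales (rule A_subring)

text \<open>A weak form of the product formula. If a nonzero \<open>a\<close> vanishes at
  \<open>v\<close>, then \<open>1/a\<close> has a pole there and is transcendental, hence has a zero
  at some \<open>w\<close>; this \<open>w\<close> differs from \<open>v\<close> and is a pole of
  \<open>a\<close>.\<close>

lemma A_inter_vball_1: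
  assumes "a \<in> A" "a \<in> vball v 1"
  shows "a = 0"
proof (rule ccontr)
  assume a: "a \<noteq> 0"
  then have "v (inverse a) < 0" using assms(2) by (simp add: vball_def)
  then have "poly P (inverse a) \<noteq> 0" if "P \<in> PF" "P \<noteq> 0" for P
    using val_poly_neg[OF dv _ that] by simp
  then obtain w where w: "discrete_valuation w" "w (inverse a) > 0"
    by (rule ex_valuation_pos)
  interpret w: valued_field w by unfold_locales fact
  have "w a < 0" using w by simp
  moreover have "w \<noteq> v" using \<open>w a < 0\<close> assms(2) a by (auto simp: vball_def)
  then have "a \<in> vball w 0" using A_D[OF assms(1) w(1)] by simp
  ultimately show False using a by (simp add: vball_def)
qed

text \<open>In coordinates over \<open>F(s)\<close>, with \<open>s\<close> having a pole at
  \<open>v\<close>, the polynomial parts give the approximation, because proper fractions of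
  polynomials in \<open>s\<close> have no pole where \<open>s\<close> has one. The obstacle is the
  finite set of other poles of \<open>s\<close>: there \<open>x\<close> is first made integral by
  weak approximation, and the remaining bounded poles are removed by finitely many
  corrections.\<close>

proposition strong_approximation: "\<exists>C::nat. \<forall>x. \<exists>a\<in>A. x - a \<in> vball v (- int C)"
proof -
  obtain s where s: "s \<noteq> 0" "v s = -1" using val_surj .
  have trans: "\<forall>P\<in>PF. P \<noteq> 0 \<longrightarrow> poly P s \<noteq> 0"
    using val_poly_neg[OF dv] s by simp
  define W where "W = {w. discrete_valuation w \<and> w s < 0}"
  have W: "finite W" unfolding W_def by (rule finite_poles)
  have vW: "v \<in> W" using dv s by (simp add: W_def)
  define S where "S = W - {v}"
  have S: "finite S" "\<And>w. w \<in> S \<Longrightarrow> discrete_valuation w \<and> w \<noteq> v" using W by (auto simp: S_def W_def)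
  have SD: "\<forall>w\<in>S. discrete_valuation w \<and> (\<exists>D. residue_reps w D)"
    using S(2) finite_residue_field by blast
  obtain n and b :: "nat \<Rightarrow> 'a" where
    b: "\<forall>l<n. \<forall>w. discrete_valuation w \<longrightarrow> 0 \<le> w s \<longrightarrow> b l \<in> vball w 0" and
    sp: "\<forall>y. \<exists>Q\<in>PF. Q \<noteq> 0 \<and> (\<exists>P. (\<forall>l<n. P l \<in> PF) \<and> poly Q s * y = (\<Sum>l<n. poly (P l) s * b l))"
    using integral_spanning_set[OF trans] by (elim exE conjE)
  have "\<exists>C. \<forall>w\<in>W. \<forall>l<n. b l \<in> vball w (- int C)"
  proof (rule finite_family_bound[OF W])
    fix w assume "w \<in> W"
    show "\<exists>C. \<forall>l<n. b l \<in> vball w (- int C)"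
      using valued_field_bounded[of "b ` {..<n}" w] by auto
  next
    fix w C D assume "\<forall>l<n. b l \<in> vball w (- int C)" "C \<le> D"
    then show "\<forall>l<n. b l \<in> vball w (- int D)" by (auto simp: vball_def)
  qed
  then obtain C where C: "\<forall>w\<in>W. \<forall>l<n. b l \<in> vball w (- int C)" ..
  \<comment> \<open>Bounded poles at the other poles of \<open>s\<close> are tolerated for the
    moment; at \<open>v\<close> there is no condition.\<close>
  define A' where "A' = {z. (\<forall>w. discrete_valuation w \<longrightarrow> 0 \<le> w s \<longrightarrow> z \<in> vball w 0) \<and>
    (\<forall>w\<in>S. z \<in> vball w (- int C))}"
  have approx: "\<exists>a\<in>A'. x - a \<in> vball v (- int C)" for x
  proof -
    have "\<exists>M. \<forall>w\<in>W. x \<in> vball w (- int M)"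
    proof (rule finite_family_bound[OF W])
      show "\<exists>C. x \<in> vball w (- int C)" for w using valued_field_bounded[of "{x}" w] by simp
    qed (auto simp: vball_def)
    then obtain M where M: "\<forall>w\<in>W. x \<in> vball w (- int M)" ..
    \<comment> \<open>At \<open>v\<close> the factor \<theta> is so close to 1 that \<open>y\<close>
      stays near \<open>x\<close>; on \<open>S\<close> it cancels the poles of
      \<open>x\<close>.\<close>
    obtain \<theta> where \<theta>: "\<theta> - 1 \<in> vball v (int M)" "\<forall>w\<in>S. \<theta> \<in> vball w (int M)"
      using weak_approximation[OF dv S(1) S(2), of M] by blast
    define y where "y = \<theta> * x"
    have yx: "y - x \<in> vball v 0"
    proof -
      have "(\<theta> - 1) * x \<in> vball v (int M + - int M)" using \<theta> M vW by (intro vball_mult) auto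
      then show ?thesis by (simp add: y_def algebra_simps)
    qed
    have yw: "y \<in> vball w 0" if w: "w \<in> S" for w
    proof -
      interpret w: valued_field w using S w by unfold_locales simp
      have "\<theta> * x \<in> vball w (int M + - int M)" using \<theta> M w by (intro w.vball_mult) (auto simp: S_def)
      then show ?thesis by (simp add: y_def)
    qed
    obtain Q P where Q: "Q \<in> PF" "Q \<noteq> 0" and P: "\<forall>l<n. P l \<in> PF"
      and eq: "poly Q s * y = (\<Sum>l<n. poly (P l) s * b l)"
      using spec[OF sp, of y] by (elim bexE exE conjE)
    have "\<forall>l\<in>{..<n}. \<exists>DR. fst DR \<in> PF \<and> snd DR \<in> PF \<and> P l = fst DR * Q + snd DR \<and>
        (snd DR = 0 \<or> degree (snd DR) < degree Q)"
    proof
      fix l assume "l \<in> {..<n}"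
      then obtain D R where "D \<in> PF" "R \<in> PF" "P l = D * Q + R" "R = 0 \<or> degree R < degree Q"
        using polys_division[OF Q, of "P l"] P by auto
      then show "\<exists>DR. fst DR \<in> PF \<and> snd DR \<in> PF \<and> P l = fst DR * Q + snd DR \<and>
        (snd DR = 0 \<or> degree (snd DR) < degree Q)" by (intro exI[of _ "(D, R)"]) simp
    qed
    from bchoice[OF this] obtain DR where DR: "\<forall>l\<in>{..<n}. fst (DR l) \<in> PF \<and> snd (DR l) \<in> PF \<and>
      P l = fst (DR l) * Q + snd (DR l) \<and> (snd (DR l) = 0 \<or> degree (snd (DR l)) < degree Q)" ..
    define a where "a = (\<Sum>l<n. poly (fst (DR l)) s * b l)"
    have "poly Q s * y = (\<Sum>l<n. poly (fst (DR l) * Q + snd (DR l)) s * b l)"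
      unfolding eq using DR by (intro sum.cong) auto
    also have "\<dots> = poly Q s * a + (\<Sum>l<n. poly (snd (DR l)) s * b l)"
      by (simp add: a_def algebra_simps sum.distrib sum_distrib_left)
    finally have ya: "poly Q s * (y - a) = (\<Sum>l<n. poly (snd (DR l)) s * b l)"
      by (simp add: algebra_simps)
    \<comment> \<open>Remainders have smaller degree than \<open>Q\<close>, so at a pole of
      \<open>s\<close> only the poles of the \<open>b l\<close> contribute.\<close>
    have near: "y - a \<in> vball w (- int C)" if w: "w \<in> W" for w
    proof -
      have dw: "discrete_valuation w" "w s < 0" using w by (auto simp: W_def)
      interpret w: valued_field w by unfold_locales (rule dw)
      have q: "poly Q s \<noteq> 0" "w (poly Q s) = int (degree Q) * w s"
        using val_poly_neg[OF dw Q] by auto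
      have "(\<Sum>l<n. poly (snd (DR l)) s * b l) \<in> vball w (w (poly Q s) + - int C)"
      proof (intro w.vball_sum w.vball_mult)
        fix l assume l: "l \<in> {..<n}"
        then show "b l \<in> vball w (- int C)" using C w by auto
        show "poly (snd (DR l)) s \<in> vball w (w (poly Q s))"
        proof (cases "snd (DR l) = 0")
          case False
          have "degree (snd (DR l)) < degree Q" using DR l False by auto
          then have "int (degree Q) * w s \<le> int (degree (snd (DR l))) * w s"
            using dw by (intro mult_right_mono_neg) auto
          moreover have "w (poly (snd (DR l)) s) = int (degree (snd (DR l))) * w s"
            using val_poly_neg[OF dw _ False] DR l by auto
          ultimately show ?thesis using q by (simp add: vball_def)
        qed simp
      qed
      then show ?thesis using w.vball_mult_iff[OF q(1), of "y - a"] ya by simp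
    qed
    have "a \<in> vball w 0" if w: "discrete_valuation w" "0 \<le> w s" for w
    proof -
      interpret w: valued_field w by unfold_locales (rule w)
      show ?thesis unfolding a_def
      proof (intro w.vball_sum w.vball_mult0)
        fix l assume l: "l \<in> {..<n}"
        show "poly (fst (DR l)) s \<in> vball w 0" using DR l w by (intro poly_vball) (auto simp: vball_def)
        show "b l \<in> vball w 0" using b l w by auto
      qed
    qed
    moreover have "a \<in> vball w (- int C)" if w: "w \<in> S" for w
    proof -
      interpret w: valued_field w using S w by unfold_locales simp
      have "y \<in> vball w (- int C)" using yw[OF w] w.vball_mono by auto
      moreover have "y - a \<in> vball w (- int C)" using near w by (simp add: S_def)
      ultimately have "y - (y - a) \<in> vball w (- int C)" by (rule w.vball_diff)
      then show ?thesis by simp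
    qed
    ultimately have "a \<in> A'" by (simp add: A'_def)
    moreover have "(y - a) - (y - x) \<in> vball v (- int C)"
      by (intro vball_diff[OF near[OF vW]] vball_mono[OF yx]) simp
    ultimately show ?thesis by (intro bexI[of _ a]) simp_all
  qed
  obtain \<phi> :: "'a \<Rightarrow> ('a \<Rightarrow> int) \<Rightarrow> 'a" where \<phi>: "finite (\<phi> ` {x. \<forall>w\<in>S. x \<in> vball w (- int C)})"
    "\<forall>x y. (\<forall>w\<in>S. x \<in> vball w (- int C)) \<longrightarrow> (\<forall>w\<in>S. y \<in> vball w (- int C)) \<longrightarrow>
      \<phi> x = \<phi> y \<longrightarrow> (\<forall>w\<in>S. x - y \<in> vball w (- int C + int C))"
    using finite_label[OF S(1) SD, of "- int C" C] by (elim exE conjE)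
  \<comment> \<open>One element of \<open>A'\<close> per label. Subtracting it from an element with
    the same label lands in \<open>A\<close>, at the cost of an error at \<open>v\<close> bounded by
    a constant \<open>E\<close> independent of \<open>x\<close>.\<close>
  define r where "r z = (SOME a. a \<in> A' \<and> \<phi> a = z)" for z
  have r: "r (\<phi> a) \<in> A' \<and> \<phi> (r (\<phi> a)) = \<phi> a" if "a \<in> A'" for a
    unfolding r_def by (rule someI[of _ a]) (simp add: that)
  have "\<phi> ` A' \<subseteq> \<phi> ` {x. \<forall>w\<in>S. x \<in> vball w (- int C)}" by (auto simp: A'_def)
  then have "finite (r ` \<phi> ` A')" using \<phi>(1) finite_subset by blast
  then obtain E where E: "\<forall>x\<in>r ` \<phi> ` A'. x \<in> vball v (- int E)"
    using valued_field_bounded by blast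
  have "\<exists>a\<in>A. x - a \<in> vball v (- int (C + E))" for x
  proof -
    obtain a where a: "a \<in> A'" "x - a \<in> vball v (- int C)" using approx by blast
    define c where "c = r (\<phi> a)"
    have c: "c \<in> A'" "\<phi> c = \<phi> a" using r[OF a(1)] by (auto simp: c_def)
    have "a - c \<in> A"
    proof (rule A_I)
      fix w assume w: "discrete_valuation w" "w \<noteq> v"
      interpret w: valued_field w by unfold_locales (rule w)
      show "a - c \<in> vball w 0"
      proof (cases "w s < 0")
        case True
        then have "w \<in> S" using w by (simp add: S_def W_def)
        moreover have "\<forall>w\<in>S. a \<in> vball w (- int C)" "\<forall>w\<in>S. c \<in> vball w (- int C)"
          using a(1) c(1) by (simp_all add: A'_def)
        then have "\<forall>w\<in>S. a - c \<in> vball w (- int C + int C)" using \<phi>(2) c(2) by simp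
        ultimately show ?thesis by simp
      next
        case False
        then show ?thesis using a(1) c(1) w by (intro w.vball_diff) (simp_all add: A'_def)
      qed
    qed
    moreover have "x - a + c \<in> vball v (- int (C + E))"
    proof (rule vball_add)
      show "x - a \<in> vball v (- int (C + E))" by (rule vball_mono[OF a(2)]) simp
      have "c \<in> vball v (- int E)" using E a(1) by (auto simp: c_def)
      then show "c \<in> vball v (- int (C + E))" by (rule vball_mono) simp
    qed
    ultimately show ?thesis by (intro bexI[of _ "a - c"]) (simp_all add: algebra_simps)
  qed
  then show ?thesis by blast
qed

text \<open>More than \<open>card D ^ Suc n\<close> points would include two whose difference lies
  in \<open>A\<close> and has positive value at \<open>v\<close>, hence vanishes.\<close>

lemma finite_A_vball: "finite (A \<inter> vball v (- int n))"
proof -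
  obtain D where D: "residue_reps v D" using finite_residue_field[OF dv] ..
  have "card X \<le> card D ^ Suc n" if X: "X \<subseteq> A \<inter> vball v (- int n)" "finite X" for X
  proof (rule ccontr)
    assume "\<not> ?thesis"
    then have "card D ^ Suc n < card X" by simp
    moreover have "X \<subseteq> vball v (- int n)" using X by blast
    ultimately obtain x y where xy: "x \<in> X" "y \<in> X" "x \<noteq> y" "x - y \<in> vball v (- int n + int (Suc n))"
      using vball_pigeonhole[OF D X(2)] by metis
    have "x - y \<in> A" using xy X by (intro A.diff_closed) auto
    then show False using A_inter_vball_1[of "x - y"] xy by simp
  qed
  then show ?thesis using finite_if_finite_subsets_card_bdd by blast
qed

text \<open>An element whose pole order exceeds the error \<open>C\<close> has the same value as its
  approximation in \<open>A\<close>, so arbitrarily high pole orders occur.\<close>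

lemma infinite_A: "infinite A"
proof -
  obtain C :: nat where C: "\<forall>x. \<exists>a\<in>A. x - a \<in> vball v (- int C)" using strong_approximation ..
  have "\<exists>a. a \<in> A \<and> v a = - int (C + Suc i)" for i
  proof -
    obtain x where x: "x \<noteq> 0" "v x = - int (C + Suc i)" using val_surj .
    obtain a where a: "a \<in> A" "x - a \<in> vball v (- int C)" using C by blast
    have "x - a \<in> vball v (v x + 1)" using vball_mono[OF a(2)] x by simp
    then have "v a = v x" using val_eq_if_diff(2)[OF x(1), of a] by (simp add: vball_commute)
    then show ?thesis using a x by auto
  qed
  then obtain f where f: "\<And>i. f i \<in> A \<and> v (f i) = - int (C + Suc i)" by metis
  have "inj f"
  proof (rule injI)
    fix i j assume "f i = f j"
    then have "v (f i) = v (f j)" by simp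
    then show "i = j" using f[of i] f[of j] by simp
  qed
  moreover have "range f \<subseteq> A" using f by auto
  ultimately show ?thesis using infinite_iff_countable_subset by blast
qed

text \<open>Infinitely many elements of \<open>A\<close> fall into finitely many classes modulo a
  high power at the poles of \<open>x\<close> other than \<open>v\<close>; the difference of two in
  one class cancels these poles.\<close>

lemma denominator: "\<exists>d\<in>A. d \<noteq> 0 \<and> d * x \<in> A"
proof -
  define S where "S = {w. discrete_valuation w \<and> w x < 0} - {v}"
  have S: "finite S" "\<And>w. w \<in> S \<Longrightarrow> discrete_valuation w \<and> w \<noteq> v"
    unfolding S_def using finite_poles by auto
  have SD: "\<forall>w\<in>S. discrete_valuation w \<and> (\<exists>D. residue_reps w D)"
    using S(2) finite_residue_field by blast
  have "\<exists>k. \<forall>w\<in>S. x \<in> vball w (- int k)"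
  proof (rule finite_family_bound[OF S(1)])
    show "\<exists>C. x \<in> vball w (- int C)" for w using valued_field_bounded[of "{x}" w] by simp
  qed (auto simp: vball_def)
  then obtain k where k: "\<forall>w\<in>S. x \<in> vball w (- int k)" ..
  obtain \<phi> :: "'a \<Rightarrow> ('a \<Rightarrow> int) \<Rightarrow> 'a" where \<phi>: "finite (\<phi> ` {x. \<forall>w\<in>S. x \<in> vball w 0})"
    "\<forall>x y. (\<forall>w\<in>S. x \<in> vball w 0) \<longrightarrow> (\<forall>w\<in>S. y \<in> vball w 0) \<longrightarrow>
      \<phi> x = \<phi> y \<longrightarrow> (\<forall>w\<in>S. x - y \<in> vball w (0 + int k))"
    using finite_label[OF S(1) SD, of 0 k] by (elim exE conjE)
  have AS: "\<forall>w\<in>S. a \<in> vball w 0" if "a \<in> A" for a using A_D[OF that] S(2) by blast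
  then have "\<phi> ` A \<subseteq> \<phi> ` {x. \<forall>w\<in>S. x \<in> vball w 0}" by blast
  then have "finite (\<phi> ` A)" using \<phi>(1) finite_subset by blast
  then have "\<not> inj_on \<phi> A" using infinite_A finite_imageD by blast
  then obtain a b where ab: "a \<in> A" "b \<in> A" "a \<noteq> b" "\<phi> a = \<phi> b" unfolding inj_on_def by blast
  have d: "\<forall>w\<in>S. a - b \<in> vball w (int k)" using \<phi>(2) AS[OF ab(1)] AS[OF ab(2)] ab(4) by simp
  have dA: "a - b \<in> A" by (intro A.diff_closed ab)
  have "(a - b) * x \<in> A"
  proof (rule A_I)
    fix w assume w: "discrete_valuation w" "w \<noteq> v"
    interpret w: valued_field w by unfold_locales (rule w)
    show "(a - b) * x \<in> vball w 0"
    proof (cases "w \<in> S")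
      case True
      then have "(a - b) * x \<in> vball w (int k + - int k)" using d k by (intro w.vball_mult) auto
      then show ?thesis by simp
    next
      case False
      then have "x \<in> vball w 0" using w by (simp add: S_def vball_def)
      then show ?thesis using A_D[OF dA w] by (intro w.vball_mult0)
    qed
  qed
  then show ?thesis using dA ab(3) by (intro bexI[of _ "a - b"]) simp_all
qed

text \<open>A lower bound of Riemann type. Each digit \<open>d\<close> at the next pole order is
  rounded to an element \<open>\<alpha> d\<close> of \<open>A\<close>; the rounding error stays
  within \<open>C\<close>, so different digits remain distinguishable and each order multiplies the
  count by \<open>card D\<close>.\<close>

lemma card_A_vball:
  assumes D: "residue_reps v D"
  shows "\<exists>C::nat. \<forall>n. card D ^ n \<le> card (A \<inter> vball v (- int (n + C)))"
proof -
  obtain C :: nat where C: "\<forall>x. \<exists>a\<in>A. x - a \<in> vball v (- int C)" using strong_approximation ..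
  have Dfin: "finite D" and D0: "\<And>d. d \<in> D \<Longrightarrow> d \<in> vball v 0"
    and Dinj: "\<And>d d'. d \<in> D \<Longrightarrow> d' \<in> D \<Longrightarrow> d - d' \<in> vball v 1 \<Longrightarrow> d = d'"
    using D unfolding residue_reps_def by blast+
  have "card D ^ n \<le> card (A \<inter> vball v (- int (n + C)))" for n
  proof (induction n)
    case 0
    have "{0} \<subseteq> A \<inter> vball v (- int (0 + C))" by simp
    then have "card {0::'a} \<le> card (A \<inter> vball v (- int (0 + C)))"
      using finite_A_vball by (intro card_mono)
    then show ?case by simp
  next
    case (Suc n)
    define X where "X = A \<inter> vball v (- int (n + C))"
    obtain p where p: "p \<noteq> 0" "v p = - int (Suc n + C)" using val_surj .
    have "\<exists>\<alpha>. \<forall>d. \<alpha> d \<in> A \<and> p * d - \<alpha> d \<in> vball v (- int C)"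
      by (rule choice) (use C in blast)
    then obtain \<alpha> where \<alpha>: "\<And>d. \<alpha> d \<in> A" "\<And>d. p * d - \<alpha> d \<in> vball v (- int C)" by blast
    let ?g = "\<lambda>(a, d). a + \<alpha> d"
    have "inj_on ?g (X \<times> D)"
    proof (rule inj_onI, clarify)
      fix a d a' d' assume *: "a \<in> X" "d \<in> D" "a' \<in> X" "d' \<in> D" "a + \<alpha> d = a' + \<alpha> d'"
      have "a' - a \<in> vball v (- int (n + C))" using * by (intro vball_diff) (auto simp: X_def)
      moreover have "\<alpha> d - \<alpha> d' = a' - a" using *(5) by (simp add: algebra_simps)
      moreover have "p * d - \<alpha> d - (p * d' - \<alpha> d') \<in> vball v (- int (n + C))"
        by (intro vball_mono[OF vball_diff[OF \<alpha>(2) \<alpha>(2)]]) simp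
      ultimately have "(p * d - \<alpha> d - (p * d' - \<alpha> d')) + (a' - a) \<in> vball v (- int (n + C))"
        by (intro vball_add)
      moreover have "(p * d - \<alpha> d - (p * d' - \<alpha> d')) + (a' - a) = p * (d - d')"
        using \<open>\<alpha> d - \<alpha> d' = a' - a\<close> by (simp add: algebra_simps)
      ultimately have "p * (d - d') \<in> vball v (- int (n + C))" by simp
      then have "d - d' \<in> vball v 1" using vball_mult_iff[OF p(1), of "d - d'"] p(2) by simp
      then have "d = d'" using Dinj * by simp
      then show "a = a' \<and> d = d'" using *(5) by simp
    qed
    moreover have "?g ` (X \<times> D) \<subseteq> A \<inter> vball v (- int (Suc n + C))"
    proof (clarify, intro IntI)
      fix a d assume *: "a \<in> X" "d \<in> D"
      show "a + \<alpha> d \<in> A" using * \<alpha> by (intro A.add_closed) (auto simp: X_def)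
      have "p * d \<in> vball v (- int (Suc n + C))"
        using D0[OF *(2)] vball_mult_iff[OF p(1), of d] p(2) by simp
      moreover have "p * d - \<alpha> d \<in> vball v (- int (Suc n + C))"
        by (rule vball_mono[OF \<alpha>(2)]) simp
      ultimately have "p * d - (p * d - \<alpha> d) \<in> vball v (- int (Suc n + C))" by (rule vball_diff)
      then have "\<alpha> d \<in> vball v (- int (Suc n + C))" by simp
      moreover have "a \<in> vball v (- int (Suc n + C))"
        using * vball_mono[of a "- int (n + C)"] by (simp add: X_def)
      ultimately show "a + \<alpha> d \<in> vball v (- int (Suc n + C))" by (intro vball_add)
    qed
    ultimately have "card (X \<times> D) \<le> card (A \<inter> vball v (- int (Suc n + C)))"
      using finite_A_vball by (intro card_inj_on_le)
    moreover have "card D ^ n \<le> card X" using Suc by (simp add: X_def)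
    then have "card D ^ Suc n \<le> card (X \<times> D)" by (simp add: card_cartesian_product mult.commute)
    ultimately show ?case by linarith
  qed
  then show ?thesis by blast
qed

end


section \<open>Two by two matrices\<close>

lemma matrix_inv_inverse:
  fixes g :: "'a::field^'n^'n"
  assumes "invertible g"
  shows "g ** matrix_inv g = mat 1" "matrix_inv g ** g = mat 1"
proof -
  have "g ** matrix_inv g = mat 1 \<and> matrix_inv g ** g = mat 1"
    unfolding matrix_inv_def by (rule someI_ex) (use assms in \<open>simp add: invertible_def\<close>)
  then show "g ** matrix_inv g = mat 1" "matrix_inv g ** g = mat 1" by auto
qed

lemma matrix_inv_unique:
  fixes g :: "'a::field^'n^'n"
  assumes "g ** h = mat 1"
  shows "matrix_inv g = h"
proof -
  have "h ** g = mat 1" using assms matrix_left_right_inverse by blast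
  then have inv: "invertible g" using assms unfolding invertible_def by blast
  have "matrix_inv g ** (g ** h) = h" by (simp add: matrix_mul_assoc matrix_inv_inverse[OF inv])
  then show ?thesis by (simp add: assms)
qed

lemma matrix_vector_mult_2:
  fixes g :: "'a::comm_ring_1^2^2"
  shows "(g *v u) $ i = g $ i $ 1 * u $ 1 + g $ i $ 2 * u $ 2"
  by (simp add: matrix_vector_mult_def sum_2)

lemma matrix_matrix_mult_2:
  fixes g h :: "'a::comm_ring_1^2^2"
  shows "(g ** h) $ i $ j = g $ i $ 1 * h $ 1 $ j + g $ i $ 2 * h $ 2 $ j"
  by (simp add: matrix_matrix_mult_def sum_2)

lemma vec2_eq_iff: "(x :: 'a^2) = y \<longleftrightarrow> x $ 1 = y $ 1 \<and> x $ 2 = y $ 2"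
  by (simp add: vec_eq_iff forall_2)

lemma mat2_eq_iff: "(x :: 'a^2^2) = y \<longleftrightarrow> (\<forall>i j. x $ i $ j = y $ i $ j)"
  by (simp add: vec_eq_iff)

lemma group_GL2: "Group.group (GL2 :: ('a::field^2^2) monoid)"
proof (rule Group.groupI)
  fix x y z :: "'a^2^2"
  assume "x \<in> carrier GL2" "y \<in> carrier GL2"
  then show "x \<otimes>\<^bsub>GL2\<^esub> y \<in> carrier GL2" by (simp add: GL2_def invertible_mult)
next
  fix x :: "'a^2^2"
  assume x: "x \<in> carrier GL2"
  then have "invertible (matrix_inv x)"
    using matrix_inv_inverse[of x] by (auto simp: GL2_def invertible_def)
  then show "\<exists>y\<in>carrier GL2. y \<otimes>\<^bsub>GL2\<^esub> x = \<one>\<^bsub>GL2\<^esub>"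
    using x matrix_inv_inverse[of x] by (auto simp: GL2_def)
next
  show "\<one>\<^bsub>GL2\<^esub> \<in> carrier (GL2 :: ('a^2^2) monoid)"
    by (auto simp: GL2_def invertible_def intro!: exI[of _ "mat 1"])
qed (auto simp: GL2_def matrix_mul_assoc)

lemma subgroup_GL2:
  assumes "subgroup H (GL2 :: ('a::field^2^2) monoid)"
  shows "\<And>x. x \<in> H \<Longrightarrow> invertible x" "mat 1 \<in> H" "\<And>x y. x \<in> H \<Longrightarrow> y \<in> H \<Longrightarrow> x ** y \<in> H"
    "\<And>x. x \<in> H \<Longrightarrow> matrix_inv x \<in> H"
proof -
  interpret Group.group "GL2 :: ('a^2^2) monoid" by (rule group_GL2)
  show inv: "invertible x" if "x \<in> H" for x
    using subgroup.mem_carrier[OF assms that] by (simp add: GL2_def)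
  show "mat 1 \<in> H" using subgroup.one_closed[OF assms] by (simp add: GL2_def)
  show "x ** y \<in> H" if "x \<in> H" "y \<in> H" for x y
    using subgroup.m_closed[OF assms that] by (simp add: GL2_def)
  show "matrix_inv x \<in> H" if x: "x \<in> H" for x
  proof -
    have c: "x \<in> carrier GL2" by (rule subgroup.mem_carrier[OF assms x])
    have "x \<otimes>\<^bsub>GL2\<^esub> inv\<^bsub>GL2\<^esub> x = \<one>\<^bsub>GL2\<^esub>" by (rule r_inv[OF c])
    then have "x ** inv\<^bsub>GL2\<^esub> x = mat 1" by (simp add: GL2_def)
    then have "matrix_inv x = inv\<^bsub>GL2\<^esub> x" by (rule matrix_inv_unique)
    then show ?thesis using subgroup.m_inv_closed[OF assms x] by simp
  qed
qed

lemma finite_index_representatives: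
  assumes H: "subgroup H (GL2 :: ('a::field^2^2) monoid)" and fi: "finite_index GL2 H U"
    and one: "mat 1 \<in> U"
  shows "\<exists>r :: 'a::field^2^2 \<Rightarrow> 'a^2^2. finite (r ` H) \<and> (\<forall>g\<in>H. \<exists>h\<in>U. g = h ** r g)"
proof -
  define coset where "coset g = (\<lambda>h. h ** g) ` U" for g :: "'a^2^2"
  have "rcosets\<^bsub>GL2\<lparr>carrier := H\<rparr>\<^esub> U = coset ` H"
    by (auto simp: RCOSETS_def r_coset_def coset_def GL2_def)
  then have fin: "finite (coset ` H)" using fi by (simp add: finite_index_def)
  define q where "q c = (SOME g. g \<in> H \<and> coset g = c)" for c
  have q: "q (coset g) \<in> H \<and> coset (q (coset g)) = coset g" if "g \<in> H" for g
    unfolding q_def by (rule someI[of _ g]) (simp add: that)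
  show ?thesis
  proof (rule exI[of _ "\<lambda>g. q (coset g)"], intro conjI ballI)
    have "(\<lambda>g. q (coset g)) ` H = q ` coset ` H" by (simp add: image_image)
    then show "finite ((\<lambda>g. q (coset g)) ` H)" using fin by simp

    fix g assume "g \<in> H"
    have "g \<in> coset g" unfolding coset_def using one by (intro image_eqI[of _ _ "mat 1"]) simp_all
    then have "g \<in> coset (q (coset g))" using q[OF \<open>g \<in> H\<close>] by simp
    then show "\<exists>h\<in>U. g = h ** q (coset g)" unfolding coset_def by blast
  qed
qed

section \<open>Lattices in the completion\<close>

abbreviation std_lattice :: "('c::field \<Rightarrow> int) \<Rightarrow> ('c^2) set" where
  "std_lattice w \<equiv> {u. \<forall>i. u $ i \<in> valuation_ring w}"

definition lattice_of :: "('c::field \<Rightarrow> int) \<Rightarrow> 'c^2^2 \<Rightarrow> ('c^2) set" where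
  "lattice_of w g = (\<lambda>u. g *v u) ` std_lattice w"

lemma std_lattice_iff: "u \<in> std_lattice w \<longleftrightarrow> u $ 1 \<in> vball w 0 \<and> u $ 2 \<in> vball w 0"
  by (simp add: forall_2 valuation_ring_eq_vball)

lemma val_dist_metric:
  assumes "discrete_valuation w"
  shows "Metric_space UNIV (val_dist w)"
proof
  interpret valued_field w by unfold_locales fact
  fix x y z
  show "0 \<le> val_dist w x y" by (simp add: val_dist_def)
  show "val_dist w x y = val_dist w y x"
    using val_minus[of "x - y"] by (simp add: val_dist_def)
  show "(val_dist w x y = 0) = (x = y)" by (simp add: val_dist_def)
  show "val_dist w x z \<le> val_dist w x y + val_dist w y z"
  proof (cases "x = y \<or> y = z \<or> x = z")
    case False
    then have "min (w (x - y)) (w (y - z)) \<le> w (x - z)" using val_add[of "x - y" "y - z"] by simp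
    then have "w (x - y) \<le> w (x - z) \<or> w (y - z) \<le> w (x - z)" by linarith
    then have "2 powr - real_of_int (w (x - z)) \<le> 2 powr - real_of_int (w (x - y)) \<or>
      2 powr - real_of_int (w (x - z)) \<le> 2 powr - real_of_int (w (y - z))" by auto
    moreover have "0 \<le> 2 powr - real_of_int (w (x - y))" "0 \<le> 2 powr - real_of_int (w (y - z))"
      by simp_all
    ultimately have "2 powr - real_of_int (w (x - z))
        \<le> 2 powr - real_of_int (w (x - y)) + 2 powr - real_of_int (w (y - z))" by linarith
    then show ?thesis using False by (simp add: val_dist_def)
  qed (auto simp: val_dist_def)
qed

locale place_completion = function_field_place F t B v
  for F :: "'a::field set" and t and B and v :: "'a \<Rightarrow> int" +
  fixes w :: "'c::field \<Rightarrow> int" and \<iota> :: "'a \<Rightarrow> 'c"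
  assumes completion: "is_completion v w \<iota>"
begin

lemma w_discrete: "discrete_valuation w"
  using completion by (simp add: is_completion_def)

sublocale w: valued_field w
  by unfold_locales (rule w_discrete)

lemma iota_hom: "\<iota> 1 = 1" "\<iota> (x + y) = \<iota> x + \<iota> y" "\<iota> (x * y) = \<iota> x * \<iota> y"
  using completion by (simp_all add: is_completion_def is_ring_hom_def)

lemma iota_0 [simp]: "\<iota> 0 = 0"
proof -
  have "\<iota> 0 = \<iota> 0 + \<iota> 0" using iota_hom(2)[of 0 0] by (simp only: add_0_left)
  then show ?thesis by (simp only: add_cancel_right_right)
qed

lemma iota_diff: "\<iota> (x - y) = \<iota> x - \<iota> y"
  using iota_hom(2)[of "x - y" y] by simp

lemma iota_eq_0_iff [simp]: "\<iota> x = 0 \<longleftrightarrow> x = 0"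
proof
  assume "\<iota> x = 0"
  show "x = 0"
  proof (rule ccontr)
    assume "x \<noteq> 0"
    then have "\<iota> x * \<iota> (inverse x) = 1" by (simp flip: iota_hom)
    then show False using \<open>\<iota> x = 0\<close> by simp
  qed
qed simp

lemma val_iota: "w (\<iota> x) = v x"
  using completion by (simp add: is_completion_def)

lemma vball_iota: "\<iota> x \<in> vball w n \<longleftrightarrow> x \<in> vball v n"
  by (simp add: vball_def val_iota)

text \<open>The closure condition of \<open>is_completion\<close>, read off in balls.\<close>

lemma density: "\<exists>y. x - \<iota> y \<in> vball w n"
proof -
  interpret M: Metric_space UNIV "val_dist w" by (rule val_dist_metric[OF w_discrete])
  have "x \<in> M.mtopology closure_of range \<iota>" using completion by (simp add: is_completion_def)
  then obtain y where y: "val_dist w x (\<iota> y) < 2 powr (- real_of_int n)"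
    unfolding M.metric_closure_of by (auto simp: M.in_mball dest!: spec[of _ "2 powr (- real_of_int n)"])
  have "x - \<iota> y \<in> vball w n"
  proof (cases "x = \<iota> y")
    case False
    then have "2 powr (- real_of_int (w (x - \<iota> y))) < 2 powr (- real_of_int n)"
      using y by (simp add: val_dist_def)
    then show ?thesis by (simp add: vball_def)
  qed simp
  then show ?thesis ..
qed

text \<open>By density the residue field does not grow under completion.\<close>

lemma residue_reps_iota:
  assumes "residue_reps v D"
  shows "residue_reps w (\<iota> ` D)"
  unfolding residue_reps_def
proof (intro conjI ballI impI)
  show "finite (\<iota> ` D)" "\<iota> ` D \<subseteq> vball w 0"
    using assms by (auto simp: residue_reps_def vball_iota)
  fix x assume x: "x \<in> vball w 0"
  obtain y where y: "x - \<iota> y \<in> vball w 1" using density by blast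
  have "x - \<iota> y \<in> vball w 0" using y w.vball_mono by auto
  from w.vball_diff[OF x this] have "y \<in> vball v 0" by (simp add: vball_iota)
  then obtain d where d: "d \<in> D" "y - d \<in> vball v 1" using assms by (auto simp: residue_reps_def)
  then have "\<iota> y - \<iota> d \<in> vball w 1" by (simp add: vball_iota flip: iota_diff)
  from w.vball_add[OF y this] have "x - \<iota> d \<in> vball w 1" by simp
  then show "\<exists>d\<in>\<iota> ` D. x - d \<in> vball w 1" using d(1) by blast
next
  fix d d' assume "d \<in> \<iota> ` D" "d' \<in> \<iota> ` D" "d - d' \<in> vball w 1"
  then obtain e e' where "d = \<iota> e" "d' = \<iota> e'" "e \<in> D" "e' \<in> D" "e - e' \<in> vball v 1"
    by (auto simp: vball_iota simp flip: iota_diff)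
  then show "d = d'" using assms by (auto simp: residue_reps_def)
qed

lemma card_iota: "card (\<iota> ` D) = card D"
proof (rule card_image, rule inj_onI)
  fix x y assume "\<iota> x = \<iota> y"
  then have "\<iota> (x - y) = 0" by (simp add: iota_diff)
  then show "x = y" by (simp only: iota_eq_0_iff) simp
qed

lemma strong_approximation_completion: "\<exists>C::nat. \<forall>x. \<exists>a\<in>A. x - \<iota> a \<in> vball w (- int C)"
proof -
  obtain C :: nat where C: "\<forall>x. \<exists>a\<in>A. x - a \<in> vball v (- int C)" using strong_approximation ..
  have "\<exists>a\<in>A. x - \<iota> a \<in> vball w (- int C)" for x
  proof -
    obtain y where y: "x - \<iota> y \<in> vball w 0" using density by blast
    obtain a where a: "a \<in> A" "y - a \<in> vball v (- int C)" using C by blast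
    have "x - \<iota> y \<in> vball w (- int C)" by (rule w.vball_mono[OF y]) simp
    moreover have "\<iota> y - \<iota> a \<in> vball w (- int C)" using a by (simp add: vball_iota flip: iota_diff)
    ultimately have "(x - \<iota> y) + (\<iota> y - \<iota> a) \<in> vball w (- int C)" by (rule w.vball_add)
    then show ?thesis using a(1) by (intro bexI[of _ a]) simp_all
  qed
  then show ?thesis by blast
qed

text \<open>The lattice in question is spanned by \<open>(a, 0)\<close> and \<open>(b c, c)\<close>.
  Many \<beta> in \<open>A\<close> have value at least \<open>w c\<close>, and rounding
  \<open>b * \<iota> \<beta>\<close> to \<open>A\<close> leaves remainders in a fixed ball. If the
  volume of the lattice is large, two remainders agree to precision \<open>w a\<close>, and the
  difference of the two points is the vector sought.\<close>

lemma minkowski_triangular: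
  "\<exists>C::nat. \<forall>a b c. w a + w c \<le> - int C \<longrightarrow>
    (\<exists>\<alpha>\<in>A. \<exists>\<beta>\<in>A. (\<alpha> \<noteq> 0 \<or> \<beta> \<noteq> 0) \<and> \<iota> \<beta> \<in> vball w (w c) \<and> \<iota> \<alpha> - b * \<iota> \<beta> \<in> vball w (w a))"
proof -
  obtain C0 :: nat where C0: "\<forall>x. \<exists>a\<in>A. x - \<iota> a \<in> vball w (- int C0)"
    using strong_approximation_completion ..
  obtain D where D: "residue_reps v D" using finite_residue_field[OF dv] ..
  obtain C1 :: nat where C1: "\<forall>n. card D ^ n \<le> card (A \<inter> vball v (- int (n + C1)))"
    using card_A_vball[OF D] ..
  have D2: "card D > 1"
  proof -
    obtain d0 d1 where d: "d0 \<in> D" "0 - d0 \<in> vball v 1" "d1 \<in> D" "1 - d1 \<in> vball v 1"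
      using D unfolding residue_reps_def by (meson vball_0 vball_1)
    have "d0 \<noteq> d1"
    proof
      assume "d0 = d1"
      then have "1 \<in> vball v 1" using vball_diff[OF d(4) d(2)] by simp
      then show False by (simp add: vball_def)
    qed
    then have "card {d0, d1} \<le> card D" using d D by (intro card_mono) (auto simp: residue_reps_def)
    then show ?thesis using \<open>d0 \<noteq> d1\<close> by simp
  qed
  \<comment> \<open>\<open>C0\<close> is the rounding error and \<open>C1\<close> the loss in the
    count of points; the extra 1 makes the pigeonhole inequality \<open>k < n\<close>
    strict.\<close>
  have "\<exists>\<alpha>\<in>A. \<exists>\<beta>\<in>A. (\<alpha> \<noteq> 0 \<or> \<beta> \<noteq> 0) \<and> \<iota> \<beta> \<in> vball w (w c) \<and> \<iota> \<alpha> - b * \<iota> \<beta> \<in> vball w (w a)"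
    if ac: "w a + w c \<le> - int (C0 + C1 + 1)" for a b c
  proof (cases "w a \<le> 0")
    case True
    then have "\<iota> 1 - b * \<iota> 0 \<in> vball w (w a)" by (simp add: iota_hom vball_def)
    then show ?thesis by (intro bexI[of _ 1] bexI[of _ 0]) simp_all
  next
    case False
    define n where "n = nat (- w c - int C1)"
    have n: "w c = - int (n + C1)" using ac False by (simp add: n_def)
    define X where "X = A \<inter> vball v (w c)"
    have finX: "finite X" unfolding X_def n by (rule finite_A_vball)
    have cardX: "card D ^ n \<le> card X" using C1 by (simp add: X_def n)
    have "\<exists>\<alpha>. \<forall>\<beta>. \<alpha> \<beta> \<in> A \<and> b * \<iota> \<beta> - \<iota> (\<alpha> \<beta>) \<in> vball w (- int C0)"
      by (rule choice) (use C0 in blast)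
    then obtain \<alpha> where \<alpha>: "\<And>\<beta>. \<alpha> \<beta> \<in> A" "\<And>\<beta>. b * \<iota> \<beta> - \<iota> (\<alpha> \<beta>) \<in> vball w (- int C0)" by blast
    define r where "r \<beta> = b * \<iota> \<beta> - \<iota> (\<alpha> \<beta>)" for \<beta>
    have "\<exists>\<beta>\<in>X. \<exists>\<beta>'\<in>X. \<beta> \<noteq> \<beta>' \<and> r \<beta> - r \<beta>' \<in> vball w (w a)"
    proof (cases "inj_on r X")
      case False
      then obtain x y where "x \<in> X" "y \<in> X" "x \<noteq> y" "r x = r y" unfolding inj_on_def by blast
      then show ?thesis by (intro bexI[of _ x] bexI[of _ y]) simp_all
    next
      case True
      define k where "k = C0 + nat (w a)"
      have "k < n" using ac n False by (simp add: k_def)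
      then have "card D ^ k < card D ^ n" using D2 by (intro power_strict_increasing)
      then have "card (\<iota> ` D) ^ k < card (r ` X)" using cardX card_image[OF True] card_iota by simp
      moreover have "r ` X \<subseteq> vball w (- int C0)" using \<alpha> by (auto simp: r_def)
      ultimately obtain x y where xy: "x \<in> r ` X" "y \<in> r ` X" "x \<noteq> y" "x - y \<in> vball w (- int C0 + int k)"
        using w.vball_pigeonhole[OF residue_reps_iota[OF D], of "r ` X" "- int C0" k] finX by blast
      then obtain \<beta> \<beta>' where "\<beta> \<in> X" "\<beta>' \<in> X" "x = r \<beta>" "y = r \<beta>'" by blast
      then show ?thesis using xy False by (intro bexI[of _ \<beta>] bexI[of _ \<beta>']) (auto simp: k_def)
    qed
    then obtain \<beta> \<beta>' where \<beta>: "\<beta> \<in> X" "\<beta>' \<in> X" "\<beta> \<noteq> \<beta>'" "r \<beta> - r \<beta>' \<in> vball w (w a)" by blast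
    have "\<iota> (\<alpha> \<beta> - \<alpha> \<beta>') - b * \<iota> (\<beta> - \<beta>') = - (r \<beta> - r \<beta>')"
      by (simp add: r_def iota_diff algebra_simps)
    then have "\<iota> (\<alpha> \<beta> - \<alpha> \<beta>') - b * \<iota> (\<beta> - \<beta>') \<in> vball w (w a)" using w.vball_minus[OF \<beta>(4)] by simp
    moreover have "\<iota> (\<beta> - \<beta>') \<in> vball w (w c)"
      using \<beta> by (auto simp: vball_iota X_def intro: vball_diff)
    moreover have "\<alpha> \<beta> - \<alpha> \<beta>' \<in> A" "\<beta> - \<beta>' \<in> A"
      using \<alpha> \<beta> by (auto simp: X_def intro: A.diff_closed)
    ultimately show ?thesis using \<beta>(3)
      by (intro bexI[of _ "\<alpha> \<beta> - \<alpha> \<beta>'"] bexI[of _ "\<beta> - \<beta>'"]) simp_all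
  qed
  then show ?thesis by blast
qed

text \<open>Integral column operations do not change the lattice, so the second row can be cleared
  by its entry of smaller value; this leaves the triangular case.\<close>

lemma minkowski_lattice:
  "\<exists>C::nat. \<forall>g. invertible g \<longrightarrow> w (det g) \<le> - int C \<longrightarrow>
    (\<exists>x. x \<noteq> 0 \<and> (\<forall>i. x $ i \<in> A) \<and> (\<chi> i. \<iota> (x $ i)) \<in> lattice_of w g)"
proof -
  obtain C :: nat where C: "\<forall>a b c. w a + w c \<le> - int C \<longrightarrow>
    (\<exists>\<alpha>\<in>A. \<exists>\<beta>\<in>A. (\<alpha> \<noteq> 0 \<or> \<beta> \<noteq> 0) \<and> \<iota> \<beta> \<in> vball w (w c) \<and> \<iota> \<alpha> - b * \<iota> \<beta> \<in> vball w (w a))"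
    using minkowski_triangular ..
  have div: "x / a \<in> vball w 0" if "a \<noteq> 0" "x \<in> vball w (w a)" for x a
    using w.vball_mult_iff[of a "x / a" "w a"] that by simp
  \<comment> \<open>Column \<open>j\<close> carries the pivot of the second row, and \<epsilon> is
    the sign of the column order, so both choices of pivot are covered.\<close>
  have *: "\<exists>x. x \<noteq> 0 \<and> (\<forall>i. x $ i \<in> A) \<and> (\<chi> i. \<iota> (x $ i)) \<in> lattice_of w g"
    if g: "w (det g) \<le> - int C" and det: "det g = \<epsilon> * (g $ 1 $ i * g $ 2 $ j - g $ 1 $ j * g $ 2 $ i)"
      and eps: "\<epsilon> = 1 \<or> \<epsilon> = -1" and ij: "{i, j} = {1, 2}" "i \<noteq> j"
      and nz: "det g \<noteq> 0" "g $ 2 $ j \<noteq> 0" and le: "g $ 2 $ i / g $ 2 $ j \<in> vball w 0"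
    for g :: "'c^2^2" and \<epsilon> i j
  proof -
    define c where "c = g $ 2 $ j"
    define a where "a = \<epsilon> * det g / c"
    define b where "b = g $ 1 $ j / c"
    have c: "c \<noteq> 0" using nz by (simp add: c_def)
    have a: "a \<noteq> 0" using nz c eps by (auto simp: a_def)
    have "a * c = \<epsilon> * det g" using c by (simp add: a_def)
    then have "w (a * c) = w (det g)" using eps by auto
    then have "w a + w c \<le> - int C" using g a c by (simp add: w.val_mult)
    then obtain \<alpha> \<beta> where \<alpha>: "\<alpha> \<in> A" "\<beta> \<in> A" "\<alpha> \<noteq> 0 \<or> \<beta> \<noteq> 0"
      "\<iota> \<beta> \<in> vball w (w c)" "\<iota> \<alpha> - b * \<iota> \<beta> \<in> vball w (w a)" using C by blast
    define p where "p = (\<iota> \<alpha> - b * \<iota> \<beta>) / a"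
    define q where "q = \<iota> \<beta> / c - g $ 2 $ i / c * p"
    have p: "p \<in> vball w 0" unfolding p_def by (rule div[OF a \<alpha>(5)])
    have q: "q \<in> vball w 0" unfolding q_def
      by (intro w.vball_diff w.vball_mult0 div[OF c \<alpha>(4)] p) (use le in \<open>simp add: c_def\<close>)
    define u :: "'c^2" where "u = (\<chi> l. if l = i then p else q)"
    have ui: "u $ i = p" "u $ j = q" using ij(2) by (auto simp: u_def)
    have sum: "(g *v u) $ l = g $ l $ i * p + g $ l $ j * q" for l
    proof -
      have "i = 1 \<and> j = 2 \<or> i = 2 \<and> j = 1" using ij by (metis doubleton_eq_iff)
      then show ?thesis using ui by (auto simp: matrix_vector_mult_2)
    qed
    have ac: "g $ 1 $ i * c - g $ 1 $ j * g $ 2 $ i = a * c"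
    proof -
      have "a * c = \<epsilon> * \<epsilon> * (g $ 1 $ i * g $ 2 $ j - g $ 1 $ j * g $ 2 $ i)"
        using \<open>a * c = \<epsilon> * det g\<close> unfolding det by (simp only: mult.assoc)
      also have "\<epsilon> * \<epsilon> = 1" using eps by auto
      finally show ?thesis by (simp add: c_def)
    qed
    have 2: "(g *v u) $ 2 = \<iota> \<beta>"
      unfolding sum q_def using c by (simp add: c_def[symmetric] right_diff_distrib)
    have "c * (g *v u) $ 1 = (g $ 1 $ i * c - g $ 1 $ j * g $ 2 $ i) * p + g $ 1 $ j * \<iota> \<beta>"
      unfolding sum q_def using c by (simp add: algebra_simps)
    also have "\<dots> = c * (a * p + b * \<iota> \<beta>)"
      unfolding ac using c by (simp add: b_def algebra_simps)
    also have "a * p = \<iota> \<alpha> - b * \<iota> \<beta>" using a by (simp add: p_def)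
    finally have 1: "(g *v u) $ 1 = \<iota> \<alpha>" using c by simp
    define x :: "'a^2" where "x = vector [\<alpha>, \<beta>]"
    have "(\<chi> i. \<iota> (x $ i)) = g *v u" by (simp add: vec2_eq_iff 1 2 x_def)
    moreover have "u \<in> std_lattice w" using p q by (auto simp: u_def valuation_ring_eq_vball)
    ultimately have "(\<chi> i. \<iota> (x $ i)) \<in> lattice_of w g" unfolding lattice_of_def by blast
    moreover have "x \<noteq> 0" "\<forall>i. x $ i \<in> A" using \<alpha> by (auto simp: x_def vec2_eq_iff forall_2)
    ultimately show ?thesis by blast
  qed
  have "\<exists>x. x \<noteq> 0 \<and> (\<forall>i. x $ i \<in> A) \<and> (\<chi> i. \<iota> (x $ i)) \<in> lattice_of w g"
    if g: "invertible g" "w (det g) \<le> - int C" for g :: "'c^2^2"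
  proof -
    have nz: "det g \<noteq> 0" using g(1) by (simp add: invertible_det_nz)
    show ?thesis
    proof (cases "g $ 2 $ 2 \<noteq> 0 \<and> g $ 2 $ 1 / g $ 2 $ 2 \<in> vball w 0")
      case True
      show ?thesis
        by (rule *[OF g(2), of 1 1 2]) (use True nz in \<open>auto simp: det_2\<close>)
    next
      case False
      have "g $ 2 $ 1 \<noteq> 0"
      proof
        assume "g $ 2 $ 1 = 0"
        then show False using False nz by (auto simp: det_2)
      qed
      moreover have "g $ 2 $ 2 / g $ 2 $ 1 \<in> vball w 0"
        using False calculation by (cases "g $ 2 $ 2 = 0") (auto simp: vball_def w.val_divide)
      ultimately show ?thesis
        by (intro *[OF g(2), of "-1" 2 1]) (use nz in \<open>auto simp: det_2\<close>)
    qed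
  qed
  then show ?thesis by blast
qed

text \<open>The entries of \<open>g\<close> are bounded, so all coordinates lie in one ball, which
  contains finitely many elements of \<open>A\<close>.\<close>

lemma finite_integral_points:
  "finite {x. (\<forall>i. x $ i \<in> A) \<and> (\<chi> i. \<iota> (x $ i)) \<in> lattice_of w g}" (is "finite ?S")
proof -
  have "finite ((\<lambda>(i, j). g $ i $ j) ` UNIV)" by simp
  then obtain M where M: "\<forall>x\<in>(\<lambda>(i, j). g $ i $ j) ` UNIV. x \<in> vball w (- int M)"
    using valued_field_bounded by blast
  have gM: "g $ i $ j \<in> vball w (- int M)" for i j using M by force
  let ?X = "A \<inter> vball v (- int M)"
  have "?S \<subseteq> (\<lambda>(a, b). vector [a, b]) ` (?X \<times> ?X)"
  proof
    fix x assume "x \<in> ?S"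
    then obtain u where u: "u \<in> std_lattice w" "(\<chi> i. \<iota> (x $ i)) = g *v u" and xA: "\<forall>i. x $ i \<in> A"
      unfolding lattice_of_def by blast
    have "x $ i \<in> ?X" for i
    proof -
      have "\<iota> (x $ i) = (g *v u) $ i" by (simp flip: u(2))
      also have "\<dots> = u $ 1 * g $ i $ 1 + u $ 2 * g $ i $ 2"
        by (simp add: matrix_vector_mult_2 mult.commute)
      also have "\<dots> \<in> vball w (- int M)"
        using u(1) gM unfolding std_lattice_iff by (intro w.vball_add w.vball_mult0) auto
      finally show ?thesis using xA by (simp add: vball_iota)
    qed
    then show "x \<in> (\<lambda>(a, b). vector [a, b]) ` (?X \<times> ?X)"
      by (intro image_eqI[of _ _ "(x $ 1, x $ 2)"]) (auto simp: vec2_eq_iff)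
  qed
  then show ?thesis using finite_A_vball finite_subset by blast
qed

lemma common_denominator:
  assumes "finite X"
  shows "\<exists>d\<in>A. d \<noteq> 0 \<and> (\<forall>x\<in>X. d * x \<in> A)"
  using assms
proof (induction X rule: finite_induct)
  case empty
  show ?case by (rule bexI[of _ 1]) auto
next
  case (insert x X)
  then obtain d where d: "d \<in> A" "d \<noteq> 0" "\<forall>x\<in>X. d * x \<in> A" by blast
  obtain e where e: "e \<in> A" "e \<noteq> 0" "e * x \<in> A" using denominator by blast
  have "d * e * y \<in> A" if "y \<in> insert x X" for y
  proof (cases "y = x")
    case True
    then show ?thesis using d e A.mult_closed[of d "e * x"] by (simp add: mult.assoc)
  next
    case False
    then have "d * y \<in> A" using that d by blast
    then have "e * (d * y) \<in> A" by (rule A.mult_closed[OF e(1)])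
    then show ?thesis by (simp add: ac_simps)
  qed
  then show ?case using d e by (intro bexI[of _ "d * e"]) (auto intro: A.mult_closed)
qed

text \<open>A nonzero element of \<open>A\<close> never has positive value at \<open>v\<close>, and
  this applies to \<open>x\<close> and to its inverse.\<close>

lemma val_unit_A:
  assumes "x \<in> A" "y \<in> A" "x * y = 1"
  shows "v x = 0"
proof -
  have nz: "x \<noteq> 0" "y \<noteq> 0" using assms(3) by auto
  have "v x + v y = 0" using val_mult[OF nz] assms(3) by simp
  moreover have "\<not> v x \<ge> 1" using A_inter_vball_1[OF assms(1)] nz by (auto simp: vball_def)
  moreover have "\<not> v y \<ge> 1" using A_inter_vball_1[OF assms(2)] nz by (auto simp: vball_def)
  ultimately show ?thesis by linarith
qed

lemma val_det_GL2_over: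
  assumes "g \<in> GL2_over A"
  shows "v (det g) = 0"
proof (rule val_unit_A)
  have g: "invertible g" "\<And>i j. g $ i $ j \<in> A" "\<And>i j. matrix_inv g $ i $ j \<in> A"
    using assms by (auto simp: GL2_over_def)
  show "det g \<in> A" "det (matrix_inv g) \<in> A"
    using g unfolding det_2 by (auto intro!: A.diff_closed A.mult_closed)
  show "det g * det (matrix_inv g) = 1" using matrix_inv_inverse(1)[OF g(1)] by (metis det_I det_mul)
qed

end

section \<open>The arithmetic group and its stable points\<close>

locale arithmetic_place = place_completion F t B v w \<iota>
  for F :: "'a::field set" and t and B and v :: "'a \<Rightarrow> int"
    and w :: "'c::field \<Rightarrow> int" and \<iota> :: "'a \<Rightarrow> 'c" +
  fixes \<Gamma> :: "('a^2^2) set"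
  assumes arithmetic: "arithmetic_subgroup v \<Gamma>"
begin

lemma Gamma_subgroup: "subgroup \<Gamma> GL2"
  using arithmetic by (simp add: arithmetic_subgroup_def)

lemmas Gamma_closed = subgroup_GL2[OF Gamma_subgroup]

lemma Gamma_representatives:
  "\<exists>r. finite (r ` \<Gamma>) \<and> (\<forall>g\<in>\<Gamma>. \<exists>h\<in>\<Gamma> \<inter> GL2_over A. g = h ** r g)"
proof (rule finite_index_representatives[OF Gamma_subgroup])
  show "finite_index GL2 \<Gamma> (\<Gamma> \<inter> GL2_over A)"
    using arithmetic by (simp add: arithmetic_subgroup_def)
  have "matrix_inv (mat 1 :: 'a^2^2) = mat 1" by (rule matrix_inv_unique) simp
  then have "mat 1 \<in> GL2_over A"
    using Gamma_closed(1)[OF Gamma_closed(2)] by (simp add: GL2_over_def mat_def)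
  then show "mat 1 \<in> \<Gamma> \<inter> GL2_over A" using Gamma_closed(2) by simp
qed

text \<open>Every power of \<open>g\<close> is an element of \<open>GL2_over A\<close>, with
  determinant of value 0, times one of finitely many matrices. Two different powers sharing this
  matrix have determinants of equal value, so the value for \<open>g\<close> is 0.\<close>

lemma val_det_Gamma:
  assumes "g \<in> \<Gamma>"
  shows "v (det g) = 0"
proof -
  obtain r where r0: "finite (r ` \<Gamma>)" "\<forall>g\<in>\<Gamma>. \<exists>h\<in>\<Gamma> \<inter> GL2_over A. g = h ** r g"
    using Gamma_representatives by (elim exE conjE)
  have r: "finite (r ` \<Gamma>)" "\<And>g. g \<in> \<Gamma> \<Longrightarrow> \<exists>h\<in>\<Gamma> \<inter> GL2_over A. g = h ** r g"
    using r0 by simp_all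
  define P where "P n = (((**) g) ^^ n) (mat 1)" for n
  have P: "P n \<in> \<Gamma> \<and> det (P n) = det g ^ n" for n
    by (induction n) (simp_all add: P_def Gamma_closed assms det_mul)
  have "range (\<lambda>n. r (P n)) \<subseteq> r ` \<Gamma>" using P by blast
  then have "\<not> inj (\<lambda>n. r (P n))" using r(1) finite_subset finite_imageD by blast
  then obtain n m where nm: "r (P n) = r (P m)" "n \<noteq> m" unfolding inj_def by blast
  obtain h h' where h: "h \<in> GL2_over A" "P n = h ** r (P n)" "h' \<in> GL2_over A" "P m = h' ** r (P m)"
    using r(2) P by (metis IntD2)
  have nz: "det g \<noteq> 0" using Gamma_closed(1)[OF assms] by (simp add: invertible_det_nz)
  have val: "v (det g ^ k) = v (det (r (P k)))" if k: "P k = h ** r (P k)" "h \<in> GL2_over A" for k h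
  proof -
    have "det (P k) = det h * det (r (P k))" using k(1) det_mul by metis
    then have e: "det g ^ k = det h * det (r (P k))" using P by simp
    then have "det h \<noteq> 0" "det (r (P k)) \<noteq> 0" using nz by auto
    then show ?thesis using e val_det_GL2_over[OF k(2)] by (simp add: val_mult)
  qed
  have "v (det g ^ n) = v (det g ^ m)" using val[OF h(2,1)] val[OF h(4,3)] nm(1) by simp
  then show ?thesis using nz nm(2) by (simp add: val_power)
qed

text \<open>The largest \<open>\<Gamma>\<close>-stable subgroup of \<open>A\<^sup>2\<close>; as \<open>\<Gamma> \<inter> GL\<^sub>2(A)\<close> has finite index in \<open>\<Gamma>\<close>,
  it still contains a multiple \<open>d A\<^sup>2\<close>.\<close>

definition stable_points :: "('a^2) set" where
  "stable_points = {x. \<forall>g\<in>\<Gamma>. \<forall>i. (g *v x) $ i \<in> A}"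

lemma stable_points_A: "x \<in> stable_points \<Longrightarrow> x $ i \<in> A"
  using Gamma_closed(2) by (force simp: stable_points_def)

lemma stable_points_diff: "x \<in> stable_points \<Longrightarrow> y \<in> stable_points \<Longrightarrow> x - y \<in> stable_points"
  by (auto simp: stable_points_def matrix_vector_mult_diff_distrib intro: A.diff_closed)

lemma stable_points_0: "0 \<in> stable_points"
  by (simp add: stable_points_def)

lemma stable_points_Gamma: "g \<in> \<Gamma> \<Longrightarrow> x \<in> stable_points \<Longrightarrow> g *v x \<in> stable_points"
  by (auto simp: stable_points_def matrix_vector_mul_assoc Gamma_closed)

text \<open>\<open>d\<close> is a common denominator for the entries of the finitely many coset
  representatives; the other factor of \<open>g\<close> lies in \<open>GL2_over A\<close> and
  preserves integrality.\<close>

lemma stable_points_multiple: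
  "\<exists>d. d \<noteq> 0 \<and> (\<forall>x :: 'a^2. (\<forall>i. x $ i \<in> A) \<longrightarrow> d *s x \<in> stable_points)"
proof -
  obtain r where r0: "finite (r ` \<Gamma>)" "\<forall>g\<in>\<Gamma>. \<exists>h\<in>\<Gamma> \<inter> GL2_over A. g = h ** r g"
    using Gamma_representatives by (elim exE conjE)
  have r: "finite (r ` \<Gamma>)" "\<And>g. g \<in> \<Gamma> \<Longrightarrow> \<exists>h\<in>\<Gamma> \<inter> GL2_over A. g = h ** r g"
    using r0 by simp_all
  have "finite ((\<lambda>(g, i, j). g $ i $ j) ` (r ` \<Gamma> \<times> UNIV))" using r(1) by simp
  then obtain d where d: "d \<in> A" "d \<noteq> 0" "\<forall>x\<in>(\<lambda>(g, i, j). g $ i $ j) ` (r ` \<Gamma> \<times> UNIV). d * x \<in> A"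
    using common_denominator by blast
  have "d *s x \<in> stable_points" if x: "\<forall>i. x $ i \<in> A" for x :: "'a^2"
    unfolding stable_points_def
  proof (intro CollectI ballI allI)
    fix g i assume g: "g \<in> \<Gamma>"
    obtain h where h: "h \<in> GL2_over A" "g = h ** r g" using r(2)[OF g] by blast
    have rA: "d * r g $ k $ l \<in> A" for k l using d(3) g by force
    have y: "(r g *v (d *s x)) $ k \<in> A" for k
    proof -
      have "(r g *v (d *s x)) $ k = d * r g $ k $ 1 * x $ 1 + d * r g $ k $ 2 * x $ 2"
        by (simp add: matrix_vector_mult_2 algebra_simps)
      also have "\<dots> \<in> A" using rA x by (intro A.add_closed A.mult_closed[OF rA]) auto
      finally show ?thesis .
    qed
    have "g *v (d *s x) = h *v (r g *v (d *s x))" using h(2) by (metis matrix_vector_mul_assoc)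
    then have "(g *v (d *s x)) $ i = h $ i $ 1 * (r g *v (d *s x)) $ 1 + h $ i $ 2 * (r g *v (d *s x)) $ 2"
      by (simp add: matrix_vector_mult_2)
    also have "\<dots> \<in> A" using y h(1) by (intro A.add_closed A.mult_closed) (auto simp: GL2_over_def)
    finally show "(g *v (d *s x)) $ i \<in> A" .
  qed
  then show ?thesis using d(2) by blast
qed

definition N :: "('c^2) set" where
  "N = (\<lambda>x. \<chi> i. \<iota> (x $ i)) ` stable_points"

lemma N_diff: "x \<in> N \<Longrightarrow> y \<in> N \<Longrightarrow> x - y \<in> N"
proof -
  assume "x \<in> N" "y \<in> N"
  then obtain a b where ab: "a \<in> stable_points" "b \<in> stable_points"
    "x = (\<chi> i. \<iota> (a $ i))" "y = (\<chi> i. \<iota> (b $ i))" unfolding N_def by blast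
  have "x - y = (\<chi> i. \<iota> ((a - b) $ i))" by (simp add: ab vec_eq_iff iota_diff)
  then show ?thesis unfolding N_def using stable_points_diff[OF ab(1,2)] by blast
qed

lemma N_0: "0 \<in> N"
  unfolding N_def by (rule image_eqI[OF _ stable_points_0]) (simp add: vec_eq_iff)

lemma iota_matrix_vector:
  fixes g :: "'a^2^2"
  shows "map_matrix \<iota> g *v (\<chi> i. \<iota> (x $ i)) = (\<chi> i. \<iota> ((g *v x) $ i))"
  by (simp add: vec_eq_iff matrix_vector_mult_2 iota_hom)

lemma N_Gamma: "g \<in> map_matrix \<iota> ` \<Gamma> \<Longrightarrow> x \<in> N \<Longrightarrow> g *v x \<in> N"
  unfolding N_def using stable_points_Gamma by (auto simp: iota_matrix_vector)

text \<open>This is where the characteristic of the global field enters: finite subgroups of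
  \<open>N\<close> have exponent \<open>p\<close>.\<close>

lemma N_char:
  assumes "CHAR('a) = p" "x \<in> N"
  shows "of_nat p *s x = 0"
proof -
  obtain a where a: "x = (\<chi> i. \<iota> (a $ i))" using assms(2) unfolding N_def by blast
  have of_nat: "\<iota> (of_nat n) = of_nat n" for n by (induction n) (simp_all add: iota_hom)
  have "(of_nat p :: 'c) = \<iota> (of_nat p)" by (simp add: of_nat)
  also have "\<dots> = 0" using assms(1) of_nat_CHAR[where 'a = 'a] by simp
  finally show ?thesis by (simp add: vec_eq_iff)
qed

lemma N_finite: "finite (N \<inter> lattice_of w g)"
proof -
  have "N \<inter> lattice_of w g \<subseteq> (\<lambda>x. \<chi> i. \<iota> (x $ i)) `
    {x. (\<forall>i. x $ i \<in> A) \<and> (\<chi> i. \<iota> (x $ i)) \<in> lattice_of w g}"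
    unfolding N_def using stable_points_A by blast
  then show ?thesis using finite_integral_points finite_surj by blast
qed

lemma N_minkowski:
  "\<exists>C::nat. \<forall>g. invertible g \<longrightarrow> w (det g) \<le> - int C \<longrightarrow> (\<exists>x\<in>N. x \<noteq> 0 \<and> x \<in> lattice_of w g)"
proof -
  obtain C :: nat where C: "\<forall>g. invertible g \<longrightarrow> w (det g) \<le> - int C \<longrightarrow>
    (\<exists>x. x \<noteq> 0 \<and> (\<forall>i. x $ i \<in> A) \<and> (\<chi> i. \<iota> (x $ i)) \<in> lattice_of w g)"
    using minkowski_lattice ..
  obtain d where d: "d \<noteq> 0" "\<forall>x :: 'a^2. (\<forall>i. x $ i \<in> A) \<longrightarrow> d *s x \<in> stable_points"
    using stable_points_multiple by blast
  \<comment> \<open>A vector over \<open>A\<close> is found in the lattice divided by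
    \<open>d\<close> and then multiplied by \<open>d\<close>. The determinant changes by the square
    of \<open>d\<close>, whence the term \<open>2 * \<bar>v d\<bar>\<close>.\<close>
  have "\<exists>x\<in>N. x \<noteq> 0 \<and> x \<in> lattice_of w g"
    if g: "invertible g" "w (det g) \<le> - int (C + nat (2 * \<bar>v d\<bar>))" for g
  proof -
    define g' :: "'c^2^2" where "g' = (\<chi> i j. g $ i $ j / \<iota> d)"
    have dn: "\<iota> d \<noteq> 0" using d by simp
    have det: "det g = \<iota> d * (\<iota> d * det g')" using dn by (simp add: det_2 g'_def field_simps)
    have nz: "det g \<noteq> 0" using g(1) by (simp add: invertible_det_nz)
    then have nz': "det g' \<noteq> 0" using det by auto
    then have "w (det g) = 2 * v d + w (det g')" using dn by (simp add: det w.val_mult val_iota)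
    then have "w (det g') \<le> - int C" using g(2) by simp
    moreover have "invertible g'" using nz' by (simp add: invertible_det_nz)
    ultimately obtain x :: "'a^2" where x: "x \<noteq> 0" "\<forall>i. x $ i \<in> A" "(\<chi> i. \<iota> (x $ i)) \<in> lattice_of w g'"
      using C by blast
    obtain u where u: "u \<in> std_lattice w" "(\<chi> i. \<iota> (x $ i)) = g' *v u"
      using x(3) unfolding lattice_of_def by blast
    define y :: "'c^2" where "y = (\<chi> i. \<iota> ((d *s x) $ i))"
    have "y $ i = (g *v u) $ i" for i
    proof -
      have "y $ i = \<iota> d * (\<chi> i. \<iota> (x $ i)) $ i" by (simp add: y_def iota_hom)
      also have "\<dots> = (g *v u) $ i" unfolding u(2) using dn
        by (simp add: matrix_vector_mult_2 g'_def field_simps)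
      finally show ?thesis .
    qed
    then have "y = g *v u" by (simp add: vec_eq_iff)
    then have "y \<in> lattice_of w g" unfolding lattice_of_def using u(1) by blast
    moreover have "y \<in> N" unfolding N_def y_def using d(2) x(2) by blast
    moreover have "y \<noteq> 0"
    proof
      assume "y = 0"
      then have "\<iota> (d * x $ i) = 0" for i by (auto simp: y_def vec_eq_iff)
      then have "x $ i = 0" for i using d(1) by simp
      then show False using x(1) by (simp add: vec_eq_iff)
    qed
    ultimately show ?thesis by blast
  qed
  then show ?thesis by blast
qed

lemma iota_Gamma:
  assumes "g \<in> map_matrix \<iota> ` \<Gamma>"
  shows "invertible g" "w (det g) = 0" "matrix_inv g \<in> map_matrix \<iota> ` \<Gamma>"
proof -
  obtain h where h: "h \<in> \<Gamma>" "g = map_matrix \<iota> h" using assms by blast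
  have det: "det (map_matrix \<iota> k) = \<iota> (det k)" for k :: "'a^2^2"
    by (simp add: det_2 iota_hom iota_diff)
  show "w (det g) = 0" using val_det_Gamma[OF h(1)] by (simp add: h(2) det val_iota)
  have inv: "invertible h" by (rule Gamma_closed(1)[OF h(1)])
  then show "invertible g" by (simp add: h(2) det invertible_det_nz)
  have "map_matrix \<iota> k ** map_matrix \<iota> l = map_matrix \<iota> (k ** l)" for k l :: "'a^2^2"
    by (simp add: vec_eq_iff matrix_matrix_mult_2 iota_hom)
  then have "g ** map_matrix \<iota> (matrix_inv h) = map_matrix \<iota> (mat 1)"
    by (simp add: h(2) matrix_inv_inverse[OF inv])
  also have "\<dots> = mat 1" by (simp add: vec_eq_iff mat_def iota_hom)
  finally have "matrix_inv g = map_matrix \<iota> (matrix_inv h)" by (rule matrix_inv_unique)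
  then show "matrix_inv g \<in> map_matrix \<iota> ` \<Gamma>" using Gamma_closed(4)[OF h(1)] by blast
qed

end


section \<open>Lattices and vertices\<close>

definition integral_matrix :: "('c::field \<Rightarrow> int) \<Rightarrow> 'c^2^2 \<Rightarrow> bool" where
  "integral_matrix w m \<longleftrightarrow> (\<forall>i j. m $ i $ j \<in> vball w 0)"

definition matrix_scale :: "'c::field \<Rightarrow> 'c^2^2 \<Rightarrow> 'c^2^2" where
  "matrix_scale c g = (\<chi> i j. c * g $ i $ j)"

lemma matrix_scale_vector: "matrix_scale c g *v u = c *s (g *v u)"
  by (simp add: vec2_eq_iff matrix_vector_mult_2 matrix_scale_def algebra_simps)

lemma det_matrix_scale: "det (matrix_scale c g) = c * (c * det g)"
  by (simp add: det_2 matrix_scale_def algebra_simps)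

lemma scale_lattice_mult: "scale_lattice a (scale_lattice b L) = scale_lattice (a * b) L"
  by (simp add: scale_lattice_def image_image vector_smult_assoc)

lemma scale_lattice_1 [simp]: "scale_lattice 1 L = L"
  by (simp add: scale_lattice_def)

lemma homothety_class_scale:
  assumes "c \<noteq> 0"
  shows "homothety_class (scale_lattice c L) = homothety_class L"
proof -
  have "scale_lattice a L \<in> homothety_class (scale_lattice c L)" if "a \<noteq> 0" for a
    unfolding homothety_class_def using that assms
    by (intro CollectI exI[of _ "a / c"]) (simp add: scale_lattice_mult)
  moreover have "scale_lattice a (scale_lattice c L) \<in> homothety_class L" if "a \<noteq> 0" for a
    unfolding homothety_class_def using that assms
    by (intro CollectI exI[of _ "a * c"]) (simp add: scale_lattice_mult)
  ultimately show ?thesis unfolding homothety_class_def by auto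
qed

lemma homothety_class_self: "L \<in> homothety_class L"
  unfolding homothety_class_def by (intro CollectI exI[of _ 1]) simp

lemma homothety_class_eq: "L' \<in> homothety_class L \<Longrightarrow> homothety_class L' = homothety_class L"
proof -
  assume "L' \<in> homothety_class L"
  then obtain c where "c \<noteq> 0" "L' = scale_lattice c L" unfolding homothety_class_def by blast
  then show ?thesis using homothety_class_scale by simp
qed

lemma matrix_image_scale: "(\<lambda>u. g *v u) ` scale_lattice c L = scale_lattice c ((\<lambda>u. g *v u) ` L)"
  by (simp add: scale_lattice_def image_image matrix_vector_mult_scaleR vector_scalar_commute)

lemma vertex_action_class: "vertex_action g (homothety_class L) = homothety_class ((\<lambda>u. g *v u) ` L)"
  unfolding vertex_action_def homothety_class_def
  by (auto simp: image_iff matrix_image_scale[symmetric])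

context valued_field
begin

abbreviation lat where "lat \<equiv> lattice_of v"

lemma is_lattice_iff: "is_lattice v L \<longleftrightarrow> (\<exists>g. invertible g \<and> L = lat g)"
  by (simp add: is_lattice_def lattice_of_def)

lemma std_lattice_add: "x \<in> std_lattice v \<Longrightarrow> y \<in> std_lattice v \<Longrightarrow> x + y \<in> std_lattice v"
  unfolding std_lattice_iff by (simp add: vball_add)

lemma std_lattice_smult: "a \<in> vball v 0 \<Longrightarrow> x \<in> std_lattice v \<Longrightarrow> a *s x \<in> std_lattice v"
  unfolding std_lattice_iff by (simp add: vball_mult0)

lemma lat_0: "0 \<in> lat g"
  unfolding lattice_of_def by (rule image_eqI[of _ _ 0]) (simp_all add: valuation_ring_eq_vball)

lemma lat_add: "x \<in> lat g \<Longrightarrow> y \<in> lat g \<Longrightarrow> x + y \<in> lat g"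
proof -
  assume "x \<in> lat g" "y \<in> lat g"
  then obtain a b where "a \<in> std_lattice v" "b \<in> std_lattice v" "x = g *v a" "y = g *v b"
    unfolding lattice_of_def by blast
  then show ?thesis unfolding lattice_of_def
    using std_lattice_add[of a b] by (intro image_eqI[of _ _ "a + b"]) (simp_all only: matrix_vector_right_distrib)
qed

lemma lat_smult: "a \<in> vball v 0 \<Longrightarrow> x \<in> lat g \<Longrightarrow> a *s x \<in> lat g"
proof -
  assume a: "a \<in> vball v 0" and "x \<in> lat g"
  then obtain b where "b \<in> std_lattice v" "x = g *v b" unfolding lattice_of_def by blast
  then show ?thesis unfolding lattice_of_def
    using std_lattice_smult[OF a, of b] by (intro image_eqI[of _ _ "a *s b"]) (simp_all only: vector_scalar_commute)
qed

lemma lat_uminus: "x \<in> lat g \<Longrightarrow> - x \<in> lat g"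
  using lat_smult[of "-1" x g] by (simp add: vector_sneg_minus1[symmetric])

lemma lat_diff: "x \<in> lat g \<Longrightarrow> y \<in> lat g \<Longrightarrow> x - y \<in> lat g"
  using lat_add[of x g "- y"] lat_uminus[of y g] by simp

lemma scale_lat: "scale_lattice c (lat g) = lat (matrix_scale c g)"
  by (simp add: scale_lattice_def lattice_of_def image_image matrix_scale_vector)

lemma invertible_scale: "c \<noteq> 0 \<Longrightarrow> invertible g \<Longrightarrow> invertible (matrix_scale c g)"
  by (simp add: invertible_det_nz det_matrix_scale)

lemma image_lat: "(\<lambda>u. g *v u) ` lat h = lat (g ** h)"
  by (simp add: lattice_of_def image_image matrix_vector_mul_assoc)

lemma lat_mult_subset_iff:
  assumes "invertible g"
  shows "lat (g ** m) \<subseteq> lat g \<longleftrightarrow> integral_matrix v m"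
proof
  have inj: "inj ((*v) g)" by (rule inj_matrix_vector_mult[OF assms])
  assume sub: "lat (g ** m) \<subseteq> lat g"
  have "m $ i $ j \<in> vball v 0" for i j
  proof -
    let ?e = "axis j 1 :: 'a^2"
    have "?e \<in> std_lattice v" by (simp add: valuation_ring_eq_vball axis_def)
    then have "(g ** m) *v ?e \<in> lat g" using sub unfolding lattice_of_def by blast
    then obtain u where u: "u \<in> std_lattice v" "g *v (m *v ?e) = g *v u"
      unfolding lattice_of_def by (auto simp: matrix_vector_mul_assoc)
    then have mu: "m *v ?e = u" using inj by (simp add: inj_eq)
    have me: "(m *v ?e) $ i = m $ i $ j" using exhaust_2[of j] by (auto simp: matrix_vector_mult_2 axis_def)
    have "u $ i \<in> vball v 0" using u(1) by (simp add: valuation_ring_eq_vball)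
    then show ?thesis by (simp only: mu[symmetric] me)
  qed
  then show "integral_matrix v m" by (simp add: integral_matrix_def)
next
  assume m: "integral_matrix v m"
  show "lat (g ** m) \<subseteq> lat g"
  proof
    fix x assume "x \<in> lat (g ** m)"
    then obtain u where u: "u \<in> std_lattice v" "x = g *v (m *v u)"
      unfolding lattice_of_def by (auto simp: matrix_vector_mul_assoc)
    have "m *v u \<in> std_lattice v"
      using m u(1) unfolding std_lattice_iff matrix_vector_mult_2 integral_matrix_def
      by (intro conjI vball_add vball_mult0) auto
    then show "x \<in> lat g" unfolding lattice_of_def using u(2) by blast
  qed
qed

lemma val_det_integral:
  assumes "integral_matrix v m" "det m \<noteq> 0"
  shows "0 \<le> v (det m)"
proof -
  have "det m \<in> vball v 0"
    using assms(1) unfolding det_2 integral_matrix_def by (intro vball_diff vball_mult0) auto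
  then show ?thesis using assms(2) by (simp add: vball_def)
qed

text \<open>The base change \<open>m\<close> is integral. If its determinant is a unit, Cramer's
  rule makes its inverse integral as well.\<close>

lemma lat_subset:
  assumes "invertible g" "invertible h" "lat h \<subseteq> lat g"
  shows "v (det g) \<le> v (det h)" and "v (det g) = v (det h) \<Longrightarrow> lat g = lat h"
proof -
  define m where "m = matrix_inv g ** h"
  have gm: "h = g ** m" by (simp add: m_def matrix_mul_assoc matrix_inv_inverse[OF assms(1)])
  have int: "integral_matrix v m" using lat_mult_subset_iff[OF assms(1)] assms(3) gm by simp
  have det: "det h = det g * det m" using gm det_mul by metis
  have nz: "det h \<noteq> 0" "det g \<noteq> 0" using assms by (simp_all add: invertible_det_nz)
  then have nzm: "det m \<noteq> 0" using det by auto
  have val: "v (det h) = v (det g) + v (det m)" using det nz nzm by (simp add: val_mult)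
  then show "v (det g) \<le> v (det h)" using val_det_integral[OF int nzm] by simp
  assume "v (det g) = v (det h)"
  then have v0: "v (det m) = 0" using val by simp
  define d where "d = inverse (det m)"
  have d: "d * (m $ 1 $ 1 * m $ 2 $ 2 - m $ 1 $ 2 * m $ 2 $ 1) = 1"
    using nzm by (simp add: d_def flip: det_2)
  \<comment> \<open>The adjugate divided by the determinant; in the index type \<open>2\<close> the
    map \<open>3 - i\<close> exchanges 1 and 2.\<close>
  define m' :: "'a^2^2" where
    "m' = (\<chi> i j. d * (if i = j then m $ (3 - i) $ (3 - j) else - m $ i $ j))"
  have idx: "(3::2) - 1 = 2" "(3::2) - 2 = 1" by simp_all
  have "d \<in> vball v 0" using v0 by (simp add: vball_def d_def)
  then have int': "integral_matrix v m'"
    using int unfolding integral_matrix_def m'_def by (auto intro!: vball_mult0)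
  have "m ** m' = mat 1"
    unfolding mat2_eq_iff forall_2 matrix_matrix_mult_2 m'_def mat_def
    using d by (simp add: idx algebra_simps)
  then have "g = h ** m'" by (simp add: gm flip: matrix_mul_assoc)
  then have "lat g \<subseteq> lat h" using lat_mult_subset_iff[OF assms(2), of m'] int' by simp
  then show "lat g = lat h" using assms(3) by blast
qed

lemma lat_eq_val_det: "invertible g \<Longrightarrow> invertible h \<Longrightarrow> lat h = lat g \<Longrightarrow> v (det g) = v (det h)"
  using lat_subset(1)[of g h] lat_subset(1)[of h g] by simp

text \<open>Minus the logarithm of the volume of the lattice, to the base of the residue field
  order: larger values belong to smaller lattices. The lattice is a bare set, so a basis is picked
  by \<open>SOME\<close>; the choice does not matter.\<close>

definition ldet :: "('a^2) set \<Rightarrow> int" where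
  "ldet L = v (det (SOME g. invertible g \<and> L = lat g))"

lemma ldet: "invertible g \<Longrightarrow> ldet (lat g) = v (det g)"
proof -
  assume g: "invertible g"
  define h where "h = (SOME h. invertible h \<and> lat g = lat h)"
  have "invertible h \<and> lat g = lat h" unfolding h_def by (rule someI[of _ g]) (simp add: g)
  then show ?thesis using lat_eq_val_det[of g h] g unfolding ldet_def h_def by simp
qed

lemma lattice_subset:
  assumes "is_lattice v L" "is_lattice v M" "M \<subseteq> L"
  shows "ldet L \<le> ldet M" and "ldet L = ldet M \<Longrightarrow> L = M"
proof -
  obtain g h where gh: "invertible g" "invertible h" "L = lat g" "M = lat h"
    using assms(1,2) by (auto simp: is_lattice_iff)
  show "ldet L \<le> ldet M" using lat_subset(1)[OF gh(1,2)] assms(3) gh by (simp add: ldet)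
  assume "ldet L = ldet M"
  then show "L = M" using lat_subset(2)[OF gh(1,2)] assms(3) gh by (simp add: ldet)
qed

lemma is_lattice_scale: "is_lattice v L \<Longrightarrow> c \<noteq> 0 \<Longrightarrow> is_lattice v (scale_lattice c L)"
  unfolding is_lattice_iff using invertible_scale scale_lat by metis

lemma ldet_scale:
  assumes "is_lattice v L" "c \<noteq> 0"
  shows "ldet (scale_lattice c L) = ldet L + 2 * v c"
proof -
  obtain g where g: "invertible g" "L = lat g" using assms(1) by (auto simp: is_lattice_iff)
  have "det g \<noteq> 0" using g(1) by (simp add: invertible_det_nz)
  then show ?thesis
    using assms(2) g by (simp add: scale_lat ldet invertible_scale det_matrix_scale val_mult)
qed

lemma lattice_smult: "is_lattice v L \<Longrightarrow> a \<in> vball v 0 \<Longrightarrow> x \<in> L \<Longrightarrow> a *s x \<in> L"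
  using lat_smult by (auto simp: is_lattice_iff)

lemma lattice_add: "is_lattice v L \<Longrightarrow> x \<in> L \<Longrightarrow> y \<in> L \<Longrightarrow> x + y \<in> L"
  using lat_add by (auto simp: is_lattice_iff)

lemma lattice_diff: "is_lattice v L \<Longrightarrow> x \<in> L \<Longrightarrow> y \<in> L \<Longrightarrow> x - y \<in> L"
  using lat_diff by (auto simp: is_lattice_iff)

lemma scale_lattice_mono:
  assumes "is_lattice v L" "a \<noteq> 0" "b \<noteq> 0" "v a \<le> v b"
  shows "scale_lattice b L \<subseteq> scale_lattice a L"
proof
  fix x assume "x \<in> scale_lattice b L"
  then obtain y where y: "y \<in> L" "x = b *s y" by (auto simp: scale_lattice_def)
  have "b / a \<in> vball v 0" using assms by (simp add: vball_def val_divide)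
  then have "(b / a) *s y \<in> L" using lattice_smult[OF assms(1)] y by blast
  moreover have "x = a *s ((b / a) *s y)" using y assms(2) by (simp add: vector_smult_assoc)
  ultimately show "x \<in> scale_lattice a L" unfolding scale_lattice_def by blast
qed

lemma scale_lattice_cong:
  "is_lattice v L \<Longrightarrow> a \<noteq> 0 \<Longrightarrow> b \<noteq> 0 \<Longrightarrow> v a = v b \<Longrightarrow> scale_lattice a L = scale_lattice b L"
  using scale_lattice_mono[of L a b] scale_lattice_mono[of L b a] by simp

lemma vertices_iff: "V \<in> vertices v \<longleftrightarrow> (\<exists>L. is_lattice v L \<and> V = homothety_class L)"
  by (auto simp: vertices_def)

lemma vertex_member:
  assumes "V \<in> vertices v" "L \<in> V"
  shows "is_lattice v L" "V = homothety_class L"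
proof -
  obtain M where M: "is_lattice v M" "V = homothety_class M" using assms(1) by (auto simp: vertices_iff)
  then show "V = homothety_class L" using homothety_class_eq assms(2) by blast
  show "is_lattice v L" using M assms(2) is_lattice_scale by (auto simp: homothety_class_def)
qed

lemma vertex_member_scale:
  assumes "V \<in> vertices v" "L \<in> V" "M \<in> V"
  obtains c where "c \<noteq> 0" "M = scale_lattice c L"
  using vertex_member[OF assms(1,2)] assms(3) by (auto simp: homothety_class_def)

lemma scale_mem_vertex:
  assumes "V \<in> vertices v" "L \<in> V" "c \<noteq> 0"
  shows "scale_lattice c L \<in> V"
proof -
  have "scale_lattice c L \<in> homothety_class L" using assms(3) by (auto simp: homothety_class_def)
  then show ?thesis using vertex_member(2)[OF assms(1,2)] by simp
qed

text \<open>Homotheties change \<open>ldet\<close> by even numbers and passing to a neighbour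
  changes its parity, so this is the bipartition of the tree.\<close>

definition even_vertex :: "('a^2) set set \<Rightarrow> bool" where
  "even_vertex V \<longleftrightarrow> (\<exists>L\<in>V. even (ldet L))"

lemma even_vertex_iff:
  assumes "V \<in> vertices v" "L \<in> V"
  shows "even_vertex V \<longleftrightarrow> even (ldet L)"
proof
  assume "even_vertex V"
  then obtain M where M: "M \<in> V" "even (ldet M)" by (auto simp: even_vertex_def)
  obtain c where c: "c \<noteq> 0" "M = scale_lattice c L" using vertex_member_scale[OF assms M(1)] .
  then show "even (ldet L)" using M(2) ldet_scale[OF vertex_member(1)[OF assms]] by simp
qed (use assms in \<open>auto simp: even_vertex_def\<close>)

text \<open>\<open>ldet\<close> increases by 2 from \<open>L\<close> to
  \<open>scale_lattice \<pi> L\<close>, and strictly along strict inclusions, so \<open>M\<close>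
  sits exactly in the middle.\<close>

lemma between_ldet:
  assumes "is_lattice v L" "is_lattice v M" "v \<pi> = 1" "scale_lattice \<pi> L \<subset> M" "M \<subset> L"
  shows "ldet M = ldet L + 1"
proof -
  have pi: "\<pi> \<noteq> 0" using assms(3) by auto
  have s: "is_lattice v (scale_lattice \<pi> L)" by (rule is_lattice_scale[OF assms(1) pi])
  have ls: "ldet (scale_lattice \<pi> L) = ldet L + 2" using ldet_scale[OF assms(1) pi] assms(3) by simp
  have "ldet L \<le> ldet M" "ldet L \<noteq> ldet M"
    using lattice_subset[OF assms(1,2)] assms(5) by auto
  moreover have "ldet M \<le> ldet L + 2" "ldet M \<noteq> ldet L + 2"
    using lattice_subset[OF assms(2) s] assms(4) ls by auto
  ultimately show ?thesis by simp
qed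

lemma adjacent_even:
  assumes "V \<in> vertices v" "V' \<in> vertices v" "adjacent v V V'"
  shows "even_vertex V' \<longleftrightarrow> \<not> even_vertex V"
proof -
  obtain L M \<pi> where *: "L \<in> V" "M \<in> V'" "v \<pi> = 1" "scale_lattice \<pi> L \<subset> M" "M \<subset> L"
    using assms(3) unfolding adjacent_def by blast
  have "ldet M = ldet L + 1"
    using * vertex_member(1) assms by (intro between_ldet[of L M \<pi>]) auto
  then show ?thesis using even_vertex_iff[OF assms(1) *(1)] even_vertex_iff[OF assms(2) *(2)] by simp
qed

lemma adjacent_sym:
  assumes "V \<in> vertices v" "adjacent v V V'"
  shows "adjacent v V' V"
proof -
  obtain L M \<pi> where *: "L \<in> V" "M \<in> V'" "v \<pi> = 1" "scale_lattice \<pi> L \<subset> M" "M \<subset> L"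
    using assms(2) unfolding adjacent_def by blast
  have pi: "\<pi> \<noteq> 0" using *(3) by auto
  have inj: "inj (\<lambda>u::'a^2. \<pi> *s u)" using pi by (auto intro!: injI simp: vec_eq_iff)
  have "scale_lattice \<pi> M \<subset> scale_lattice \<pi> L"
    unfolding scale_lattice_def by (rule image_strict_mono[OF inj_on_subset[OF inj subset_UNIV] *(5)])
  moreover have "scale_lattice \<pi> L \<in> V" by (rule scale_mem_vertex[OF assms(1) *(1) pi])
  ultimately show ?thesis unfolding adjacent_def using * by blast
qed

lemma edges_iff: "(V, V') \<in> edges v \<longleftrightarrow> V \<in> vertices v \<and> V' \<in> vertices v \<and> adjacent v V V'"
  by (simp add: edges_def)

text \<open>\<open>T\<close> represents the finite quotient of \<open>L\<close> by
  \<open>scale_lattice \<pi> L\<close>. A lattice in between is a union of classes, hence determined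
  by its trace on \<open>T\<close>.\<close>

lemma finite_between:
  assumes D: "residue_reps v D" and L: "is_lattice v L" and pi: "v \<pi> = 1"
  shows "finite {M. is_lattice v M \<and> scale_lattice \<pi> L \<subseteq> M \<and> M \<subseteq> L}" (is "finite ?S")
proof -
  obtain g where g: "invertible g" "L = lat g" using L by (auto simp: is_lattice_iff)
  have p0: "\<pi> \<noteq> 0" using pi by auto
  define T where "T = (\<lambda>(a, b). g *v vector [a, b]) ` (D \<times> D)"
  have finT: "finite T" using D by (simp add: T_def residue_reps_def)
  have cover: "\<exists>t\<in>T. x - t \<in> scale_lattice \<pi> L" if x: "x \<in> L" for x
  proof -
    obtain u where u: "u \<in> std_lattice v" "x = g *v u" using x g(2) by (auto simp: lattice_of_def)
    obtain a b where ab: "a \<in> D" "b \<in> D" "u $ 1 - a \<in> vball v 1" "u $ 2 - b \<in> vball v 1"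
      using D u(1) unfolding residue_reps_def std_lattice_iff by blast
    define z :: "'a^2" where "z = vector [(u $ 1 - a) / \<pi>, (u $ 2 - b) / \<pi>]"
    have "z \<in> std_lattice v"
      using ab(3,4) p0 vball_mult_iff[OF p0, of "(u $ 1 - a) / \<pi>" 1]
        vball_mult_iff[OF p0, of "(u $ 2 - b) / \<pi>" 1] pi
      unfolding std_lattice_iff z_def by simp
    then have "g *v z \<in> L" unfolding g(2) lattice_of_def by blast
    moreover have "x - g *v vector [a, b] = \<pi> *s (g *v z)"
      using p0 by (simp add: u(2) vec2_eq_iff matrix_vector_mult_2 z_def field_simps)
    ultimately have "x - g *v vector [a, b] \<in> scale_lattice \<pi> L" unfolding scale_lattice_def by blast
    moreover have "g *v vector [a, b] \<in> T" unfolding T_def using ab(1,2) by force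
    ultimately show ?thesis by blast
  qed
  have "inj_on (\<lambda>M. M \<inter> T) ?S"
  proof (rule inj_onI)
    have sub: "M \<subseteq> M'" if M: "M \<in> ?S" "M' \<in> ?S" "M \<inter> T = M' \<inter> T" for M M'
    proof
      fix x assume x: "x \<in> M"
      obtain t where t: "t \<in> T" "x - t \<in> scale_lattice \<pi> L" using cover x M(1) by blast
      have "x - t \<in> M" using t M(1) by blast
      with x have "x - (x - t) \<in> M" using lattice_diff[of M] M(1) by blast
      then have "t \<in> M'" using t(1) M(3) by auto
      moreover have "x - t \<in> M'" using t M(2) by blast
      ultimately have "t + (x - t) \<in> M'" using lattice_add[of M'] M(2) by blast
      then show "x \<in> M'" by simp
    qed
    fix M M' assume "M \<in> ?S" "M' \<in> ?S" "M \<inter> T = M' \<inter> T"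
    then show "M = M'" using sub[of M M'] sub[of M' M] by simp
  qed
  moreover have "finite ((\<lambda>M. M \<inter> T) ` ?S)"
    by (rule finite_subset[of _ "Pow T"]) (use finT in auto)
  ultimately show ?thesis using finite_imageD by blast
qed

text \<open>Every neighbour has a representative just below one fixed \<open>L\<close>. Finiteness
  matters because a sum over an infinite set is 0 by convention.\<close>

lemma finite_neighbours:
  assumes D: "residue_reps v D" and V: "V \<in> vertices v"
  shows "finite {V'. (V, V') \<in> edges v}"
proof -
  obtain L where L: "is_lattice v L" "V = homothety_class L" using V by (auto simp: vertices_iff)
  obtain \<pi> where pi: "\<pi> \<noteq> 0" "v \<pi> = 1" using uniformizer .
  let ?S = "{M. is_lattice v M \<and> scale_lattice \<pi> L \<subseteq> M \<and> M \<subseteq> L}"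
  have "{V'. (V, V') \<in> edges v} \<subseteq> homothety_class ` ?S"
  proof
    fix V' assume "V' \<in> {V'. (V, V') \<in> edges v}"
    then have V': "V' \<in> vertices v" "adjacent v V V'" by (auto simp: edges_iff)
    then obtain K M q where *: "K \<in> V" "M \<in> V'" "v q = 1" "scale_lattice q K \<subset> M" "M \<subset> K"
      unfolding adjacent_def by blast
    obtain c where c: "c \<noteq> 0" "K = scale_lattice c L" using *(1) L(2) by (auto simp: homothety_class_def)
    define M' where "M' = scale_lattice (inverse c) M"
    have mono: "scale_lattice a X \<subseteq> scale_lattice a Y" if "X \<subseteq> Y" for a and X Y :: "('a^2) set"
      using that by (auto simp: scale_lattice_def)
    have "scale_lattice (inverse c) (scale_lattice q K) \<subseteq> M'" "M' \<subseteq> scale_lattice (inverse c) K"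
      unfolding M'_def using * by (auto intro!: mono)
    moreover have "scale_lattice (inverse c) K = L" using c by (simp add: scale_lattice_mult)
    moreover have "inverse c * (q * c) = q" using c(1) by simp
    then have "scale_lattice (inverse c) (scale_lattice q K) = scale_lattice q L"
      unfolding c(2) scale_lattice_mult by (simp only:)
    moreover have "scale_lattice q L = scale_lattice \<pi> L"
      using *(3) pi by (intro scale_lattice_cong L(1)) auto
    moreover have "is_lattice v M'" unfolding M'_def
      using c vertex_member(1)[OF V'(1) *(2)] by (intro is_lattice_scale) auto
    ultimately have "M' \<in> ?S" by simp
    moreover have "V' = homothety_class M'"
      using vertex_member(2)[OF V'(1) *(2)] c homothety_class_scale[of "inverse c" M] by (simp add: M'_def)
    ultimately show "V' \<in> homothety_class ` ?S" by blast
  qed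
  then show ?thesis using finite_between[OF D L(1) pi(2)] finite_surj by blast
qed

section \<open>The action on the tree\<close>

lemma is_lattice_image: "invertible g \<Longrightarrow> is_lattice v L \<Longrightarrow> is_lattice v ((\<lambda>u. g *v u) ` L)"
  unfolding is_lattice_iff using invertible_mult image_lat by metis

lemma ldet_image:
  assumes "invertible g" "is_lattice v L"
  shows "ldet ((\<lambda>u. g *v u) ` L) = v (det g) + ldet L"
proof -
  obtain h where h: "invertible h" "L = lat h" using assms(2) by (auto simp: is_lattice_iff)
  have "det g \<noteq> 0" "det h \<noteq> 0" using assms(1) h(1) by (simp_all add: invertible_det_nz)
  then show ?thesis using assms(1) h by (simp add: image_lat ldet invertible_mult det_mul val_mult)
qed

lemma vertex_action_vertex: "invertible g \<Longrightarrow> V \<in> vertices v \<Longrightarrow> vertex_action g V \<in> vertices v"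
  unfolding vertices_iff using is_lattice_image vertex_action_class by metis

lemma vertex_action_mult: "vertex_action g (vertex_action h V) = vertex_action (g ** h) V"
  by (simp add: vertex_action_def image_image matrix_vector_mul_assoc)

lemma vertex_action_one [simp]: "vertex_action (mat 1) V = V"
  by (simp add: vertex_action_def)

lemma vertex_action_inverse:
  assumes "invertible g"
  shows "vertex_action (matrix_inv g) (vertex_action g V) = V"
    "vertex_action g (vertex_action (matrix_inv g) V) = V"
  by (simp_all add: vertex_action_mult matrix_inv_inverse[OF assms])

lemma even_vertex_action:
  assumes "invertible g" "v (det g) = 0" "V \<in> vertices v"
  shows "even_vertex (vertex_action g V) = even_vertex V"
proof -
  obtain L where L: "is_lattice v L" "V = homothety_class L" using assms(3) by (auto simp: vertices_iff)
  have "L \<in> V" "(\<lambda>u. g *v u) ` L \<in> vertex_action g V"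
    using homothety_class_self by (auto simp: L(2) vertex_action_class)
  then show ?thesis
    using even_vertex_iff[OF vertex_action_vertex[OF assms(1,3)]] even_vertex_iff[OF assms(3)]
      ldet_image[OF assms(1) L(1)] assms(2) by simp
qed

lemma adjacent_action:
  assumes "invertible g" "adjacent v V V'"
  shows "adjacent v (vertex_action g V) (vertex_action g V')"
proof -
  let ?g = "\<lambda>u. g *v u"
  obtain L M \<pi> where *: "L \<in> V" "M \<in> V'" "v \<pi> = 1" "scale_lattice \<pi> L \<subset> M" "M \<subset> L"
    using assms(2) unfolding adjacent_def by blast
  have inj: "inj ?g" by (rule inj_matrix_vector_mult[OF assms(1)])
  have strict: "?g ` X \<subset> ?g ` Y" if "X \<subset> Y" for X Y
    by (rule image_strict_mono[OF inj_on_subset[OF inj subset_UNIV] that])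
  have "scale_lattice \<pi> (?g ` L) \<subset> ?g ` M" using strict[OF *(4)] by (simp add: matrix_image_scale)
  moreover have "?g ` M \<subset> ?g ` L" by (rule strict[OF *(5)])
  moreover have "?g ` L \<in> vertex_action g V" "?g ` M \<in> vertex_action g V'"
    using *(1,2) by (auto simp: vertex_action_def)
  ultimately show ?thesis unfolding adjacent_def using *(3) by blast
qed

lemma edge_action_iff:
  assumes "invertible g"
  shows "(vertex_action g V, vertex_action g V') \<in> edges v \<longleftrightarrow> (V, V') \<in> edges v"
proof -
  have fwd: "(vertex_action g V, vertex_action g V') \<in> edges v"
    if "(V, V') \<in> edges v" "invertible g" for g V V'
    using that adjacent_action vertex_action_vertex by (simp add: edges_iff)
  have "invertible (matrix_inv g)"
    using matrix_inv_inverse[OF assms] by (auto simp: invertible_def)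
  from fwd[OF _ this, of "vertex_action g V" "vertex_action g V'"] fwd[OF _ assms, of V V'] show ?thesis
    by (auto simp: vertex_action_inverse[OF assms])
qed

end


section \<open>Minimal vectors\<close>

text \<open>All that the tree argument takes from arithmetic: a discrete subgroup of exponent
  \<open>p\<close> that meets every lattice of large volume, and a group preserving it whose
  determinants have value 0.\<close>

locale lattice_points = valued_field w for w :: "'c::field \<Rightarrow> int" +
  fixes D :: "'c set" and N :: "('c^2) set" and C :: nat and p :: nat and G :: "('c^2^2) set"
  assumes reps: "residue_reps w D"
    and N_0: "0 \<in> N" and N_diff: "\<And>x y. x \<in> N \<Longrightarrow> y \<in> N \<Longrightarrow> x - y \<in> N"
    and N_finite: "\<And>L. is_lattice w L \<Longrightarrow> finite (N \<inter> L)"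
    and N_meets: "\<And>L. is_lattice w L \<Longrightarrow> ldet L \<le> - int C \<Longrightarrow> \<exists>x\<in>N. x \<noteq> 0 \<and> x \<in> L"
    and p_prime: "prime p" and N_char: "\<And>x. x \<in> N \<Longrightarrow> of_nat p *s x = 0"
    and G_invertible: "\<And>g. g \<in> G \<Longrightarrow> invertible g"
    and G_inverse: "\<And>g. g \<in> G \<Longrightarrow> matrix_inv g \<in> G"
    and G_N: "\<And>g x. g \<in> G \<Longrightarrow> x \<in> N \<Longrightarrow> g *v x \<in> N"
    and G_det: "\<And>g. g \<in> G \<Longrightarrow> w (det g) = 0"
begin

definition minimal :: "('c^2) set set \<Rightarrow> ('c^2) set \<Rightarrow> bool" where
  "minimal V L \<longleftrightarrow> L \<in> V \<and> (\<exists>x\<in>N. x \<noteq> 0 \<and> x \<in> L) \<and>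
     (\<forall>\<pi>. w \<pi> = 1 \<longrightarrow> (\<forall>x\<in>N. x \<in> scale_lattice \<pi> L \<longrightarrow> x = 0))"

lemma lattice_bounded:
  assumes "is_lattice w L" "x \<noteq> 0"
  shows "\<exists>n::nat. \<forall>c. c \<noteq> 0 \<longrightarrow> int n \<le> w c \<longrightarrow> x \<notin> scale_lattice c L"
proof -
  obtain g where g: "invertible g" "L = lat g" using assms(1) by (auto simp: is_lattice_iff)
  define u where "u = matrix_inv g *v x"
  have "g *v u = x" by (simp add: u_def matrix_vector_mul_assoc matrix_inv_inverse[OF g(1)])
  then have "u \<noteq> 0" using assms(2) by auto
  then obtain i where i: "u $ i \<noteq> 0" by (auto simp: vec_eq_iff)
  have "x \<notin> scale_lattice c L" if c: "c \<noteq> 0" "int (nat (w (u $ i) + 1)) \<le> w c" for c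
  proof
    assume "x \<in> scale_lattice c L"
    then obtain z where z: "z \<in> std_lattice w" "x = c *s (g *v z)"
      using g(2) by (auto simp: scale_lattice_def lattice_of_def)
    have "u = c *s (matrix_inv g *v (g *v z))" by (simp add: u_def z(2) vector_scalar_commute)
    then have "u = c *s z" by (simp add: matrix_vector_mul_assoc matrix_inv_inverse[OF g(1)])
    then have "u $ i = c * z $ i" by simp
    moreover have "z $ i \<in> vball w 0" using z(1) by (simp add: valuation_ring_eq_vball)
    ultimately have "w c \<le> w (u $ i)" using i c(1) by (auto simp: vball_def val_mult)
    then show False using c(2) by linarith
  qed
  then show ?thesis by blast
qed

text \<open>Start with a member of the class so large that it must meet \<open>N\<close>, and shrink
  it by a uniformizer. This stops, since the first lattice contains finitely many nonzero points of
  \<open>N\<close> and each is divisible only finitely often.\<close>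

lemma ex_minimal:
  assumes V: "V \<in> vertices w"
  shows "\<exists>L. minimal V L"
proof (rule ccontr)
  assume none: "\<not> ?thesis"
  obtain L0 where L0: "is_lattice w L0" "V = homothety_class L0" using V by (auto simp: vertices_iff)
  have L0V: "L0 \<in> V" using L0 homothety_class_self by simp
  obtain \<pi> where pi: "\<pi> \<noteq> 0" "w \<pi> = 1" using uniformizer .
  \<comment> \<open>Scaling by an element of value \<open>- m\<close> lowers \<open>ldet\<close> by
    \<open>2 * m\<close>, enough to reach \<open>- int C\<close>.\<close>
  define m where "m = int C + \<bar>ldet L0\<bar>"
  obtain a where a: "a \<noteq> 0" "w a = - m" using val_surj .
  define M where "M n = scale_lattice (a * \<pi> ^ n) L0" for n
  have M: "is_lattice w (M n)" "M n \<in> V" for n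
    unfolding M_def using a pi is_lattice_scale[OF L0(1)] scale_mem_vertex[OF V L0V] by auto
  have meets: "\<exists>x\<in>N. x \<noteq> 0 \<and> x \<in> M n" for n
  proof (induction n)
    case 0
    have "ldet (M 0) \<le> - int C" using a ldet_scale[OF L0(1) a(1)] by (simp add: M_def m_def)
    then show ?case by (rule N_meets[OF M(1)])
  next
    case (Suc n)
    have "\<not> minimal V (M n)" using none by blast
    then obtain q x where q: "w q = 1" "x \<in> N" "x \<in> scale_lattice q (M n)" "x \<noteq> 0"
      using M(2) Suc unfolding minimal_def by blast
    have "scale_lattice q (M n) = scale_lattice \<pi> (M n)"
      using q(1) pi by (intro scale_lattice_cong M) auto
    then have "scale_lattice q (M n) = M (Suc n)" by (simp add: M_def scale_lattice_mult ac_simps)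
    then show ?case using q by blast
  qed
  have "\<forall>x\<in>N \<inter> M 0 - {0}. \<exists>n::nat. \<forall>c. c \<noteq> 0 \<longrightarrow> int n \<le> w c \<longrightarrow> x \<notin> scale_lattice c (M 0)"
    using lattice_bounded[OF M(1)] by blast
  from bchoice[OF this] obtain f :: "'c^2 \<Rightarrow> nat" where
    f: "\<forall>x\<in>N \<inter> M 0 - {0}. \<forall>c. c \<noteq> 0 \<longrightarrow> int (f x) \<le> w c \<longrightarrow> x \<notin> scale_lattice c (M 0)" ..
  have "finite (f ` (N \<inter> M 0 - {0}))" using N_finite[OF M(1)] by simp
  then obtain n where n: "\<forall>x\<in>N \<inter> M 0 - {0}. f x \<le> n" using Max_ge by blast
  obtain x where x: "x \<in> N" "x \<noteq> 0" "x \<in> M n" using meets by blast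
  have Mn: "M n = scale_lattice (\<pi> ^ n) (M 0)" by (simp add: M_def scale_lattice_mult ac_simps)
  have wn: "w (\<pi> ^ n) = int n" using pi by (simp add: val_power)
  have "scale_lattice (\<pi> ^ n) (M 0) \<subseteq> scale_lattice 1 (M 0)"
    using pi wn by (intro scale_lattice_mono M) auto
  then have "x \<in> M 0" using x(3) Mn by auto
  then have "x \<notin> scale_lattice (\<pi> ^ n) (M 0)" using f n x pi wn by simp
  then show False using x(3) Mn by simp
qed

text \<open>If one of two homothetic lattices were properly smaller, it would lie in a uniformizer
  multiple of the other, which contains no nonzero point of \<open>N\<close>.\<close>

lemma minimal_unique:
  assumes V: "V \<in> vertices w" and LM: "minimal V L" "minimal V M"
  shows "L = M"
proof -
  obtain \<pi> where pi: "\<pi> \<noteq> 0" "w \<pi> = 1" using uniformizer .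
  have *: "\<not> w c \<ge> 1" if L: "minimal V L" and M: "minimal V (scale_lattice c L)" and c: "c \<noteq> 0" for L c
  proof
    assume "w c \<ge> 1"
    have "L \<in> V" using L by (simp add: minimal_def)
    then have "scale_lattice c L \<subseteq> scale_lattice \<pi> L"
      using pi c \<open>w c \<ge> 1\<close> by (intro scale_lattice_mono vertex_member(1)[OF V]) auto
    moreover obtain x where "x \<in> N" "x \<noteq> 0" "x \<in> scale_lattice c L" using M by (auto simp: minimal_def)
    ultimately show False using L pi unfolding minimal_def by blast
  qed
  have mem: "L \<in> V" "M \<in> V" using LM by (simp_all add: minimal_def)
  obtain c where c: "c \<noteq> 0" "M = scale_lattice c L" using vertex_member_scale[OF V mem] .
  have "L = scale_lattice (inverse c) M" using c by (simp add: scale_lattice_mult)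
  then have "\<not> w c \<ge> 1" "\<not> w (inverse c) \<ge> 1"
    using *[OF LM(1), of c] *[OF LM(2), of "inverse c"] LM c by auto
  then have "w c = w 1" using c(1) by simp
  then have "scale_lattice c L = scale_lattice 1 L"
    using c(1) by (intro scale_lattice_cong vertex_member(1)[OF V mem(1)]) auto
  then show ?thesis using c(2) by simp
qed

definition min_lattice :: "('c^2) set set \<Rightarrow> ('c^2) set" where
  "min_lattice V = (THE L. minimal V L)"

lemma minimal: "V \<in> vertices w \<Longrightarrow> minimal V (min_lattice V)"
  unfolding min_lattice_def using ex_minimal minimal_unique by (metis theI)

lemma min_lattice_eq: "V \<in> vertices w \<Longrightarrow> minimal V L \<Longrightarrow> min_lattice V = L"
  using minimal minimal_unique by blast

definition min_vectors :: "('c^2) set set \<Rightarrow> ('c^2) set" where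
  "min_vectors V = N \<inter> min_lattice V - {0}"

lemma min_lattice:
  assumes "V \<in> vertices w"
  shows "min_lattice V \<in> V" "is_lattice w (min_lattice V)" "V = homothety_class (min_lattice V)"
  using minimal[OF assms] vertex_member[OF assms] by (auto simp: minimal_def)

lemma finite_min_vectors: "V \<in> vertices w \<Longrightarrow> finite (min_vectors V)"
  using N_finite min_lattice(2) by (simp add: min_vectors_def)

text \<open>\<open>H\<close> is a group of exponent \<open>p\<close>; the multiples of
  \<open>z\<close> form a subgroup of order \<open>p\<close>, whose cosets partition
  \<open>H\<close>.\<close>

lemma card_dvd_of_translation_invariant:
  fixes H :: "('c^2) set"
  assumes "finite H" "\<And>x y. x \<in> H \<Longrightarrow> y \<in> H \<Longrightarrow> x - y \<in> H" "z \<in> H" "z \<noteq> 0" "H \<subseteq> N"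
  shows "p dvd card H"
proof -
  have H0: "0 \<in> H" using assms(2)[OF assms(3,3)] by simp
  have Hneg: "- x \<in> H" if "x \<in> H" for x using assms(2)[OF H0 that] by simp
  have Hadd: "x + y \<in> H" if "x \<in> H" "y \<in> H" for x y using assms(2)[OF that(1) Hneg[OF that(2)]] by simp
  have Hz: "of_nat i *s z \<in> H" for i
    by (induction i) (simp_all add: H0 vector_sadd_rdistrib Hadd assms(3))
  define coset where "coset x = (\<lambda>i. x + of_nat i *s z) ` {..<p}" for x
  have p: "p > 1" using p_prime prime_gt_1_nat by blast
  have shift: "of_nat i *s z = of_nat (i mod p) *s z" for i
  proof -
    have "(of_nat i :: 'c) = of_nat (i div p) * of_nat p + of_nat (i mod p)"
      by (metis div_mult_mod_eq of_nat_add of_nat_mult)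
    then have "of_nat i *s z = of_nat (i div p) *s (of_nat p *s z) + of_nat (i mod p) *s z"
      by (simp add: vector_sadd_rdistrib vector_smult_assoc)
    then show ?thesis using N_char assms(3,5) by auto
  qed
  have inj: "i = j" if "i < p" "j < p" "of_nat i *s z = of_nat j *s z" for i j
  proof -
    have aux: False if ij: "i < j" "j < p" "of_nat i *s z = of_nat j *s z" for i j
    proof -
      have "of_nat (j - i) *s z = of_nat j *s z - of_nat i *s z"
        using ij(1) by (simp add: of_nat_diff vector_sub_rdistrib)
      then have "of_nat (j - i) *s z = 0" using ij(3) by simp
      then have 1: "(of_nat (j - i) :: 'c) = 0" using assms(4) by auto
      have "of_nat p *s z = 0" using N_char assms(3,5) by blast
      then have 2: "(of_nat p :: 'c) = 0" using assms(4) by auto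
      have "coprime (j - i) p" using ij p_prime
        by (metis coprime_commute diff_le_self dvd_imp_le le_less_trans not_le prime_imp_coprime zero_less_diff)
      then obtain x y where "(j - i) * x = p * y + 1"
        using ij(1) by (metis bezout_nat coprime_imp_gcd_eq_1 zero_less_diff less_numeral_extra(3))
      then have "of_nat ((j - i) * x) = (of_nat (p * y + 1) :: 'c)" by simp
      then show False using 1 2 by simp
    qed
    show ?thesis using aux[of i j] aux[of j i] that by (metis linorder_neqE_nat)
  qed
  have card_coset: "card (coset x) = p" for x
  proof -
    have "inj_on (\<lambda>i. x + of_nat i *s z) {..<p}" using inj by (intro inj_onI) auto
    then show ?thesis by (simp add: coset_def card_image)
  qed
  have self: "x \<in> coset x" for x
    unfolding coset_def by (rule image_eqI[of _ _ 0]) (use p in simp_all)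
  have coset_sub: "coset y \<subseteq> coset x" if "y \<in> coset x" for x y
  proof
    fix a assume "a \<in> coset y"
    then obtain i j where "a = x + of_nat j *s z + of_nat i *s z" using \<open>y \<in> coset x\<close> by (auto simp: coset_def)
    then have "a = x + of_nat ((i + j) mod p) *s z"
      by (simp add: vector_sadd_rdistrib add.assoc add.commute flip: shift)
    then show "a \<in> coset x" unfolding coset_def using p by (intro image_eqI[of _ _ "(i + j) mod p"]) auto
  qed
  have coset_eq: "coset y = coset x" if y: "y \<in> coset x" for x y
    by (rule card_subset_eq) (use coset_sub[OF y] card_coset in \<open>auto simp: coset_def\<close>)
  have "p * card (coset ` H) = card (\<Union>(coset ` H))"
  proof (rule card_partition)
    show "finite (coset ` H)" "finite (\<Union>(coset ` H))" using assms(1) by (auto simp: coset_def)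
    show "card c = p" if "c \<in> coset ` H" for c using that card_coset by auto
    show "c \<inter> d = {}" if cd: "c \<in> coset ` H" "d \<in> coset ` H" "c \<noteq> d" for c d
    proof (rule ccontr)
      assume "c \<inter> d \<noteq> {}"
      then obtain y where y: "y \<in> c" "y \<in> d" by blast
      obtain a b where "c = coset a" "d = coset b" using cd by blast
      then show False using coset_eq[of y a] coset_eq[of y b] y cd(3) by simp
    qed
  qed
  moreover have "\<Union>(coset ` H) = H"
  proof
    show "\<Union>(coset ` H) \<subseteq> H" using Hadd Hz by (auto simp: coset_def)
    show "H \<subseteq> \<Union>(coset ` H)" using self by blast
  qed
  ultimately show ?thesis by (metis dvd_triv_left)
qed

text \<open>Together with the zero vector these form a nontrivial finite group, whose order is
  divisible by \<open>p\<close>.\<close>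

lemma card_min_vectors:
  assumes V: "V \<in> vertices w"
  shows "\<not> p dvd card (min_vectors V)"
proof -
  let ?H = "N \<inter> min_lattice V"
  obtain z where z: "z \<in> ?H" "z \<noteq> 0" using minimal[OF V] by (auto simp: minimal_def)
  have fin: "finite ?H" by (rule N_finite[OF min_lattice(2)[OF V]])
  have "p dvd card ?H"
  proof (rule card_dvd_of_translation_invariant[OF fin _ z])
    fix x y assume "x \<in> ?H" "y \<in> ?H"
    then show "x - y \<in> ?H" using N_diff lattice_diff[OF min_lattice(2)[OF V]] by blast
  qed simp
  have "x - x \<in> ?H" if "x \<in> ?H" for x
    using that N_diff lattice_diff[OF min_lattice(2)[OF V]] by blast
  then have "0 \<in> ?H" using z(1) by fastforce
  then have "card ?H = Suc (card (min_vectors V))" unfolding min_vectors_def by (rule card.remove[OF fin])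
  show ?thesis
  proof
    assume "p dvd card (min_vectors V)"
    with \<open>p dvd card ?H\<close> have "p dvd 1"
      unfolding \<open>card ?H = Suc (card (min_vectors V))\<close> by (simp only: Suc_eq_plus1 dvd_add_right_iff)
    then show False using p_prime not_prime_unit by blast
  qed
qed

text \<open>Neighbours of a vertex correspond to lines in \<open>L\<close> modulo a uniformizer
  multiple of \<open>L\<close>; this is the preimage of the line spanned by \<open>x\<close>. All
  uniformizers are allowed so that none has to be fixed.\<close>

definition towards_lattice :: "('c^2) set \<Rightarrow> 'c^2 \<Rightarrow> ('c^2) set" where
  "towards_lattice L x = {a *s x + \<pi> *s y | a \<pi> y. a \<in> vball w 0 \<and> w \<pi> = 1 \<and> y \<in> L}"

definition towards :: "('c^2) set set \<Rightarrow> 'c^2 \<Rightarrow> ('c^2) set set" where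
  "towards V x = homothety_class (towards_lattice (min_lattice V) x)"

text \<open>A primitive vector has a unit among its coordinates, so it extends to a basis of
  \<open>L\<close>. Multiplying the other basis vector by a uniformizer gives a basis of the new
  lattice, whence \<open>ldet\<close> grows by 1.\<close>

lemma towards_lattice:
  assumes L: "is_lattice w L" and x: "x \<in> L" "\<forall>\<pi>. w \<pi> = 1 \<longrightarrow> x \<notin> scale_lattice \<pi> L"
  shows "is_lattice w (towards_lattice L x)" "ldet (towards_lattice L x) = ldet L + 1"
    "w \<pi> = 1 \<Longrightarrow> scale_lattice \<pi> L \<subset> towards_lattice L x" "towards_lattice L x \<subset> L"
    "x \<in> towards_lattice L x"
proof -
  obtain g where g: "invertible g" "L = lat g" using L by (auto simp: is_lattice_iff)
  obtain u where u: "u \<in> std_lattice w" "x = g *v u" using x(1) g(2) by (auto simp: lattice_of_def)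
  obtain \<pi>0 where pi: "\<pi>0 \<noteq> 0" "w \<pi>0 = 1" using uniformizer .
  have "\<exists>i. u $ i \<noteq> 0 \<and> w (u $ i) = 0"
  proof (rule ccontr)
    assume no: "\<not> ?thesis"
    have "u $ i / \<pi>0 \<in> vball w 0" for i
    proof (cases "u $ i = 0")
      case False
      then have "w (u $ i) \<noteq> 0" "u $ i \<in> vball w 0" using no u(1) by (auto simp: valuation_ring_eq_vball)
      then have "w (u $ i) \<ge> 1" using False by (auto simp: vball_def)
      then show ?thesis using False pi by (simp add: vball_def val_divide)
    qed simp
    then have "(\<chi> i. u $ i / \<pi>0) \<in> std_lattice w" by (simp add: valuation_ring_eq_vball)
    then have "g *v (\<chi> i. u $ i / \<pi>0) \<in> L" unfolding g(2) lattice_of_def by blast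
    moreover have "x = \<pi>0 *s (g *v (\<chi> i. u $ i / \<pi>0))"
      using pi by (simp add: u(2) vec2_eq_iff matrix_vector_mult_2 field_simps)
    ultimately have "x \<in> scale_lattice \<pi>0 L" unfolding scale_lattice_def by blast
    then show False using x(2) pi by blast
  qed
  then obtain i where i: "u $ i \<noteq> 0" "w (u $ i) = 0" by blast
  define j :: 2 where "j = 3 - i"
  have ij: "i = 1 \<and> j = 2 \<or> i = 2 \<and> j = 1" using exhaust_2[of i] by (auto simp: j_def)
  \<comment> \<open>Column \<open>i\<close> is \<open>u\<close>, whose entry \<open>u $ i\<close> is
    a unit, and column \<open>j\<close> is a uniformizer multiple of a unit vector; the determinant
    has value 1.\<close>
  define m :: "'c^2^2" where "m = (\<chi> r s. if s = i then u $ r else if r = j then \<pi>0 else 0)"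
  have det: "det m = \<pi>0 * u $ i" using ij by (auto simp: det_2 m_def)
  have mv: "m *v s = s $ i *s u + (\<chi> r. if r = j then \<pi>0 * s $ j else 0)" for s
    using ij by (auto simp: vec2_eq_iff matrix_vector_mult_2 m_def algebra_simps)
  have eq: "towards_lattice L x = lat (g ** m)"
  proof (intro equalityI subsetI)
    fix z assume "z \<in> towards_lattice L x"
    then obtain a \<pi> y where z: "z = a *s x + \<pi> *s (g *v y)" "a \<in> vball w 0" "w \<pi> = 1" "y \<in> std_lattice w"
      unfolding towards_lattice_def g(2) lattice_of_def by blast
    have yi: "y $ k \<in> vball w 0" for k using z(4) by (simp add: valuation_ring_eq_vball)
    have ui: "u $ k \<in> vball w 0" for k using u(1) by (simp add: valuation_ring_eq_vball)
    have inv: "inverse (u $ i) \<in> vball w 0" using i by (simp add: vball_def)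
    have pv: "\<pi> \<in> vball w 0" using z(3) by (simp add: vball_def)
    have q: "\<pi> / \<pi>0 \<in> vball w 0" using z(3) pi by (cases "\<pi> = 0") (auto simp: vball_def val_divide)
    \<comment> \<open>The solution of \<open>m *v s = a *s u + \<pi> *s y\<close>; it is integral
      because the only divisions are by the unit \<open>u $ i\<close> and of one uniformizer by
      another.\<close>
    define s :: "'c^2" where "s = (\<chi> r. if r = i then a + inverse (u $ i) * (\<pi> * y $ i)
      else \<pi> / \<pi>0 * (y $ j - inverse (u $ i) * (u $ j * y $ i)))"
    have "s $ r \<in> vball w 0" for r
      using z(2) yi ui inv pv q
      by (simp add: s_def vball_add vball_diff vball_mult0 del: times_divide_eq_left)
    then have "s \<in> std_lattice w" by (simp add: valuation_ring_eq_vball)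
    moreover have "m *v s = a *s u + \<pi> *s y"
      unfolding mv using ij i pi by (auto simp: vec2_eq_iff s_def field_simps)
    then have "z = (g ** m) *v s"
      by (simp add: z(1) u(2) vector_scalar_commute matrix_vector_right_distrib flip: matrix_vector_mul_assoc)
    ultimately show "z \<in> lat (g ** m)" unfolding lattice_of_def by blast
  next
    fix z assume "z \<in> lat (g ** m)"
    then obtain s where s: "s \<in> std_lattice w" "z = g *v (m *v s)"
      unfolding lattice_of_def by (auto simp: matrix_vector_mul_assoc)
    define y :: "'c^2" where "y = (\<chi> r. if r = j then s $ j else 0)"
    have si: "s $ k \<in> vball w 0" for k using s(1) by (simp add: valuation_ring_eq_vball)
    then have "y \<in> std_lattice w" by (simp add: valuation_ring_eq_vball y_def)
    moreover have "m *v s = s $ i *s u + \<pi>0 *s y" unfolding mv by (simp add: vec_eq_iff y_def)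
    then have "z = s $ i *s x + \<pi>0 *s (g *v y)"
      by (simp add: s(2) u(2) vector_scalar_commute matrix_vector_right_distrib)
    ultimately show "z \<in> towards_lattice L x"
      unfolding towards_lattice_def g(2) lattice_of_def using si pi by blast
  qed
  have "det m \<noteq> 0" using det i pi by simp
  then have inv: "invertible (g ** m)" using g(1) by (simp add: invertible_mult invertible_det_nz[of m])
  show lt: "is_lattice w (towards_lattice L x)" unfolding is_lattice_iff eq using inv by blast
  have "det g \<noteq> 0" using g(1) by (simp add: invertible_det_nz)
  then have "w (det (g ** m)) = w (det g) + 1" using i pi by (simp add: det_mul det val_mult)
  then show ld: "ldet (towards_lattice L x) = ldet L + 1"
    unfolding eq by (simp add: ldet[OF inv] ldet[OF g(1)] g(2))
  have sub: "towards_lattice L x \<subseteq> L"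
  proof
    fix z assume "z \<in> towards_lattice L x"
    then obtain a \<pi> y where z: "z = a *s x + \<pi> *s y" "a \<in> vball w 0" "w \<pi> = 1" "y \<in> L"
      unfolding towards_lattice_def by blast
    have "\<pi> \<in> vball w 0" using z(3) by (simp add: vball_def)
    then show "z \<in> L" using z x(1) lattice_add[OF L] lattice_smult[OF L] by simp
  qed
  then show "towards_lattice L x \<subset> L" using ld by (metis less_add_one order_less_irrefl psubsetI)
  show "scale_lattice \<pi> L \<subset> towards_lattice L x" if p: "w \<pi> = 1"
  proof -
    have "scale_lattice \<pi> L \<subseteq> towards_lattice L x"
    proof
      fix z assume "z \<in> scale_lattice \<pi> L"
      then obtain y where "y \<in> L" "z = 0 *s x + \<pi> *s y" by (auto simp: scale_lattice_def)
      then show "z \<in> towards_lattice L x" unfolding towards_lattice_def using p vball_0 by blast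
    qed
    moreover have "\<pi> \<noteq> 0" using p by auto
    then have "ldet (scale_lattice \<pi> L) = ldet L + 2" using ldet_scale[OF L] p by simp
    then have "scale_lattice \<pi> L \<noteq> towards_lattice L x" using ld by auto
    ultimately show ?thesis by blast
  qed
  have "0 \<in> L" using lat_0 g(2) by simp
  then have "1 *s x + \<pi>0 *s 0 \<in> towards_lattice L x"
    unfolding towards_lattice_def using pi vball_1 by blast
  then show "x \<in> towards_lattice L x" by simp
qed

lemma min_vectors_primitive:
  assumes V: "V \<in> vertices w" and x: "x \<in> min_vectors V"
  shows "x \<in> min_lattice V" "\<forall>\<pi>. w \<pi> = 1 \<longrightarrow> x \<notin> scale_lattice \<pi> (min_lattice V)"
  using x minimal[OF V] by (auto simp: min_vectors_def minimal_def)

text \<open>The minimal lattice of the neighbour is a multiple by some \<open>c\<close> of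
  \<open>towards_lattice\<close>, which contains \<open>x\<close>. If \<open>w c\<close> were
  negative, \<open>x\<close> would still lie in a uniformizer multiple of that minimal lattice. So
  \<open>w c\<close> is nonnegative and \<open>ldet\<close> grows by at least 1.\<close>

lemma towards_vertex:
  assumes V: "V \<in> vertices w" and x: "x \<in> min_vectors V"
  shows "towards V x \<in> vertices w" "(V, towards V x) \<in> edges w"
    "ldet (min_lattice V) < ldet (min_lattice (towards V x))"
proof -
  let ?L = "min_lattice V"
  note T = towards_lattice[OF min_lattice(2)[OF V] min_vectors_primitive[OF V x]]
  show TV: "towards V x \<in> vertices w" unfolding vertices_iff towards_def using T(1) by blast
  obtain \<pi> where pi: "\<pi> \<noteq> 0" "w \<pi> = 1" using uniformizer .
  have mem: "towards_lattice ?L x \<in> towards V x" unfolding towards_def by (rule homothety_class_self)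
  have "adjacent w V (towards V x)"
    unfolding adjacent_def using T(3)[OF pi(2)] T(4) mem min_lattice(1)[OF V] pi(2) by blast
  then show "(V, towards V x) \<in> edges w" using V TV by (simp add: edges_iff)
  obtain c where c: "c \<noteq> 0" "min_lattice (towards V x) = scale_lattice c (towards_lattice ?L x)"
    using vertex_member_scale[OF TV mem min_lattice(1)[OF TV]] .
  have "w c \<ge> 0"
  proof (rule ccontr)
    assume "\<not> w c \<ge> 0"
    then have "scale_lattice 1 (towards_lattice ?L x) \<subseteq> scale_lattice (\<pi> * c) (towards_lattice ?L x)"
      using pi c by (intro scale_lattice_mono T(1)) (auto simp: val_mult)
    then have "x \<in> scale_lattice \<pi> (min_lattice (towards V x))"
      using T(5) by (auto simp: c(2) scale_lattice_mult)
    then show False using minimal[OF TV] x pi unfolding minimal_def min_vectors_def by blast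
  qed
  then show "ldet ?L < ldet (min_lattice (towards V x))"
    unfolding c(2) ldet_scale[OF T(1) c(1)] T(2) by simp
qed

text \<open>A uniformizer multiple of the minimal lattice contains no nonzero point of
  \<open>N\<close>, so its \<open>ldet\<close>, larger by 2, exceeds \<open>- int C\<close>.\<close>

lemma ldet_min_lattice:
  assumes V: "V \<in> vertices w"
  shows "- int C - 2 < ldet (min_lattice V)"
proof (rule ccontr)
  assume neg: "\<not> ?thesis"
  obtain \<pi> where pi: "\<pi> \<noteq> 0" "w \<pi> = 1" using uniformizer .
  have "ldet (scale_lattice \<pi> (min_lattice V)) \<le> - int C"
    using neg ldet_scale[OF min_lattice(2)[OF V] pi(1)] pi(2) by simp
  then have "\<exists>x\<in>N. x \<noteq> 0 \<and> x \<in> scale_lattice \<pi> (min_lattice V)"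
    by (intro N_meets is_lattice_scale min_lattice V pi)
  then show False using minimal[OF V] pi(2) unfolding minimal_def by blast
qed

lemma G_image_N:
  assumes "g \<in> G"
  shows "g *v x \<in> N \<longleftrightarrow> x \<in> N"
proof
  assume "g *v x \<in> N"
  then have "matrix_inv g *v (g *v x) \<in> N" by (rule G_N[OF G_inverse[OF assms]])
  then show "x \<in> N" by (simp add: matrix_vector_mul_assoc matrix_inv_inverse[OF G_invertible[OF assms]])
qed (rule G_N[OF assms])

lemma G_mult_eq_0:
  assumes "g \<in> G"
  shows "g *v x = 0 \<longleftrightarrow> x = 0"
proof
  assume "g *v x = 0"
  then have "matrix_inv g *v (g *v x) = 0" by simp
  then show "x = 0" by (simp add: matrix_vector_mul_assoc matrix_inv_inverse[OF G_invertible[OF assms]])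
qed simp

text \<open>The minimal lattice is unique and \<open>G\<close> permutes \<open>N\<close>; this is
  the source of all equivariance below.\<close>

lemma min_lattice_action:
  assumes g: "g \<in> G" and V: "V \<in> vertices w"
  shows "min_lattice (vertex_action g V) = (\<lambda>u. g *v u) ` min_lattice V"
proof (rule min_lattice_eq)
  let ?L = "min_lattice V"
  show "vertex_action g V \<in> vertices w" by (rule vertex_action_vertex[OF G_invertible[OF g] V])
  have mem: "(\<lambda>u. g *v u) ` ?L \<in> vertex_action g V"
    unfolding vertex_action_def using min_lattice(1)[OF V] by blast
  obtain x where x: "x \<in> N" "x \<noteq> 0" "x \<in> ?L" using minimal[OF V] by (auto simp: minimal_def)
  have "g *v x \<noteq> 0" using G_mult_eq_0[OF g] x(2) by simp
  then have meets: "\<exists>x\<in>N. x \<noteq> 0 \<and> x \<in> (\<lambda>u. g *v u) ` ?L" using x G_N[OF g] by blast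
  have "x = 0" if x: "w \<pi> = 1" "x \<in> N" "x \<in> scale_lattice \<pi> ((\<lambda>u. g *v u) ` ?L)" for x \<pi>
  proof -
    obtain y where y: "y \<in> scale_lattice \<pi> ?L" "x = g *v y"
      using x(3) by (auto simp flip: matrix_image_scale)
    then have "y \<in> N" using x(2) G_image_N[OF g] by simp
    then have "y = 0" using minimal[OF V] x(1) y(1) by (auto simp: minimal_def)
    then show ?thesis using y(2) by simp
  qed
  then show "minimal (vertex_action g V) ((\<lambda>u. g *v u) ` ?L)"
    unfolding minimal_def using mem meets by blast
qed

lemma min_vectors_action:
  assumes g: "g \<in> G" and V: "V \<in> vertices w"
  shows "min_vectors (vertex_action g V) = (\<lambda>u. g *v u) ` min_vectors V"
  unfolding min_vectors_def min_lattice_action[OF g V]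
  using G_image_N[OF g] G_mult_eq_0[OF g] by auto

lemma towards_action:
  assumes g: "g \<in> G" and V: "V \<in> vertices w"
  shows "towards (vertex_action g V) (g *v x) = vertex_action g (towards V x)"
proof -
  have e: "g *v (a *s x + \<pi> *s y) = a *s (g *v x) + \<pi> *s (g *v y)" for a \<pi> y
    by (simp add: matrix_vector_right_distrib vector_scalar_commute)
  have "towards_lattice ((\<lambda>u. g *v u) ` L) (g *v x) = (\<lambda>u. g *v u) ` towards_lattice L x" for L
  proof (intro equalityI subsetI)
    fix z assume "z \<in> towards_lattice ((\<lambda>u. g *v u) ` L) (g *v x)"
    then obtain a \<pi> y where "z = g *v (a *s x + \<pi> *s y)" "a \<in> vball w 0" "w \<pi> = 1" "y \<in> L"
      unfolding towards_lattice_def e by blast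
    then show "z \<in> (\<lambda>u. g *v u) ` towards_lattice L x" unfolding towards_lattice_def by blast
  next
    fix z assume "z \<in> (\<lambda>u. g *v u) ` towards_lattice L x"
    then obtain a \<pi> y where "z = a *s (g *v x) + \<pi> *s (g *v y)" "a \<in> vball w 0" "w \<pi> = 1" "y \<in> L"
      unfolding towards_lattice_def by (auto simp: e)
    then show "z \<in> towards_lattice ((\<lambda>u. g *v u) ` L) (g *v x)" unfolding towards_lattice_def by blast
  qed
  then show ?thesis unfolding towards_def min_lattice_action[OF g V] vertex_action_class by simp
qed

text \<open>Different minimal vectors may point to the same neighbour. Counting them, rather than
  choosing one, keeps the construction equivariant.\<close>

definition edge_weight :: "('c^2) set set \<Rightarrow> ('c^2) set set \<Rightarrow> nat" where
  "edge_weight U V = card {x \<in> min_vectors U. towards U x = V}"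

lemma edge_weight_action:
  assumes g: "g \<in> G" and U: "U \<in> vertices w"
  shows "edge_weight (vertex_action g U) (vertex_action g V) = edge_weight U V"
proof -
  have inj: "inj ((*v) g)" by (rule inj_matrix_vector_mult[OF G_invertible[OF g]])
  have "A = B" if "vertex_action g A = vertex_action g B" for A B
    using arg_cong[OF that, of "vertex_action (matrix_inv g)"]
    by (simp only: vertex_action_inverse(1)[OF G_invertible[OF g]])
  then have "{x \<in> min_vectors (vertex_action g U). towards (vertex_action g U) x = vertex_action g V}
    = (\<lambda>u. g *v u) ` {x \<in> min_vectors U. towards U x = V}"
    unfolding min_vectors_action[OF g U] using towards_action[OF g U] by auto
  then show ?thesis unfolding edge_weight_def by (simp only: card_image[OF inj_on_subset[OF inj subset_UNIV]])
qed

lemma edge_weight_nonzero: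
  assumes U: "U \<in> vertices w" and "edge_weight U V \<noteq> 0"
  shows "(U, V) \<in> edges w" "ldet (min_lattice U) < ldet (min_lattice V)"
proof -
  obtain x where "x \<in> min_vectors U" "towards U x = V"
    using assms(2) unfolding edge_weight_def by (cases "{x \<in> min_vectors U. towards U x = V} = {}") auto
  then show "(U, V) \<in> edges w" "ldet (min_lattice U) < ldet (min_lattice V)"
    using towards_vertex[OF U] by auto
qed

lemma sum_edge_weight:
  assumes U: "U \<in> vertices w"
  shows "(\<Sum>V\<in>{V. (U, V) \<in> edges w}. edge_weight U V) = card (min_vectors U)"
proof -
  have "towards U ` min_vectors U \<subseteq> {V. (U, V) \<in> edges w}" using towards_vertex(2)[OF U] by auto
  from sum.group[OF finite_min_vectors[OF U] finite_neighbours[OF reps U] this, of "\<lambda>_. 1 :: nat"]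
  show ?thesis by (simp add: edge_weight_def)
qed

end


section \<open>Units of a local ring\<close>

lemma ideal_in_maximal_ideal:
  fixes I :: "'a::comm_ring_1 set"
  assumes I: "is_ideal I" "1 \<notin> I"
  shows "\<exists>M. is_maximal_ideal M \<and> I \<subseteq> M"
proof -
  let ?A = "{J. is_ideal J \<and> I \<subseteq> J \<and> 1 \<notin> J}"
  have "\<exists>M\<in>?A. \<forall>X\<in>?A. M \<subseteq> X \<longrightarrow> X = M"
  proof (rule subset_Zorn_nonempty)
    show "?A \<noteq> {}" using I by blast
    fix C assume C: "C \<noteq> {}" "subset.chain ?A C"
    then have C': "C \<subseteq> ?A" "\<forall>J\<in>C. \<forall>K\<in>C. J \<subseteq> K \<or> K \<subseteq> J"
      unfolding subset_chain_def by blast+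
    obtain J0 where J0: "J0 \<in> C" using C(1) by blast
    have "is_ideal (\<Union>C)"
      unfolding is_ideal_def
    proof (intro conjI ballI allI)
      show "0 \<in> \<Union>C" using J0 C'(1) unfolding is_ideal_def by blast
      fix x assume x: "x \<in> \<Union>C"
      then obtain J where J: "J \<in> C" "x \<in> J" by blast
      have Ji: "is_ideal J" using C'(1) J(1) by blast
      show "r * x \<in> \<Union>C" for r using Ji J unfolding is_ideal_def by blast
      fix y assume "y \<in> \<Union>C"
      then obtain K where K: "K \<in> C" "y \<in> K" by blast
      have Ki: "is_ideal K" using C'(1) K(1) by blast
      show "x + y \<in> \<Union>C"
      proof (cases "J \<subseteq> K")
        case True
        then have "x + y \<in> K" using Ki J(2) K(2) unfolding is_ideal_def by blast
        then show ?thesis using K(1) by blast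
      next
        case False
        then have "K \<subseteq> J" using C'(2) J(1) K(1) by blast
        then have "x + y \<in> J" using Ji J(2) K(2) unfolding is_ideal_def by blast
        then show ?thesis using J(1) by blast
      qed
    qed
    moreover have "I \<subseteq> \<Union>C" "1 \<notin> \<Union>C" using C'(1) J0 by blast+
    ultimately show "\<Union>C \<in> ?A" by blast
  qed
  then obtain M where M: "M \<in> ?A" "\<forall>X\<in>?A. M \<subseteq> X \<longrightarrow> X = M" by (elim bexE)
  have "J = M \<or> J = UNIV" if J: "is_ideal J" "M \<subseteq> J" for J
  proof (cases "1 \<in> J")
    case True
    then have "r * 1 \<in> J" for r using J(1) unfolding is_ideal_def by blast
    then show ?thesis by auto
  next
    case False
    then have "J \<in> ?A" using M(1) J by blast
    then show ?thesis using M(2) J(2) by blast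
  qed
  moreover have "is_ideal M" "M \<noteq> UNIV" "I \<subseteq> M" using M(1) by auto
  ultimately have "is_maximal_ideal M \<and> I \<subseteq> M" unfolding is_maximal_ideal_def by simp
  then show ?thesis ..
qed

text \<open>The principal ideal of a nonunit lies in some maximal ideal, and the kernel of \<rho> is
  the only one.\<close>

lemma local_ring_unit:
  fixes \<rho> :: "'r::comm_ring_1 \<Rightarrow> 'l::field"
  assumes loc: "local_ring TYPE('r)" and res: "residue_map \<rho>" and x: "\<rho> x \<noteq> 0"
  shows "\<exists>y. y * x = 1"
proof (rule ccontr)
  assume no: "\<not> ?thesis"
  let ?I = "range (\<lambda>r. r * x)"
  have "is_ideal ?I"
    unfolding is_ideal_def
  proof (intro conjI ballI allI)
    show "0 \<in> ?I" by (rule image_eqI[of _ _ 0]) simp_all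
    fix a assume "a \<in> ?I"
    then obtain r where r: "a = r * x" by blast
    show "c * a \<in> ?I" for c by (rule image_eqI[of _ _ "c * r"]) (simp_all add: r mult.assoc)
    fix b assume "b \<in> ?I"
    then obtain s where s: "b = s * x" by blast
    show "a + b \<in> ?I" by (rule image_eqI[of _ _ "r + s"]) (simp_all add: r s distrib_right)
  qed
  moreover have "1 \<notin> ?I"
  proof
    assume "1 \<in> ?I"
    then obtain r where "1 = r * x" by blast
    then have "r * x = 1" by simp
    then show False using no by blast
  qed
  ultimately obtain M where M: "is_maximal_ideal M" "?I \<subseteq> M" using ideal_in_maximal_ideal by blast
  have "is_maximal_ideal {x. \<rho> x = 0}" using res by (simp add: residue_map_def)
  moreover obtain m :: "'r set" where "\<forall>m'. is_maximal_ideal m' \<longrightarrow> m' = m"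
    using loc unfolding local_ring_def by blast
  ultimately have "M = {x. \<rho> x = 0}" using M(1) by metis
  moreover have "1 * x \<in> M" using M(2) by blast
  ultimately show False using x by simp
qed

section \<open>Equivariant flows\<close>

context lattice_points
begin

definition neighbours where "neighbours V = {U. (V, U) \<in> edges w}"

lemma neighbours_vertex: "U \<in> neighbours V \<Longrightarrow> U \<in> vertices w"
  by (simp add: neighbours_def edges_iff)

lemma edges_swap: "e \<in> edges w \<longleftrightarrow> reversed e \<in> edges w"
  using adjacent_sym by (cases e) (auto simp: edges_iff)

lemma vertex_action_inj:
  assumes "g \<in> G" "vertex_action g U = vertex_action g V"
  shows "U = V"
  using arg_cong[OF assms(2), of "vertex_action (matrix_inv g)"]
  by (simp only: vertex_action_inverse(1)[OF G_invertible[OF assms(1)]])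

lemma neighbours_action:
  assumes g: "g \<in> G"
  shows "neighbours (vertex_action g V) = vertex_action g ` neighbours V"
proof (intro equalityI subsetI)
  fix U assume U: "U \<in> neighbours (vertex_action g V)"
  define U' where "U' = vertex_action (matrix_inv g) U"
  have eq: "U = vertex_action g U'"
    by (simp add: U'_def vertex_action_inverse(2)[OF G_invertible[OF g]])
  then have "U' \<in> neighbours V"
    using U edge_action_iff[OF G_invertible[OF g]] by (simp add: neighbours_def)
  then show "U \<in> vertex_action g ` neighbours V" using eq by blast
next
  fix U assume "U \<in> vertex_action g ` neighbours V"
  then show "U \<in> neighbours (vertex_action g V)"
    using edge_action_iff[OF G_invertible[OF g]] by (auto simp: neighbours_def)
qed

lemma sum_neighbours_action:
  assumes "g \<in> G"
  shows "(\<Sum>U\<in>neighbours (vertex_action g V). F U) = (\<Sum>U\<in>neighbours V. F (vertex_action g U))"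
  unfolding neighbours_action[OF assms]
  using vertex_action_inj[OF assms] by (subst sum.reindex) (auto intro!: inj_onI)

lemma sum_edges_at: "(\<Sum>e | e \<in> edges w \<and> origin e = V. F e) = (\<Sum>U\<in>neighbours V. F (V, U))"
proof -
  have "{e. e \<in> edges w \<and> origin e = V} = Pair V ` neighbours V"
    by (auto simp: neighbours_def)
  then show ?thesis by (simp add: sum.reindex inj_on_def)
qed

text \<open>By the lower bound for \<open>ldet\<close> the argument of \<open>nat\<close> is
  positive, so truncation preserves strict increase.\<close>

definition height :: "('c^2) set set \<Rightarrow> nat" where
  "height V = nat (ldet (min_lattice V) + int C + 2)"

lemma height_less:
  assumes "U \<in> vertices w" "edge_weight U V \<noteq> 0"
  shows "height U < height V"
proof -
  have "V \<in> vertices w" using edge_weight_nonzero(1)[OF assms] by (simp add: edges_iff)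
  then show ?thesis
    using edge_weight_nonzero(2)[OF assms] ldet_min_lattice[OF assms(1)] by (simp add: height_def)
qed

text \<open>Every vertex pushes what it has received, plus \<open>h\<close>, along its outgoing edges in proportion to the
  edge weights; this terminates as the height increases along the edges used.\<close>

lemma ex_equivariant_flow:
  fixes h :: "('c^2) set set \<Rightarrow> 'r::comm_ring_1"
  assumes units: "\<forall>n. \<not> p dvd n \<longrightarrow> (\<exists>y::'r. y * of_nat n = 1)"
    and M: "is_ideal M" and h_M: "\<forall>V\<in>vertices w. h V \<in> M"
    and hG: "\<forall>g\<in>G. \<forall>V\<in>vertices w. h (vertex_action g V) = h V"
  shows "\<exists>f. (\<forall>e. f e \<in> M) \<and> (\<forall>e. e \<notin> edges w \<longrightarrow> f e = 0) \<and>
    (\<forall>e\<in>edges w. f (reversed e) = - f e) \<and>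
    (\<forall>V\<in>vertices w. (\<Sum>e | e \<in> edges w \<and> origin e = V. f e) = h V) \<and>
    (\<forall>g\<in>G. \<forall>e. f (edge_action g e) = f e)"
proof -
  have hM: "h V \<in> M" if "V \<in> vertices w" for V using h_M that by blast
  have M0: "0 \<in> M" and Madd: "\<And>x y. x \<in> M \<Longrightarrow> y \<in> M \<Longrightarrow> x + y \<in> M"
    and Mmult: "\<And>r x. x \<in> M \<Longrightarrow> r * x \<in> M" using M unfolding is_ideal_def by blast+
  have Mdiff: "x - y \<in> M" if "x \<in> M" "y \<in> M" for x y
    using Madd[OF that(1) Mmult[OF that(2), of "-1"]] by simp
  have Msum: "sum f I \<in> M" if "\<And>i. i \<in> I \<Longrightarrow> f i \<in> M" for f :: "('c^2) set set \<Rightarrow> 'r" and I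
    using that by (induction I rule: infinite_finite_induct) (auto intro: M0 Madd)
  define recip :: "nat \<Rightarrow> 'r" where "recip n = (SOME y. y * of_nat n = 1)" for n
  have recip: "recip n * of_nat n = 1" if n: "\<not> p dvd n" for n
  proof -
    obtain y :: 'r where "y * of_nat n = 1" using units n by blast
    then show ?thesis unfolding recip_def by (rule someI)
  qed
  \<comment> \<open>The share of the content of \<open>U\<close> that is sent to \<open>V\<close>.
    The denominator is a unit by \<open>card_min_vectors\<close>, and the shares of each vertex add
    up to 1.\<close>
  define a where "a U V = of_nat (edge_weight U V) * recip (card (min_vectors U))" for U V
  have a_G: "a (vertex_action g U) (vertex_action g V) = a U V" if g: "g \<in> G" and U: "U \<in> vertices w" for g U V
  proof -
    have "inj ((*v) g)" by (rule inj_matrix_vector_mult[OF G_invertible[OF g]])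
    then have "card (min_vectors (vertex_action g U)) = card (min_vectors U)"
      unfolding min_vectors_action[OF g U] by (rule card_image[OF inj_on_subset[OF _ subset_UNIV]])
    then show ?thesis by (simp add: a_def edge_weight_action[OF g U])
  qed
  have a_sum: "(\<Sum>U\<in>neighbours V. a V U) = 1" if V: "V \<in> vertices w" for V
  proof -
    have "(\<Sum>U\<in>neighbours V. a V U) = (\<Sum>U\<in>neighbours V. of_nat (edge_weight V U)) * recip (card (min_vectors V))"
      unfolding a_def by (rule sum_distrib_right[symmetric])
    also have "(\<Sum>U\<in>neighbours V. of_nat (edge_weight V U) :: 'r) = of_nat (\<Sum>U\<in>neighbours V. edge_weight V U)"
      by (rule of_nat_sum[symmetric])
    also have "of_nat (\<Sum>U\<in>neighbours V. edge_weight V U) * recip (card (min_vectors V))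
        = recip (card (min_vectors V)) * of_nat (card (min_vectors V))"
      unfolding neighbours_def sum_edge_weight[OF V] by (rule mult.commute)
    also have "\<dots> = 1" by (rule recip[OF card_min_vectors[OF V]])
    finally show ?thesis .
  qed
  have a_height: "height U < height V" if "U \<in> vertices w" "a U V \<noteq> 0" for U V
  proof (rule height_less[OF that(1)])
    show "edge_weight U V \<noteq> 0" using that(2) unfolding a_def by (metis mult_zero_left of_nat_0)
  qed
  \<comment> \<open>Well-founded recursion by iteration: \<open>T k\<close> has reached its final
    value at the vertices of height below \<open>k\<close>. Recursion on \<open>k\<close> makes
    invariance and membership in \<open>M\<close> plain inductions.\<close>
  define T where "T = rec_nat (\<lambda>_. 0) (\<lambda>k t V. h V + (\<Sum>U\<in>neighbours V. a U V * t U))"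
  have T0: "T 0 V = 0" and TS: "T (Suc k) V = h V + (\<Sum>U\<in>neighbours V. a U V * T k U)" for k V
    by (simp_all add: T_def)
  have TM: "T k V \<in> M" if "V \<in> vertices w" for k V
    using that
  proof (induction k arbitrary: V)
    case 0
    then show ?case by (simp add: T0 M0)
  next
    case (Suc k)
    show ?case unfolding TS
      using Suc neighbours_vertex by (intro Madd hM Msum Mmult) auto
  qed
  have TG: "T k (vertex_action g V) = T k V" if "g \<in> G" "V \<in> vertices w" for k g V
    using that
  proof (induction k arbitrary: V)
    case 0
    then show ?case by (simp add: T0)
  next
    case (Suc k)
    have "(\<Sum>U\<in>neighbours V. a (vertex_action g U) (vertex_action g V) * T k (vertex_action g U))
        = (\<Sum>U\<in>neighbours V. a U V * T k U)"
      using Suc neighbours_vertex by (intro sum.cong refl) (simp add: a_G)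
    then show ?case unfolding TS sum_neighbours_action[OF Suc.prems(1)] using hG Suc.prems by simp
  qed
  have stable: "T (Suc k) V = T k V" if "V \<in> vertices w" "height V < k" for k V
    using that
  proof (induction k arbitrary: V)
    case (Suc k)
    have "a U V * T (Suc k) U = a U V * T k U" if U: "U \<in> neighbours V" for U
    proof (cases "a U V = 0")
      case False
      have "height U < height V" by (rule a_height[OF neighbours_vertex[OF U] False])
      then have "T (Suc k) U = T k U" using Suc.prems neighbours_vertex[OF U] by (intro Suc.IH) auto
      then show ?thesis by simp
    qed simp
    then have "(\<Sum>U\<in>neighbours V. a U V * T (Suc k) U) = (\<Sum>U\<in>neighbours V. a U V * T k U)"
      by (intro sum.cong refl)
    then show ?case using TS[of "Suc k" V] TS[of k V] by simp
  qed simp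
  define S where "S V = T (Suc (height V)) V" for V
  have S_eq: "T k V = S V" if "V \<in> vertices w" "Suc (height V) \<le> k" for k V
    using that(2)
  proof (induction k rule: nat_induct_at_least)
    case base
    show ?case by (simp add: S_def)
  next
    case (Suc k)
    then show ?case using stable[OF that(1), of k] by simp
  qed
  have S_rec: "S V = h V + (\<Sum>U\<in>neighbours V. a U V * S U)" if V: "V \<in> vertices w" for V
  proof -
    have "a U V * T (height V) U = a U V * S U" if U: "U \<in> neighbours V" for U
    proof (cases "a U V = 0")
      case False
      have "height U < height V" by (rule a_height[OF neighbours_vertex[OF U] False])
      then show ?thesis using S_eq[OF neighbours_vertex[OF U], of "height V"] by simp
    qed simp
    then have "(\<Sum>U\<in>neighbours V. a U V * T (height V) U) = (\<Sum>U\<in>neighbours V. a U V * S U)"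
      by (intro sum.cong refl)
    then show ?thesis unfolding S_def TS by simp
  qed
  have SM: "S V \<in> M" if "V \<in> vertices w" for V unfolding S_def by (rule TM[OF that])
  have SG: "S (vertex_action g V) = S V" if g: "g \<in> G" and V: "V \<in> vertices w" for g V
  proof -
    let ?k = "Suc (height V + height (vertex_action g V))"
    have "T ?k (vertex_action g V) = S (vertex_action g V)"
      by (rule S_eq[OF vertex_action_vertex[OF G_invertible[OF g] V]]) simp
    moreover have "T ?k V = S V" by (rule S_eq[OF V]) simp
    ultimately show ?thesis using TG[OF g V] by metis
  qed
  \<comment> \<open>Outflow minus inflow along the edge. At \<open>V\<close> the total outflow is
    \<open>S V\<close>, and the total inflow is \<open>S V - h V\<close> by the recursion.\<close>
  define f where "f e = (if e \<in> edges w then a (fst e) (snd e) * S (fst e) - a (snd e) (fst e) * S (snd e) else 0)" for e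
  have ev: "fst e \<in> vertices w" "snd e \<in> vertices w" if "e \<in> edges w" for e
    using that by (cases e; simp add: edges_iff)+
  have "f e \<in> M" for e using ev[of e] SM by (auto simp: f_def intro: M0 Mdiff Mmult)
  moreover have "f (reversed e) = - f e" if "e \<in> edges w" for e
    using that edges_swap[of e] by (simp add: f_def)
  moreover have "(\<Sum>e | e \<in> edges w \<and> origin e = V. f e) = h V" if V: "V \<in> vertices w" for V
  proof -
    have "(\<Sum>e | e \<in> edges w \<and> origin e = V. f e) = (\<Sum>U\<in>neighbours V. a V U * S V - a U V * S U)"
      unfolding sum_edges_at by (rule sum.cong) (auto simp: f_def neighbours_def)
    also have "\<dots> = (\<Sum>U\<in>neighbours V. a V U) * S V - (\<Sum>U\<in>neighbours V. a U V * S U)"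
      by (simp add: sum_subtractf sum_distrib_right)
    also have "\<dots> = h V" using S_rec[OF V] by (simp add: a_sum[OF V])
    finally show ?thesis .
  qed
  moreover have "f (edge_action g e) = f e" if g: "g \<in> G" for g e
  proof -
    have "edge_action g e \<in> edges w \<longleftrightarrow> e \<in> edges w"
      using edge_action_iff[OF G_invertible[OF g]] by (cases e) (simp add: edge_action_def)
    then show ?thesis using ev[of e] g by (simp add: f_def edge_action_def a_G SG)
  qed
  ultimately show ?thesis by (intro exI[of _ f]) (simp add: f_def)
qed

section \<open>Lifting and reducing invariant cocycles\<close>

lemma lift_invariant_cocycle:
  fixes \<rho> :: "'r::comm_ring_1 \<Rightarrow> 'l::field"
  assumes loc: "local_ring TYPE('r)" and res: "residue_map \<rho>" and char: "CHAR('l) = p"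
    and f0: "f0 \<in> invariant_cocycles w G"
  shows "\<exists>f\<in>invariant_cocycles w G. \<rho> \<circ> f = f0"
proof -
  have hom: "\<rho> 1 = 1" "\<And>x y. \<rho> (x + y) = \<rho> x + \<rho> y" "\<And>x y. \<rho> (x * y) = \<rho> x * \<rho> y" "surj \<rho>"
    using res by (auto simp: residue_map_def is_ring_hom_def)
  have rho0: "\<rho> 0 = 0" using hom(2)[of 0 0] by (simp only: add_0_left add_cancel_right_right)
  have rho_minus: "\<rho> (- x) = - \<rho> x" for x
    using hom(2)[of x "- x"] by (simp add: rho0 eq_neg_iff_add_eq_0 add.commute)
  have rho_sum: "\<rho> (sum f I) = (\<Sum>i\<in>I. \<rho> (f i))" for f :: "('c edge) \<Rightarrow> 'r" and I
    by (induction I rule: infinite_finite_induct) (simp_all add: rho0 hom)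
  have rho_nat: "\<rho> (of_nat n) = of_nat n" for n by (induction n) (simp_all add: rho0 hom)
  have f0_edges: "f0 e = 0" if "e \<notin> edges w" for e
    using f0 that unfolding invariant_cocycles_def harmonic_cocycles_def by blast
  have f0_rev: "f0 (reversed e) = - f0 e" if "e \<in> edges w" for e
    using f0 that unfolding invariant_cocycles_def harmonic_cocycles_def by blast
  have f0_harm: "(\<Sum>e | e \<in> edges w \<and> origin e = V. f0 e) = 0" if "V \<in> vertices w" for V
    using f0 that unfolding invariant_cocycles_def harmonic_cocycles_def by blast
  have f0_G: "f0 (edge_action g e) = f0 e" if g: "g \<in> G" for g e
  proof -
    have "matrix_inv (matrix_inv g) = g"
      by (rule matrix_inv_unique[OF matrix_inv_inverse(2)[OF G_invertible[OF g]]])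
    moreover have "cochain_action (matrix_inv g) f0 = f0"
      using f0 G_inverse[OF g] unfolding invariant_cocycles_def by blast
    then have "f0 (edge_action (matrix_inv (matrix_inv g)) e) = f0 e"
      unfolding cochain_action_def by (rule fun_cong)
    ultimately show ?thesis by simp
  qed
  \<comment> \<open>Zero is lifted to zero so that \<open>l\<close> vanishes off the edges.\<close>
  define \<sigma> where "\<sigma> x = (if x = 0 then 0 else inv_into UNIV \<rho> x)" for x
  have sigma: "\<rho> (\<sigma> x) = x" for x using hom(4) by (simp add: \<sigma>_def rho0 surj_f_inv_f)
  text \<open>Orienting the edges from even to odd vertices gives an alternating equivariant lift.\<close>
  define l where "l e = (if even_vertex (fst e) then \<sigma> (f0 e) else - \<sigma> (f0 (reversed e)))" for e
  have l_edges: "l e = 0" if "e \<notin> edges w" for e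
    using that edges_swap[of e] by (simp add: l_def f0_edges \<sigma>_def)
  have parity: "even_vertex (snd e) \<longleftrightarrow> \<not> even_vertex (fst e)" if "e \<in> edges w" for e
    using that adjacent_even by (cases e) (simp add: edges_iff)
  have l_rev: "l (reversed e) = - l e" if "e \<in> edges w" for e
    using parity[OF that] by (simp add: l_def)
  have rho_l: "\<rho> (l e) = f0 e" for e
  proof (cases "e \<in> edges w")
    case True
    then show ?thesis using f0_rev[OF True] by (simp add: l_def sigma rho_minus)
  qed (simp add: l_edges f0_edges rho0)
  have edge_G: "edge_action g e \<in> edges w \<longleftrightarrow> e \<in> edges w" if "g \<in> G" for g e
    using edge_action_iff[OF G_invertible[OF that]] by (cases e) (simp add: edge_action_def)
  have l_G: "l (edge_action g e) = l e" if g: "g \<in> G" for g e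
  proof (cases "e \<in> edges w")
    case True
    then have "fst e \<in> vertices w" by (cases e) (simp add: edges_iff)
    then have "even_vertex (fst (edge_action g e)) = even_vertex (fst e)"
      using even_vertex_action[OF G_invertible[OF g] G_det[OF g]] by (simp add: edge_action_def)
    moreover have "reversed (edge_action g e) = edge_action g (reversed e)"
      by (cases e) (simp add: edge_action_def)
    ultimately show ?thesis by (simp add: l_def f0_G[OF g])
  next
    case False
    then show ?thesis using edge_G[OF g] by (simp add: l_edges)
  qed
  \<comment> \<open>The defect of harmonicity of \<open>l\<close>, with opposite sign; it reduces to
    0 because \<open>f0\<close> is harmonic.\<close>
  define h where "h V = - (\<Sum>e | e \<in> edges w \<and> origin e = V. l e)" for V
  let ?M = "{x. \<rho> x = 0}"
  have ideal: "is_ideal ?M" using res by (simp add: residue_map_def is_maximal_ideal_def)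
  have hM: "\<forall>V\<in>vertices w. h V \<in> ?M"
    using f0_harm by (simp add: h_def rho_minus rho_sum rho_l)
  have hG: "\<forall>g\<in>G. \<forall>V\<in>vertices w. h (vertex_action g V) = h V"
  proof (intro ballI)
    fix g V assume g: "g \<in> G"
    have "l (vertex_action g V, vertex_action g U) = l (V, U)" for U
      using l_G[OF g, of "(V, U)"] by (simp add: edge_action_def)
    then show "h (vertex_action g V) = h V"
      unfolding h_def sum_edges_at sum_neighbours_action[OF g] by simp
  qed
  have units: "\<forall>n. \<not> p dvd n \<longrightarrow> (\<exists>y::'r. y * of_nat n = 1)"
  proof (intro allI impI)
    fix n assume "\<not> p dvd n"
    then have "\<rho> (of_nat n) \<noteq> 0" using char by (simp add: rho_nat of_nat_eq_0_iff_char_dvd)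
    then show "\<exists>y::'r. y * of_nat n = 1" by (rule local_ring_unit[OF loc res])
  qed
  obtain f where f: "\<forall>e. f e \<in> ?M" "\<forall>e. e \<notin> edges w \<longrightarrow> f e = 0"
    "\<forall>e\<in>edges w. f (reversed e) = - f e"
    "\<forall>V\<in>vertices w. (\<Sum>e | e \<in> edges w \<and> origin e = V. f e) = h V"
    "\<forall>g\<in>G. \<forall>e. f (edge_action g e) = f e"
    using ex_equivariant_flow[of ?M h, OF units ideal hM hG] by (elim exE conjE)
  define F where "F e = l e + f e" for e
  have "F \<in> harmonic_cocycles w"
    unfolding harmonic_cocycles_def
  proof (intro CollectI conjI allI impI ballI)
    show "F e = 0" if "e \<notin> edges w" for e
      using spec[OF f(2), of e] that by (simp add: F_def l_edges)
    show "F (reversed e) = - F e" if "e \<in> edges w" for e using f(3) that by (simp add: F_def l_rev)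
    show "(\<Sum>e | e \<in> edges w \<and> origin e = V. F e) = 0" if "V \<in> vertices w" for V
      using f(4) that by (simp add: F_def sum.distrib h_def)
  qed
  moreover have "cochain_action g F = F" if "g \<in> G" for g
    using l_G[OF G_inverse[OF that]] f(5) G_inverse[OF that] by (simp add: cochain_action_def F_def fun_eq_iff)
  ultimately have "F \<in> invariant_cocycles w G" by (simp add: invariant_cocycles_def)
  moreover have "\<rho> \<circ> F = f0" using f(1) by (simp add: fun_eq_iff F_def hom rho_l)
  ultimately show ?thesis by blast
qed

end

text \<open>The easy inclusion: all conditions are equations with integer coefficients, which a ring
  homomorphism preserves.\<close>

lemma reduction_invariant_cocycle:
  fixes \<rho> :: "'r::comm_ring_1 \<Rightarrow> 'l::comm_ring_1"
  assumes hom: "is_ring_hom \<rho>" and f: "f \<in> invariant_cocycles w G"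
  shows "\<rho> \<circ> f \<in> invariant_cocycles w G"
proof -
  have add: "\<And>x y. \<rho> (x + y) = \<rho> x + \<rho> y" using hom by (simp add: is_ring_hom_def)
  have rho0: "\<rho> 0 = 0" using add[of 0 0] by (simp only: add_0_left add_cancel_right_right)
  have rho_minus: "\<rho> (- x) = - \<rho> x" for x
    using add[of x "- x"] by (simp add: rho0 eq_neg_iff_add_eq_0 add.commute)
  have rho_sum: "\<rho> (sum f I) = (\<Sum>i\<in>I. \<rho> (f i))" for f :: "('c edge) \<Rightarrow> 'r" and I
    by (induction I rule: infinite_finite_induct) (simp_all add: rho0 add)
  have "f \<in> harmonic_cocycles w" and inv: "\<And>g. g \<in> G \<Longrightarrow> cochain_action g f = f"
    using f by (auto simp: invariant_cocycles_def)
  then have "\<rho> \<circ> f \<in> harmonic_cocycles w"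
    unfolding harmonic_cocycles_def
    by (simp add: rho0 rho_minus flip: rho_sum)
  moreover have "cochain_action g (\<rho> \<circ> f) = \<rho> \<circ> f" if "g \<in> G" for g
    using inv[OF that] by (simp add: cochain_action_def fun_eq_iff)
  ultimately show ?thesis by (simp add: invariant_cocycles_def)
qed

section \<open>From the arithmetic group to the tree argument\<close>

context arithmetic_place
begin

lemma ex_lattice_points:
  assumes "prime p" "CHAR('a) = p"
  shows "\<exists>D C. lattice_points w D N C p (map_matrix \<iota> ` \<Gamma>)"
proof -
  obtain D where D: "residue_reps v D" using finite_residue_field[OF dv] ..
  obtain C :: nat where C: "\<forall>g. invertible g \<longrightarrow> w (det g) \<le> - int C \<longrightarrow> (\<exists>x\<in>N. x \<noteq> 0 \<and> x \<in> lattice_of w g)"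
    using N_minkowski ..
  have "lattice_points w (\<iota> ` D) N C p (map_matrix \<iota> ` \<Gamma>)"
  proof unfold_locales
    show "residue_reps w (\<iota> ` D)" by (rule residue_reps_iota[OF D])
    show "finite (N \<inter> L)" if "is_lattice w L" for L
      using that N_finite by (auto simp: w.is_lattice_iff)
    show "\<exists>x\<in>N. x \<noteq> 0 \<and> x \<in> L" if "is_lattice w L" "w.ldet L \<le> - int C" for L
      using that C by (auto simp: w.is_lattice_iff w.ldet)
    show "of_nat p *s x = 0" if "x \<in> N" for x by (rule N_char[OF assms(2) that])
  qed (use assms in \<open>simp_all add: N_0 N_diff iota_Gamma N_Gamma\<close>)
  then show ?thesis by blast
qed

end

theorem mainTheorem3:
  fixes p :: nat
    and v :: "'k::field \<Rightarrow> int"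
    and w :: "'c::field \<Rightarrow> int"
    and \<iota> :: "'k \<Rightarrow> 'c"
    and \<rho> :: "'r::comm_ring_1 \<Rightarrow> 'l::field"
    and \<Gamma> :: "('k^2^2) set"
  assumes "p > 0"
    and "global_function_field TYPE('k)" and "CHAR('k) = p"
    and "discrete_valuation v"
    and "is_completion v w \<iota>"
    and "arithmetic_subgroup v \<Gamma>"
    and "local_ring TYPE('r)" and "CHAR('r) = 0"
    and "residue_map \<rho>" and "CHAR('l) = p"
  shows "(\<lambda>f :: 'c edge \<Rightarrow> 'r. \<rho> \<circ> f) ` invariant_cocycles w (map_matrix \<iota> ` \<Gamma>)
       = (invariant_cocycles w (map_matrix \<iota> ` \<Gamma>) :: ('c edge \<Rightarrow> 'l) set)"
proof (intro equalityI subsetI)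
  fix f0 :: "'c edge \<Rightarrow> 'l"
  assume f0: "f0 \<in> invariant_cocycles w (map_matrix \<iota> ` \<Gamma>)"
  obtain F :: "'k set" and t B where F: "is_subfield F" "finite F" "finite B"
    "\<forall>x. \<exists>c. (\<forall>b\<in>B. c b \<in> field_adjoin F t) \<and> x = (\<Sum>b\<in>B. c b * b)"
    using assms(2) unfolding global_function_field_def by (elim exE conjE)
  interpret arithmetic_place F t B v w \<iota> \<Gamma>
    by unfold_locales (use F assms in simp_all)
  have "prime p" using assms(1,10) prime_CHAR_semidom[where 'a = 'l] by simp
  then obtain D C where "lattice_points w D N C p (map_matrix \<iota> ` \<Gamma>)"
    using ex_lattice_points assms(3) by blast
  then interpret lattice_points w D N C p "map_matrix \<iota> ` \<Gamma>" .
  show "f0 \<in> (\<lambda>f :: 'c edge \<Rightarrow> 'r. \<rho> \<circ> f) ` invariant_cocycles w (map_matrix \<iota> ` \<Gamma>)"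
    using lift_invariant_cocycle[OF assms(7,9,10) f0] by blast
next
  have "is_ring_hom \<rho>" using assms(9) by (simp add: residue_map_def)
  then show "f0 \<in> invariant_cocycles w (map_matrix \<iota> ` \<Gamma>)"
    if "f0 \<in> (\<lambda>f :: 'c edge \<Rightarrow> 'r. \<rho> \<circ> f) ` invariant_cocycles w (map_matrix \<iota> ` \<Gamma>)" for f0
    using that reduction_invariant_cocycle by blast
qed

end
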